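(* Let $X=\bigvee^wS^1\cup(D^2_1\cup\cdots\cup D^2_r)$ be a two dimensional CW complex whose one-skeleton is a bouquet of $w$ circles, with two-cells $D^2_1,\dots,D^2_r$, and let $n\ge1$. Then $\overline{SP}^n(X)$ is $(2n-\min(w,n)-1)$-connected.
   Context: $SP^n(X)=X^n/\mathfrak S_n$ is the $n$-th symmetric product, with $SP^0(X)$ a point. For $X$ based at $*$ (here the wedge point of the bouquet), $SP^{n-1}(X)$ is embedded in $SP^n(X)$ by $[x_1,\dots,x_{n-1}]\mapsto[*,x_1,\dots,x_{n-1}]$, and $\overline{SP}^n(X)=SP^n(X)/SP^{n-1}(X)$. A space $Y$ is $m$-connected if $\pi_i(Y)=0$ for $0\le i\le m$. *)

theory Defs
  imports "HOL-Analysis.Analysis"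
begin

subsection \<open>Quotient spaces\<close>

text \<open>The final topology on the set \<open>C\<close> for \<open>q : X \<rightarrow> C\<close>; if \<open>q\<close> is onto \<open>C\<close> it is the
  quotient topology (lemma \<open>quotient_map_final_topology\<close> below).\<close>

definition final_topology :: "'a topology \<Rightarrow> ('a \<Rightarrow> 'b) \<Rightarrow> 'b set \<Rightarrow> 'b topology"
  where "final_topology X q C =
    topology (\<lambda>U. U \<subseteq> C \<and> openin X {x \<in> topspace X. q x \<in> U})"

lemma openin_final_topology:
  "openin (final_topology X q C) U \<longleftrightarrow> U \<subseteq> C \<and> openin X {x \<in> topspace X. q x \<in> U}"
proof -
  have "istopology (\<lambda>U. U \<subseteq> C \<and> openin X {x \<in> topspace X. q x \<in> U})"
    unfolding istopology_def
  proof (intro conjI allI impI)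
    fix S T assume S: "S \<subseteq> C \<and> openin X {x \<in> topspace X. q x \<in> S}"
      and T: "T \<subseteq> C \<and> openin X {x \<in> topspace X. q x \<in> T}"
    have "{x \<in> topspace X. q x \<in> S \<inter> T} =
        {x \<in> topspace X. q x \<in> S} \<inter> {x \<in> topspace X. q x \<in> T}" by auto
    with S T show "openin X {x \<in> topspace X. q x \<in> S \<inter> T}" by auto
    show "S \<inter> T \<subseteq> C" using S by auto
  next
    fix \<K> assume K: "\<forall>K\<in>\<K>. K \<subseteq> C \<and> openin X {x \<in> topspace X. q x \<in> K}"
    have "{x \<in> topspace X. q x \<in> \<Union>\<K>} = (\<Union>K\<in>\<K>. {x \<in> topspace X. q x \<in> K})" by auto
    with K show "openin X {x \<in> topspace X. q x \<in> \<Union>\<K>}" by auto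
    show "\<Union>\<K> \<subseteq> C" using K by auto
  qed
  then show ?thesis by (simp add: final_topology_def)
qed

lemma topspace_final_topology:
  assumes "q ` topspace X \<subseteq> C"
  shows "topspace (final_topology X q C) = C"
proof -
  have "{x \<in> topspace X. q x \<in> C} = topspace X" using assms by auto
  then have "openin (final_topology X q C) C" by (simp add: openin_final_topology)
  then show ?thesis
    by (metis openin_final_topology openin_subset openin_topspace subset_antisym)
qed

lemma quotient_map_final_topology:
  "quotient_map X (final_topology X q (q ` topspace X)) q"
  by (simp add: quotient_map_def topspace_final_topology openin_final_topology)

text \<open>\<open>X/A\<close>: the subset \<open>A\<close> is collapsed to the single point \<open>A\<close>, every other point \<open>x\<close>
  becomes \<open>{x}\<close>. With the usual convention, \<open>X/{}\<close> is \<open>X\<close> with an added isolated point.\<close>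

definition collapse_map :: "'a set \<Rightarrow> 'a \<Rightarrow> 'a set"
  where "collapse_map A x = (if x \<in> A then A else {x})"

definition collapse :: "'a topology \<Rightarrow> 'a set \<Rightarrow> 'a set topology"
  where "collapse X A = final_topology X (collapse_map A) (insert A (collapse_map A ` topspace X))"

subsection \<open>Two-dimensional complexes over a bouquet of circles\<close>

text \<open>The wedge of \<open>w\<close> circles based at \<open>1\<close>. By the convention on \<open>X/{}\<close> the wedge of no
  circles is a point.\<close>

definition wedge_point :: "nat \<Rightarrow> (nat \<times> complex) set"
  where "wedge_point w = {..<w} \<times> {1}"

definition bouquet :: "nat \<Rightarrow> (nat \<times> complex) set topology"
  where "bouquet w =
    collapse (sum_topology (\<lambda>_. top_of_set (sphere (0::complex) 1)) {..<w}) (wedge_point w)"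

text \<open>\<open>X\<close> is obtained from its subspace \<open>S\<close> by attaching \<open>r\<close> two-cells with characteristic maps
  \<open>\<Phi> j\<close>; the attaching maps are the restrictions of the \<open>\<Phi> j\<close> to the unit circle. The last
  condition says that \<open>X\<close> carries the quotient topology from the disjoint union of \<open>S\<close> and the
  discs.\<close>

definition attach_two_cells :: "'a topology \<Rightarrow> 'a set \<Rightarrow> nat \<Rightarrow> (nat \<Rightarrow> complex \<Rightarrow> 'a) \<Rightarrow> bool"
  where "attach_two_cells X S r \<Phi> \<longleftrightarrow>
    S \<subseteq> topspace X \<and>
    (\<forall>j<r. continuous_map (top_of_set (cball 0 1)) X (\<Phi> j) \<and> \<Phi> j ` sphere 0 1 \<subseteq> S) \<and>
    bij_betw (\<lambda>(j, z). \<Phi> j z) ({..<r} \<times> ball 0 1) (topspace X - S) \<and>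
    (\<forall>U \<subseteq> topspace X.
       openin X U \<longleftrightarrow>
         openin (subtopology X S) (U \<inter> S) \<and>
         (\<forall>j<r. openin (top_of_set (cball 0 1)) {z \<in> cball 0 1. \<Phi> j z \<in> U}))"

text \<open>\<open>S\<close> is the one-skeleton of \<open>X\<close> and \<open>e\<close> the wedge point of the bouquet.\<close>

definition two_complex_over_bouquet :: "'a topology \<Rightarrow> 'a \<Rightarrow> nat \<Rightarrow> nat \<Rightarrow> bool"
  where "two_complex_over_bouquet X e w r \<longleftrightarrow>
    (\<exists>S h \<Phi>. homeomorphic_map (bouquet w) (subtopology X S) h \<and> h (wedge_point w) = e \<and>
             attach_two_cells X S r \<Phi>)"

subsection \<open>Symmetric products\<close>

text \<open>A point of \<open>X\<^sup>n\<close> is an extensional function on \<open>{..<n}\<close>; \<open>sp_class n x\<close> is its orbit under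
  the symmetric group.\<close>

definition sp_class :: "nat \<Rightarrow> (nat \<Rightarrow> 'a) \<Rightarrow> (nat \<Rightarrow> 'a) set"
  where "sp_class n x = {x \<circ> p | p. p permutes {..<n}}"

definition sym_prod :: "nat \<Rightarrow> 'a topology \<Rightarrow> (nat \<Rightarrow> 'a) set topology"
  where "sym_prod n X =
    (let P = product_topology (\<lambda>_. X) {..<n} in final_topology P (sp_class n) (sp_class n ` topspace P))"

text \<open>The embedding \<open>[x\<^sub>1,\<dots>,x\<^sub>n] \<mapsto> [e,x\<^sub>1,\<dots>,x\<^sub>n]\<close>. All representatives of \<open>c\<close> contribute the same
  orbit (lemma \<open>sp_incl_class\<close>), so the union is that orbit.\<close>

definition sp_incl :: "'a \<Rightarrow> nat \<Rightarrow> (nat \<Rightarrow> 'a) set \<Rightarrow> (nat \<Rightarrow> 'a) set"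
  where "sp_incl e n c = (\<Union>x\<in>c. sp_class (Suc n) (case_nat e x))"

lemma sp_class_comp:
  assumes "p permutes {..<n}"
  shows "sp_class n (x \<circ> p) = sp_class n x"
proof -
  have "x \<circ> q \<in> sp_class n (x \<circ> p)" if "q permutes {..<n}" for q
  proof -
    have "(inv p \<circ> q) permutes {..<n}"
      using assms that by (simp add: permutes_compose permutes_inv)
    moreover have "x \<circ> q = (x \<circ> p) \<circ> (inv p \<circ> q)"
      by (simp add: fun_eq_iff permutes_inverses(1)[OF assms])
    ultimately show ?thesis unfolding sp_class_def mem_Collect_eq by (intro exI conjI)
  qed
  moreover have "x \<circ> p \<circ> q \<in> sp_class n x" if "q permutes {..<n}" for q
    unfolding sp_class_def mem_Collect_eq comp_assoc
    by (intro exI conjI, rule refl, rule permutes_compose[OF that assms])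
  ultimately show ?thesis by (auto simp: sp_class_def[of n x] sp_class_def[of n "x \<circ> p"])
qed

lemma sp_incl_class: "sp_incl e n (sp_class n x) = sp_class (Suc n) (case_nat e x)"
proof -
  have eq: "sp_class (Suc n) (case_nat e (x \<circ> p)) = sp_class (Suc n) (case_nat e x)"
    if p: "p permutes {..<n}" for p
  proof -
    define q where "q = case_nat 0 (Suc \<circ> p)"
    define r where "r = case_nat 0 (Suc \<circ> inv p)"
    have "q (r i) = i" "r (q i) = i" for i
      by (cases i; simp add: q_def r_def permutes_inverses[OF p])+
    then have "bij q" by (metis bijI')
    moreover have "q i = i" if "i \<notin> {..<Suc n}" for i
      using that permutes_not_in[OF p, of "i - 1"] by (cases i) (simp_all add: q_def)
    ultimately have q: "q permutes {..<Suc n}"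
      unfolding permutes_def bij_iff by blast
    have "case_nat e (x \<circ> p) = case_nat e x \<circ> q"
      by (auto simp: q_def fun_eq_iff split: nat.splits)
    then show ?thesis using sp_class_comp[OF q] by simp
  qed
  have "x = x \<circ> id" by simp
  then have "x \<in> sp_class n x"
    unfolding sp_class_def using permutes_id by blast
  moreover have "sp_class (Suc n) (case_nat e y) = sp_class (Suc n) (case_nat e x)"
    if "y \<in> sp_class n x" for y
    using that eq by (auto simp: sp_class_def[of n])
  ultimately show ?thesis unfolding sp_incl_def by blast
qed

text \<open>The image of \<open>SP\<^sup>n\<^sup>-\<^sup>1(X)\<close> in \<open>SP\<^sup>n(X)\<close>, empty for \<open>n = 0\<close>.\<close>

primrec sp_lower :: "'a topology \<Rightarrow> 'a \<Rightarrow> nat \<Rightarrow> (nat \<Rightarrow> 'a) set set"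
  where
    "sp_lower X e 0 = {}"
  | "sp_lower X e (Suc n) = sp_incl e n ` topspace (sym_prod n X)"

definition reduced_sym_prod :: "nat \<Rightarrow> 'a topology \<Rightarrow> 'a \<Rightarrow> (nat \<Rightarrow> 'a) set set topology"
  where "reduced_sym_prod n X e = collapse (sym_prod n X) (sp_lower X e n)"

subsection \<open>Homotopy groups and connectivity\<close>

definition nsphere_point :: "nat \<Rightarrow> real"
  where "nsphere_point = (\<lambda>k. if k = 0 then 1 else 0)"

text \<open>The based maps \<open>(S\<^sup>i, *) \<rightarrow> (Y, y)\<close> and based homotopy between them; \<open>homotopy_group i Y y\<close>
  is the underlying set of \<open>\<pi>\<^sub>i(Y, y)\<close> (the pointed set of path components if \<open>i = 0\<close>), with
  neutral element the class of the constant map.\<close>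

definition based_maps :: "nat \<Rightarrow> 'a topology \<Rightarrow> 'a \<Rightarrow> ((nat \<Rightarrow> real) \<Rightarrow> 'a) set"
  where "based_maps i Y y = {f. continuous_map (nsphere i) Y f \<and> f nsphere_point = y}"

definition based_homotopy ::
    "nat \<Rightarrow> 'a topology \<Rightarrow> 'a \<Rightarrow> (((nat \<Rightarrow> real) \<Rightarrow> 'a) \<times> ((nat \<Rightarrow> real) \<Rightarrow> 'a)) set"
  where "based_homotopy i Y y =
    {(f, g). homotopic_with (\<lambda>h. h nsphere_point = y) (nsphere i) Y f g}"

definition homotopy_group :: "nat \<Rightarrow> 'a topology \<Rightarrow> 'a \<Rightarrow> ((nat \<Rightarrow> real) \<Rightarrow> 'a) set set"
  where "homotopy_group i Y y = based_maps i Y y // based_homotopy i Y y"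

lemma equiv_based_homotopy: "equiv (based_maps i Y y) (based_homotopy i Y y)"
proof (rule equivI)
  show "based_homotopy i Y y \<subseteq> based_maps i Y y \<times> based_maps i Y y"
    by (auto simp: based_maps_def based_homotopy_def
        dest: homotopic_with_imp_continuous_maps homotopic_with_imp_property)
  show "refl_on (based_maps i Y y) (based_homotopy i Y y)"
    by (auto simp: refl_on_def based_maps_def based_homotopy_def)
  show "sym (based_homotopy i Y y)"
    by (auto simp: sym_def based_homotopy_def intro: homotopic_with_symD)
  show "trans (based_homotopy i Y y)"
    by (auto simp: trans_def based_homotopy_def intro: homotopic_with_trans)
qed

definition m_connected :: "nat \<Rightarrow> 'a topology \<Rightarrow> bool"
  where "m_connected m Y \<longleftrightarrow>
    topspace Y \<noteq> {} \<and>
    (\<forall>y \<in> topspace Y. \<forall>i \<le> m. homotopy_group i Y y = {based_homotopy i Y y `` {\<lambda>_. y}})"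

end

theory Submission
  imports Defs "HOL-Computational_Algebra.Fundamental_Theorem_Algebra" "HOL-Combinatorics.Permutations"
begin

text \<open>
  Let \<open>Y\<close> be the reduced symmetric product. Apart from its base point, the points of \<open>Y\<close> are the
  configurations of \<open>n\<close> points, with multiplicities, in the complement of \<open>e\<close>, which as a set is a disjoint
  union of \<open>w\<close> open arcs and \<open>r\<close> open discs. Let level \<open>m\<close> consist of the base point and of the
  configurations with at least \<open>m\<close> points in the one-skeleton \<open>S\<close>. Level \<open>0\<close> is \<open>Y\<close> and level \<open>n + 1\<close> is the
  base point. The proof moves a sphere of dimension \<open>d < 2 * n - min w n\<close> by homotopies from level \<open>m\<close>
  into level \<open>m + 1\<close> for \<open>m = 0, \<dots>, n\<close> (\<open>nullhomotopic\<close>). Each of these moves has two steps. Call a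
  configuration central if \<open>m\<close> of its points are midpoints of arcs and \<open>n - m\<close> are centres of
  discs; there are finitely many of these.

  First the sphere is moved off the central configurations (\<open>avoid_centres\<close>). Near them, level
  \<open>m\<close> is described by \<open>m\<close> real numbers in increasing order, for the points in the arcs, and by the \<open>n - m\<close>
  coefficients of the monic polynomial whose roots are the points in the discs: a monic complex
  polynomial is the same thing as the multiset of its roots, and the roots depend continuously
  on the coefficients. So the sphere has \<open>2 * n - m\<close> real coordinates there. If \<open>m \<le> w\<close>, then
  \<open>d < 2 * n - m\<close>, and a map to a space of dimension larger than \<open>d\<close> can be perturbed off finitely many
  points (\<open>generic_avoidance\<close>). If \<open>m > w\<close>, two of the \<open>m\<close> real points of a central configuration lie at
  the same midpoint, and it is enough to spread the sorted real points apart
  (\<open>avoiding_target_crowded\<close>). So only the levels \<open>m \<le> min w n\<close> restrict \<open>d\<close>, and the last of these is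
  the most restrictive.

  Then the sphere is pushed into the next level (\<open>push_level\<close>). There is a deformation of \<open>X\<close> that
  fixes \<open>e\<close>, preserves \<open>S\<close>, stretches the \<open>\<delta>\<close>-neighbourhoods of the midpoints and centres over the
  cells, sends the rest of the arcs to \<open>e\<close> and the rest of the discs into \<open>S\<close>
  (\<open>expansion_pushes\<close>). Apply it to all points of a configuration simultaneously. If the configuration is in
  level \<open>m\<close> and is not within \<open>\<delta>\<close> of a central one, then one of its points reaches \<open>e\<close>, or one more of
  them reaches \<open>S\<close>.

  Only free homotopies occur in this argument; a free null-homotopy extends the map over the
  disc, and contracting the disc to the base point gives a based one (\<open>m_connectedI\<close>).
\<close>

section \<open>Closed covers and quotient maps\<close>

lemma continuous_map_closed_cover:
  assumes "finite I" "\<And>i. i \<in> I \<Longrightarrow> closedin X (A i)" "topspace X \<subseteq> (\<Union>i\<in>I. A i)"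
    and "\<And>i. i \<in> I \<Longrightarrow> continuous_map (subtopology X (A i)) Y f"
  shows "continuous_map X Y f"
  unfolding continuous_map_closedin
proof (intro conjI allI impI)
  have sub: "A i \<subseteq> topspace X" if "i \<in> I" for i using assms(2)[OF that] closedin_subset by blast
  have "f x \<in> topspace Y" if "i \<in> I" "x \<in> A i" for i x
    using continuous_map_image_subset_topspace[OF assms(4)[OF that(1)]] that(2) sub[OF that(1)] by auto
  then show "f \<in> topspace X \<rightarrow> topspace Y" using assms(3) by blast
  fix C assume C: "closedin Y C"
  have "{x \<in> topspace X. f x \<in> C} = (\<Union>i\<in>I. {x \<in> A i. f x \<in> C})" using assms(3) sub by blast
  moreover have "closedin X {x \<in> A i. f x \<in> C}" if i: "i \<in> I" for i
    using closedin_continuous_map_preimage[OF assms(4)[OF i] C] closedin_closed_subtopology[OF assms(2)[OF i]] sub[OF i]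
    by (simp add: Int_absorb1)
  ultimately show "closedin X {x \<in> topspace X. f x \<in> C}" using assms(1) by (auto intro!: closedin_Union)
qed

lemma continuous_map_paste_closed:
  assumes "closedin X A" "closedin X B" "A \<union> B = topspace X"
    and f: "continuous_map (subtopology X A) Y f" and g: "continuous_map (subtopology X B) Y g"
    and agree: "\<And>x. \<lbrakk>x \<in> A; x \<in> B\<rbrakk> \<Longrightarrow> f x = g x"
  shows "continuous_map X Y (\<lambda>x. if x \<in> A then f x else g x)" (is "continuous_map X Y ?h")
proof -
  have "continuous_map (subtopology X A) Y ?h" using f by (rule continuous_map_eq) simp
  moreover have "continuous_map (subtopology X B) Y ?h" using g by (rule continuous_map_eq) (use agree in auto)
  moreover have "topspace X \<subseteq> (\<Union>C\<in>{A, B}. C)" using assms(3) by simp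
  ultimately show ?thesis
    using assms(1,2) by (intro continuous_map_closed_cover[of "{A, B}" X "\<lambda>C. C"]) (simp, blast, assumption, blast)
qed

lemma closed_quotient_onto_image:
  assumes "continuous_map X Y f" "closed_map X Y f"
  shows "quotient_map X (subtopology Y (f ` topspace X)) f"
proof (rule continuous_closed_imp_quotient_map)
  show "continuous_map X (subtopology Y (f ` topspace X)) f"
    using assms(1) by (simp add: continuous_map_in_subtopology)
  show "closed_map X (subtopology Y (f ` topspace X)) f"
    using assms(2) by (simp add: closed_map_into_subtopology)
  show "f ` topspace X = topspace (subtopology Y (f ` topspace X))"
    using continuous_map_image_subset_topspace[OF assms(1)] by auto
qed

text \<open>A continuous map from a compact space to a Hausdorff space is closed, hence a quotient map onto its
  image.\<close>

lemma continuous_map_from_compact_image: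
  assumes "Hausdorff_space Z" "compact_space K" "continuous_map K Z q" "continuous_map K Y (f \<circ> q)"
  shows "continuous_map (subtopology Z (q ` topspace K)) Y f"
  using closed_quotient_onto_image[OF assms(3) continuous_imp_closed_map[OF assms(3,2,1)]] assms(4)
  by (rule continuous_compose_quotient_map)

lemma continuous_map_complex_mult:
  fixes f g :: "'a \<Rightarrow> complex"
  assumes "continuous_map X euclidean f" "continuous_map X euclidean g"
  shows "continuous_map X euclidean (\<lambda>x. f x * g x)"
  using assms by (simp add: continuous_map_atin tendsto_mult)

lemma continuous_map_complex_of_real:
  assumes "continuous_map X euclideanreal f"
  shows "continuous_map X euclidean (\<lambda>x. complex_of_real (f x))"
  using assms tendsto_of_real[where 'a=complex] unfolding continuous_map_atin by fastforce

section \<open>Null-homotopies of maps on spheres\<close>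

definition sphere_set :: "nat \<Rightarrow> (nat \<Rightarrow> real) set"
  where "sphere_set i = {x. (\<Sum>k\<le>i. (x k)\<^sup>2) = 1 \<and> (\<forall>k>i. x k = 0)}"

lemma nsphere_eq_top_of_set: "nsphere i = top_of_set (sphere_set i)"
  by (simp add: nsphere sphere_set_def euclidean_product_topology)

lemma topspace_nsphere: "topspace (nsphere i) = sphere_set i"
  by (simp add: nsphere_eq_top_of_set)

lemma sphere_coord_le_1:
  assumes "x \<in> sphere_set i" shows "\<bar>x k\<bar> \<le> 1"
proof (cases "k \<le> i")
  case True
  then have "(x k)\<^sup>2 \<le> (\<Sum>k\<le>i. (x k)\<^sup>2)" by (intro member_le_sum) auto
  then show ?thesis using assms by (simp add: sphere_set_def abs_square_le_1)
qed (use assms in \<open>simp add: sphere_set_def\<close>)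

lemma compact_sphere_set: "compact (sphere_set i)"
proof -
  have "compactin (product_topology (\<lambda>_. euclideanreal) UNIV) (PiE UNIV (\<lambda>_::nat. {-1..1}))"
    by (simp add: compactin_PiE)
  then have "compact (PiE UNIV (\<lambda>_::nat. {-1..1::real}))"
    by (simp add: euclidean_product_topology)
  moreover have "closed (sphere_set i)"
  proof -
    have "sphere_set i = {x. (\<Sum>k\<le>i. (x k)\<^sup>2) = 1} \<inter> (\<Inter>k\<in>{i<..}. {x. x k = 0})"
      by (auto simp: sphere_set_def)
    moreover have "closed {x::nat\<Rightarrow>real. (\<Sum>k\<le>i. (x k)\<^sup>2) = 1}"
      by (intro closed_Collect_eq continuous_intros continuous_on_product_coordinates)
    moreover have "closed {x::nat\<Rightarrow>real. x k = 0}" for k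
      by (intro closed_Collect_eq continuous_intros continuous_on_product_coordinates)
    ultimately show ?thesis by (simp add: closed_Int closed_INT)
  qed
  moreover have "sphere_set i \<subseteq> PiE UNIV (\<lambda>_. {-1..1})"
    using sphere_coord_le_1 by (fastforce simp: abs_le_iff)
  ultimately show ?thesis using compact_Int_closed[of _ "sphere_set i"] by (metis inf.absorb2)
qed

lemma compact_space_nsphere: "compact_space (nsphere i)"
  by (simp add: nsphere_eq_top_of_set compact_space_subtopology compact_sphere_set)

definition disc_set :: "nat \<Rightarrow> (nat \<Rightarrow> real) set"
  where "disc_set i = {z. (\<Sum>k\<le>i. (z k)\<^sup>2) \<le> 1 \<and> (\<forall>k>i. z k = 0)}"

lemma continuous_map_cylinder_time: "continuous_map (prod_topology (top_of_set T) X) euclidean fst"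
  by (rule continuous_map_into_fulltopology[OF continuous_map_fst])

lemma continuous_map_cylinder_point:
  "continuous_map (prod_topology T (nsphere i)) euclideanreal (\<lambda>p. snd p k)"
  using continuous_map_compose[OF continuous_map_snd continuous_map_nsphere_projection] by (simp add: o_def)

text \<open>The disc is the cone over the sphere, with vertex at \<open>s = 1\<close>.\<close>

lemma cone_quotient_map:
  "quotient_map (prod_topology (top_of_set {0..1}) (nsphere i)) (top_of_set (disc_set i))
     (\<lambda>(s, x) k. (1 - s) * x k)"
proof (rule continuous_imp_quotient_map)
  let ?q = "\<lambda>(s, x) k. (1 - s) * x k :: real"
  let ?P = "prod_topology (top_of_set {0..1::real}) (nsphere i)"
  have sq: "(\<Sum>k\<le>i. ((1 - s) * x k)\<^sup>2) = (1 - s)\<^sup>2" if "x \<in> sphere_set i" for s x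
    using that by (simp add: power_mult_distrib sphere_set_def flip: sum_distrib_left)
  have "(\<lambda>k. (1 - s) * x k) \<in> disc_set i" if "0 \<le> s" "s \<le> 1" "x \<in> sphere_set i" for s x
    using sq[OF that(3), of s] that by (simp add: disc_set_def sphere_set_def power_le_one)
  then have sub: "?q ` topspace ?P \<subseteq> disc_set i"
    by (force simp: topspace_nsphere)
  have "continuous_map ?P euclideanreal (\<lambda>p. (1 - fst p) * snd p k)" for k
    by (intro continuous_map_real_mult continuous_map_diff continuous_map_canonical_const
        continuous_map_cylinder_time continuous_map_cylinder_point)
  then have "continuous_map ?P euclidean ?q"
    by (simp add: case_prod_unfold continuous_map_componentwise_UNIV flip: euclidean_product_topology)
  then show "continuous_map ?P (top_of_set (disc_set i)) ?q"
    using sub by (auto simp: continuous_map_in_subtopology image_subset_iff_funcset)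
  show "compact_space ?P"
    by (simp add: compact_space_prod_topology compact_space_nsphere compact_space_subtopology)
  show "Hausdorff_space (top_of_set (disc_set i))" by (simp add: Hausdorff_space_subtopology)
  have "z \<in> ?q ` topspace ?P" if z: "z \<in> disc_set i" for z
  proof -
    define r where "r = sqrt (\<Sum>k\<le>i. (z k)\<^sup>2)"
    have r: "0 \<le> r" "r \<le> 1" "r\<^sup>2 = (\<Sum>k\<le>i. (z k)\<^sup>2)"
      using z by (auto simp: r_def disc_set_def sum_nonneg)
    show ?thesis
    proof (cases "r = 0")
      case True
      then have "\<forall>k\<le>i. z k = 0" using r(3) by (simp add: sum_nonneg_eq_0_iff)
      then have "z k = 0" for k using z by (cases "k \<le> i") (auto simp: disc_set_def)
      then have "z = ?q (1, nsphere_point)" by (simp add: fun_eq_iff)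
      moreover have "(1, nsphere_point) \<in> topspace ?P"
        using in_topspace_nsphere by (simp add: nsphere_point_def)
      ultimately show ?thesis by blast
    next
      case False
      define x where "x = (\<lambda>k. z k / r)"
      have "(\<Sum>k\<le>i. (x k)\<^sup>2) = (\<Sum>k\<le>i. (z k)\<^sup>2) / r\<^sup>2"
        by (simp add: x_def power_divide sum_divide_distrib)
      also have "\<dots> = 1" using False by (simp flip: r(3))
      finally have "x \<in> sphere_set i"
        using z by (simp add: x_def sphere_set_def disc_set_def)
      moreover have "z = ?q (1 - r, x)" using False by (simp add: x_def)
      ultimately show ?thesis using r by (intro image_eqI[of _ _ "(1 - r, x)"]) (auto simp: topspace_nsphere)
    qed
  qed
  then show "?q ` topspace ?P = topspace (top_of_set (disc_set i))" using sub by auto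
qed

text \<open>The end of a null-homotopy is constant, so it factors through the cone.\<close>

lemma nullhomotopic_extends_to_disc:
  assumes "homotopic_with (\<lambda>_. True) (nsphere i) Y f (\<lambda>_. a)"
  obtains F where "continuous_map (top_of_set (disc_set i)) Y F" "\<And>x. x \<in> topspace (nsphere i) \<Longrightarrow> F x = f x"
proof -
  let ?q = "\<lambda>(s, x) k. (1 - s) * x k :: real"
  let ?P = "prod_topology (top_of_set {0..1::real}) (nsphere i)"
  obtain h where h: "continuous_map ?P Y h" "\<And>x. h (0, x) = f x" "\<And>x. h (1, x) = a"
    using assms by (auto simp: homotopic_with_def)
  have inj: "h u = h v" if uv: "u \<in> topspace ?P" "v \<in> topspace ?P" "?q u = ?q v" for u v
  proof -
    obtain s x t y where eq: "u = (s, x)" "v = (t, y)" by (metis surj_pair)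
    have s: "0 \<le> s" "s \<le> 1" "x \<in> sphere_set i" "0 \<le> t" "t \<le> 1" "y \<in> sphere_set i"
      using uv by (auto simp: eq topspace_nsphere)
    have q: "(1 - s) * x k = (1 - t) * y k" for k using uv(3) by (simp add: eq fun_eq_iff)
    have "(1 - s)\<^sup>2 = (\<Sum>k\<le>i. ((1 - s) * x k)\<^sup>2)"
      using s by (simp add: power_mult_distrib sphere_set_def flip: sum_distrib_left)
    also have "\<dots> = (\<Sum>k\<le>i. ((1 - t) * y k)\<^sup>2)" by (simp only: q)
    also have "\<dots> = (1 - t)\<^sup>2"
      using s by (simp add: power_mult_distrib sphere_set_def flip: sum_distrib_left)
    finally have "s = t" using s by simp
    show ?thesis
    proof (cases "s = 1")
      case True
      then show ?thesis using \<open>s = t\<close> by (simp add: eq h)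
    next
      case False
      then have "x = y" using q \<open>s = t\<close> by (auto simp: fun_eq_iff)
      then show ?thesis using \<open>s = t\<close> by (simp add: eq)
    qed
  qed
  obtain F where F: "continuous_map (top_of_set (disc_set i)) Y F" "\<And>u. u \<in> topspace ?P \<Longrightarrow> F (?q u) = h u"
    by (rule quotient_map_lift_exists[OF cone_quotient_map h(1)], erule (2) inj, rule that)
  show ?thesis
  proof
    show "F x = f x" if "x \<in> topspace (nsphere i)" for x
      using F(2)[of "(0, x)"] that h(2) by simp
  qed (rule F(1))
qed

text \<open>Extend the map over the disc and contract the disc linearly to the base point, which stays fixed.\<close>

lemma nullhomotopic_imp_based_nullhomotopic:
  assumes "homotopic_with (\<lambda>_. True) (nsphere i) Y f (\<lambda>_. a)" "f nsphere_point = y"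
  shows "homotopic_with (\<lambda>h. h nsphere_point = y) (nsphere i) Y f (\<lambda>_. y)"
proof -
  let ?P = "prod_topology (top_of_set {0..1::real}) (nsphere i)"
  define p where "p = nsphere_point"
  have p: "p \<in> sphere_set i"
    using in_topspace_nsphere by (simp add: p_def nsphere_point_def topspace_nsphere)
  obtain F where F: "continuous_map (top_of_set (disc_set i)) Y F" "\<And>x. x \<in> topspace (nsphere i) \<Longrightarrow> F x = f x"
    using nullhomotopic_extends_to_disc[OF assms(1)] by blast
  define c where "c = (\<lambda>(t, x) k. (1 - t) * x k + t * p k :: real)"
  have "c (t, x) \<in> disc_set i" if t: "0 \<le> t" "t \<le> 1" and x: "x \<in> sphere_set i" for t x
  proof -
    have "(\<Sum>k\<le>i. ((1 - t) * x k + t * p k)\<^sup>2) \<le> (\<Sum>k\<le>i. (1 - t) * (x k)\<^sup>2 + t * (p k)\<^sup>2)"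
    proof (rule sum_mono)
      fix k
      have "(1 - t) * (x k)\<^sup>2 + t * (p k)\<^sup>2 - ((1 - t) * x k + t * p k)\<^sup>2 = t * (1 - t) * (x k - p k)\<^sup>2"
        by (simp add: power2_eq_square algebra_simps)
      also have "\<dots> \<ge> 0" using t by simp
      finally show "((1 - t) * x k + t * p k)\<^sup>2 \<le> (1 - t) * (x k)\<^sup>2 + t * (p k)\<^sup>2" by simp
    qed
    also have "\<dots> = 1" using x p by (simp add: sum.distrib sphere_set_def flip: sum_distrib_left)
    finally show ?thesis using x p by (simp add: c_def disc_set_def sphere_set_def)
  qed
  then have sub: "c ` topspace ?P \<subseteq> disc_set i" by (auto simp: topspace_nsphere)
  have "continuous_map ?P euclideanreal (\<lambda>u. (1 - fst u) * snd u k + fst u * p k)" for k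
    by (intro continuous_map_real_mult continuous_map_diff continuous_map_add continuous_map_canonical_const
        continuous_map_cylinder_time continuous_map_cylinder_point)
  then have "continuous_map ?P euclidean c"
    by (simp add: c_def case_prod_unfold continuous_map_componentwise_UNIV flip: euclidean_product_topology)
  then have "continuous_map ?P (top_of_set (disc_set i)) c"
    using sub by (auto simp: continuous_map_in_subtopology image_subset_iff_funcset)
  then have cont: "continuous_map ?P Y (F \<circ> c)" using F(1) by (rule continuous_map_compose)
  have c0: "c (0, x) = x" and c1: "c (1, x) = p" and cp: "c (t, p) = p" for x t
    by (simp_all add: c_def fun_eq_iff algebra_simps)
  have Fp: "F p = y" using F(2)[of p] p assms(2) by (simp add: topspace_nsphere p_def)
  have "\<exists>h. continuous_map ?P Y h \<and> (\<forall>x\<in>topspace (nsphere i). h (0, x) = f x) \<and>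
    (\<forall>x\<in>topspace (nsphere i). h (1, x) = y) \<and> (\<forall>t\<in>{0..1}. h (t, nsphere_point) = y)"
    using cont F(2) Fp by (intro exI[of _ "F \<circ> c"]) (auto simp: c0 c1 cp simp flip: p_def)
  moreover have "nsphere_point \<in> topspace (nsphere i)" using p by (simp add: topspace_nsphere p_def)
  ultimately show ?thesis by (subst homotopic_with) auto
qed

text \<open>This allows the homotopies constructed below to move the base point.\<close>

lemma m_connectedI:
  assumes "topspace Y \<noteq> {}"
    and "\<And>i f. \<lbrakk>i \<le> m; continuous_map (nsphere i) Y f\<rbrakk> \<Longrightarrow> \<exists>a. homotopic_with (\<lambda>_. True) (nsphere i) Y f (\<lambda>_. a)"
  shows "m_connected m Y"
  unfolding m_connected_def
proof (intro conjI ballI allI impI)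
  fix y i assume y: "y \<in> topspace Y" and i: "i \<le> m"
  let ?r = "based_homotopy i Y y" and ?M = "based_maps i Y y"
  have "?r `` {f} = ?r `` {\<lambda>_. y}" if "f \<in> ?M" for f
  proof -
    obtain a where "homotopic_with (\<lambda>_. True) (nsphere i) Y f (\<lambda>_. a)"
      using assms(2)[OF i, of f] \<open>f \<in> ?M\<close> by (auto simp: based_maps_def)
    then have "(f, \<lambda>_. y) \<in> ?r"
      using nullhomotopic_imp_based_nullhomotopic[of i Y f a y] that
      by (simp add: based_homotopy_def based_maps_def)
    then show ?thesis by (rule equiv_class_eq[OF equiv_based_homotopy])
  qed
  moreover have "(\<lambda>_. y) \<in> ?M" using y by (simp add: based_maps_def)
  ultimately show "homotopy_group i Y y = {?r `` {\<lambda>_. y}}"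
    unfolding homotopy_group_def quotient_def by blast
qed (rule assms(1))

section \<open>Perturbing maps on spheres off finite sets\<close>

text \<open>By the Stone--Weierstrass theorem, since the Lipschitz functions on a compact set form an algebra
  that contains the coordinates.\<close>

lemma lipschitz_approximation:
  fixes f :: "(nat \<Rightarrow> real) \<Rightarrow> real"
  assumes "compact S" "\<And>x k. \<lbrakk>x \<in> S; k > i\<rbrakk> \<Longrightarrow> x k = 0" "continuous_on S f" "\<epsilon> > 0"
  obtains g L where "continuous_on S g" "\<And>x. x \<in> S \<Longrightarrow> \<bar>f x - g x\<bar> < \<epsilon>" "L \<ge> 0"
    "\<And>x y. \<lbrakk>x \<in> S; y \<in> S\<rbrakk> \<Longrightarrow> \<bar>g x - g y\<bar> \<le> L * (\<Sum>k\<le>i. \<bar>x k - y k\<bar>)"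
proof -
  define D :: "(nat \<Rightarrow> real) \<Rightarrow> (nat \<Rightarrow> real) \<Rightarrow> real" where "D = (\<lambda>x y. \<Sum>k\<le>i. \<bar>x k - y k\<bar>)"
  have D0: "D x y \<ge> 0" for x y by (simp add: D_def sum_nonneg)
  define P where "P = (\<lambda>g::(nat \<Rightarrow> real) \<Rightarrow> real. continuous_on S g \<and> (\<exists>L\<ge>0. \<forall>x\<in>S. \<forall>y\<in>S. \<bar>g x - g y\<bar> \<le> L * D x y))"
  have "\<exists>g. P g \<and> (\<forall>x\<in>S. \<bar>f x - g x\<bar> < \<epsilon>)"
  proof (rule Stone_Weierstrass_HOL[OF assms(1) _ _ _ _ _ assms(3,4)])
    show "P (\<lambda>x. c)" for c using D0 by (auto simp: P_def)
    show "continuous_on S f" if "P f" for f using that by (simp add: P_def)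
    show "P (\<lambda>x. f x + g x)" if fg: "P f \<and> P g" for f g
    proof -
      obtain L M where "L \<ge> 0" "\<forall>x\<in>S. \<forall>y\<in>S. \<bar>f x - f y\<bar> \<le> L * D x y"
         "M \<ge> 0" "\<forall>x\<in>S. \<forall>y\<in>S. \<bar>g x - g y\<bar> \<le> M * D x y"
        using fg by (auto simp: P_def)
      then have "\<forall>x\<in>S. \<forall>y\<in>S. \<bar>(f x + g x) - (f y + g y)\<bar> \<le> (L + M) * D x y"
        by (smt (verit, ccfv_SIG) distrib_right)
      then show ?thesis using fg \<open>L \<ge> 0\<close> \<open>M \<ge> 0\<close> unfolding P_def
        by (intro conjI continuous_intros exI[of _ "L+M"]) auto
    qed
    show "P (\<lambda>x. f x * g x)" if fg: "P f \<and> P g" for f g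
    proof -
      obtain L M where LM: "L \<ge> 0" "\<And>x y. x\<in>S \<Longrightarrow> y\<in>S \<Longrightarrow> \<bar>f x - f y\<bar> \<le> L * D x y"
         "M \<ge> 0" "\<And>x y. x\<in>S \<Longrightarrow> y\<in>S \<Longrightarrow> \<bar>g x - g y\<bar> \<le> M * D x y"
        using fg unfolding P_def by metis
      have "bounded (f ` S)" "bounded (g ` S)"
        using fg assms(1) by (auto simp: P_def intro: compact_imp_bounded compact_continuous_image)
      then obtain A B where A: "A > 0" "\<And>x. x \<in> S \<Longrightarrow> \<bar>f x\<bar> \<le> A" and B: "B > 0" "\<And>x. x \<in> S \<Longrightarrow> \<bar>g x\<bar> \<le> B"
        by (auto simp: bounded_pos)
      have "\<bar>f x * g x - f y * g y\<bar> \<le> (A * M + B * L) * D x y" if "x \<in> S" "y \<in> S" for x y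
      proof -
        have "f x * g x - f y * g y = f x * (g x - g y) + g y * (f x - f y)" by (simp add: algebra_simps)
        also have "\<bar>\<dots>\<bar> \<le> \<bar>f x\<bar> * \<bar>g x - g y\<bar> + \<bar>g y\<bar> * \<bar>f x - f y\<bar>"
          by (metis abs_mult abs_triangle_ineq)
        also have "\<dots> \<le> A * (M * D x y) + B * (L * D x y)"
          using that LM A B by (intro add_mono mult_mono) (auto intro: less_imp_le)
        finally show ?thesis by (simp add: algebra_simps)
      qed
      then show ?thesis using fg LM A B unfolding P_def
        by (intro conjI continuous_intros exI[of _ "A * M + B * L"]) auto
    qed
    show "\<exists>f. P f \<and> f x \<noteq> f y" if xy: "x \<in> S \<and> y \<in> S \<and> x \<noteq> y" for x y
    proof -
      obtain k where k: "x k \<noteq> y k" using xy by auto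
      then have "k \<le> i" using xy assms(2) by (metis not_le)
      have "\<bar>u k - v k\<bar> \<le> 1 * D u v" for u v
        unfolding D_def using \<open>k \<le> i\<close> member_le_sum[of k "{..i}" "\<lambda>k. \<bar>u k - v k\<bar>"] by simp
      moreover have "continuous_on S (\<lambda>u. u k)"
        by (rule continuous_on_subset[OF continuous_on_product_coordinates]) simp
      ultimately have "P (\<lambda>u. u k)" unfolding P_def by (meson zero_le_one)
      then show ?thesis using k by blast
    qed
  qed
  then show ?thesis using that unfolding P_def D_def by metis
qed

text \<open>A point \<open>x\<close> of the \<open>i\<close>-sphere has a coordinate with \<open>(x j)\<^sup>2 \<ge> 1 / (i + 1)\<close>. It is determined, up to its
  sign, by the other \<open>i\<close> coordinates, and depends on them in a Lipschitz way because it is bounded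
  away from \<open>0\<close>. Rounding these \<open>i\<close> coordinates to multiples of \<open>1 / N\<close> gives a partition whose number of
  boxes has the order of \<open>N ^ i\<close> and not of \<open>N ^ (i + 1)\<close>.\<close>

lemma sphere_box_cover:
  assumes "N \<ge> (1::nat)"
  obtains \<beta> :: "(nat \<Rightarrow> real) \<Rightarrow> nat \<times> bool \<times> (nat \<Rightarrow> int)" where
    "finite (\<beta> ` sphere_set i)" "card (\<beta> ` sphere_set i) \<le> (i + 1) * (2 * (2 * N + 1) ^ i)"
    "\<And>x y. \<lbrakk>x \<in> sphere_set i; y \<in> sphere_set i; \<beta> x = \<beta> y\<rbrakk>
       \<Longrightarrow> (\<Sum>k\<le>i. \<bar>x k - y k\<bar>) \<le> real (i + 2 * i * (i + 1)) / N"
proof -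
  have ex: "\<exists>j\<le>i. 1 \<le> (i + 1) * (x j)\<^sup>2" if "x \<in> sphere_set i" for x :: "nat \<Rightarrow> real"
  proof (rule ccontr)
    assume "\<not> ?thesis"
    then have "(i + 1) * (x j)\<^sup>2 < 1" if "j \<in> {..i}" for j
      using that by (metis atMost_iff not_le)
    then have "(\<Sum>j\<le>i. (i + 1) * (x j)\<^sup>2) < (\<Sum>j\<le>i. 1)"
      by (intro sum_strict_mono) (simp_all only: finite_atMost atMost_iff, blast+)
    moreover have "(\<Sum>j\<le>i. (i + 1) * (x j)\<^sup>2) = i + 1"
      using that by (simp add: sphere_set_def flip: sum_distrib_left)
    ultimately show False by simp
  qed
  define J where "J x = (SOME j. j \<le> i \<and> 1 \<le> (i + 1) * (x j)\<^sup>2)" for x :: "nat \<Rightarrow> real"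
  have J: "J x \<le> i" "1 \<le> (i + 1) * (x (J x))\<^sup>2" if "x \<in> sphere_set i" for x :: "nat \<Rightarrow> real"
    using someI_ex[OF ex[OF that, unfolded Bex_def]] unfolding J_def by auto
  define \<beta> where "\<beta> x = (J x, x (J x) \<ge> 0, \<lambda>k\<in>{..i}-{J x}. \<lfloor>N * x k\<rfloor>)" for x :: "nat \<Rightarrow> real"
  define B where "B = (SIGMA j:{..i}. (UNIV::bool set) \<times> PiE ({..i}-{j}) (\<lambda>_. {- int N..int N}))"
  have fin: "finite B" unfolding B_def by (intro finite_SigmaI finite_cartesian_product finite_PiE) auto
  have "card B = (i + 1) * (2 * (2 * N + 1) ^ i)"
    unfolding B_def by (subst card_SigmaI) (auto simp: finite_PiE card_cartesian_product card_PiE nat_add_distrib nat_mult_distrib)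
  moreover have sub: "\<beta> ` sphere_set i \<subseteq> B"
  proof (rule image_subsetI)
    fix x assume x: "x \<in> sphere_set i"
    have "- int N \<le> \<lfloor>N * x k\<rfloor> \<and> \<lfloor>N * x k\<rfloor> \<le> int N" for k
    proof -
      have "\<bar>x k\<bar> \<le> 1" using sphere_coord_le_1[OF x] .
      then have "- real N \<le> N * x k" "N * x k \<le> real N"
        using mult_left_mono[of "-1" "x k" "real N"] mult_left_mono[of "x k" 1 "real N"] by auto
      then show ?thesis by (simp add: le_floor_iff floor_le_iff)
    qed
    then show "\<beta> x \<in> B" using J[OF x] by (auto simp: \<beta>_def B_def)
  qed
  ultimately have "finite (\<beta> ` sphere_set i)" "card (\<beta> ` sphere_set i) \<le> (i + 1) * (2 * (2 * N + 1) ^ i)"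
    using fin by (metis finite_subset, metis card_mono)
  moreover have "(\<Sum>k\<le>i. \<bar>x k - y k\<bar>) \<le> real (i + 2 * i * (i + 1)) / N"
    if x: "x \<in> sphere_set i" and y: "y \<in> sphere_set i" and eq: "\<beta> x = \<beta> y" for x y
  proof -
    define j where "j = J x"
    have j: "j \<le> i" "1 \<le> (i + 1) * (x j)\<^sup>2" and sgn: "x j \<ge> 0 \<longleftrightarrow> y j \<ge> 0"
      using J[OF x] eq by (auto simp: j_def \<beta>_def)
    have close: "\<bar>x k - y k\<bar> \<le> 1 / N" if "k \<in> {..i} - {j}" for k
    proof -
      have "\<lfloor>N * x k\<rfloor> = \<lfloor>N * y k\<rfloor>"
      proof -
        have "(\<lambda>k\<in>{..i}-{j}. \<lfloor>N * x k\<rfloor>) k = (\<lambda>k\<in>{..i}-{j}. \<lfloor>N * y k\<rfloor>) k"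
          using eq unfolding \<beta>_def prod.inject j_def by metis
        then show ?thesis using that by simp
      qed
      then have "\<bar>N * x k - N * y k\<bar> \<le> 1" by linarith
      then have "N * \<bar>x k - y k\<bar> \<le> 1" by (simp add: abs_mult flip: right_diff_distrib)
      then show ?thesis using assms by (simp add: field_simps)
    qed
    have "(\<Sum>k\<in>{..i}-{j}. \<bar>x k - y k\<bar>) \<le> of_nat (card ({..i}-{j})) * (1 / N)"
      by (rule sum_bounded_above) (use close in auto)
    then have rest: "(\<Sum>k\<in>{..i}-{j}. \<bar>x k - y k\<bar>) \<le> i / N" using j by simp
    have "(x j)\<^sup>2 + (\<Sum>k\<in>{..i}-{j}. (x k)\<^sup>2) = (y j)\<^sup>2 + (\<Sum>k\<in>{..i}-{j}. (y k)\<^sup>2)"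
      using x y j sum.remove[of "{..i}" j "\<lambda>k. (x k)\<^sup>2"] sum.remove[of "{..i}" j "\<lambda>k. (y k)\<^sup>2"]
      by (simp add: sphere_set_def)
    then have "(x j)\<^sup>2 - (y j)\<^sup>2 = (\<Sum>k\<in>{..i}-{j}. (y k)\<^sup>2 - (x k)\<^sup>2)" by (simp add: sum_subtractf)
    also have "\<bar>\<dots>\<bar> \<le> (\<Sum>k\<in>{..i}-{j}. 2 * \<bar>x k - y k\<bar>)"
    proof (rule order_trans[OF sum_abs], rule sum_mono)
      fix k
      have "\<bar>(y k)\<^sup>2 - (x k)\<^sup>2\<bar> = \<bar>y k + x k\<bar> * \<bar>x k - y k\<bar>"
        by (simp add: power2_eq_square square_diff_square_factored abs_mult abs_minus_commute)
      also have "\<dots> \<le> 2 * \<bar>x k - y k\<bar>"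
        using sphere_coord_le_1[OF x, of k] sphere_coord_le_1[OF y, of k] by (intro mult_right_mono) auto
      finally show "\<bar>(y k)\<^sup>2 - (x k)\<^sup>2\<bar> \<le> 2 * \<bar>x k - y k\<bar>" .
    qed
    also have "\<dots> \<le> 2 * (i / N)" using rest by (simp flip: sum_distrib_left)
    finally have sq: "\<bar>(x j)\<^sup>2 - (y j)\<^sup>2\<bar> \<le> 2 * (i / N)" .
    have "1 \<le> (i + 1) * \<bar>x j\<bar>"
    proof -
      have "(x j)\<^sup>2 \<le> \<bar>x j\<bar>" using sphere_coord_le_1[OF x, of j]
        by (metis abs_ge_zero mult.right_neutral mult_left_mono power2_abs power2_eq_square)
      then show ?thesis using j(2) by (smt (verit) mult_left_mono of_nat_0_le_iff)
    qed
    also have "\<dots> \<le> (i + 1) * \<bar>x j + y j\<bar>" using sgn by (intro mult_left_mono) auto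
    finally have "1 * \<bar>x j - y j\<bar> \<le> (i + 1) * \<bar>x j + y j\<bar> * \<bar>x j - y j\<bar>"
      by (intro mult_right_mono) auto
    also have "\<dots> = (i + 1) * \<bar>(x j)\<^sup>2 - (y j)\<^sup>2\<bar>"
      by (simp add: power2_eq_square square_diff_square_factored abs_mult)
    also have "\<dots> \<le> (i + 1) * (2 * (i / N))" using sq by (intro mult_left_mono) auto
    finally have "\<bar>x j - y j\<bar> \<le> (i + 1) * (2 * (i / N))" by simp
    moreover have "(\<Sum>k\<le>i. \<bar>x k - y k\<bar>) = \<bar>x j - y j\<bar> + (\<Sum>k\<in>{..i}-{j}. \<bar>x k - y k\<bar>)"
      using j(1) by (intro sum.remove) auto
    ultimately have "(\<Sum>k\<le>i. \<bar>x k - y k\<bar>) \<le> (i + 1) * (2 * (i / N)) + i / N" using rest by linarith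
    also have "\<dots> = real (i + 2 * i * (i + 1)) / N" by (simp add: field_simps add_divide_distrib)
    finally show ?thesis .
  qed
  ultimately show ?thesis using that by blast
qed

text \<open>Let \<open>h\<close> be a Lipschitz approximation of \<open>f\<close> and translate it by the points \<open>v * \<eta>\<close> of a grid with \<open>M\<close> steps in
  each of the \<open>card J\<close> directions. If all translates met \<open>P\<close>, every \<open>v\<close> would yield a point of \<open>P\<close> and a box
  of the sphere that contains a preimage of it. Two grid points with the same point of \<open>P\<close> and
  the same box would force \<open>h\<close> to vary by \<open>\<eta>\<close> or more within one box, which the Lipschitz bound forbids if
  the boxes have size \<open>1 / N\<close> with \<open>N\<close> a suitable multiple of \<open>M\<close>. So \<open>M ^ card J\<close> would be at most the
  number of pairs, which has the order of \<open>M ^ i\<close>; this fails for large \<open>M\<close>.\<close>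

lemma generic_avoidance:
  assumes S: "compact S" "S \<subseteq> sphere_set i" and J: "finite J" "card J > i" and P: "finite P" and \<epsilon>: "\<epsilon> > 0"
    and f: "\<And>j. j \<in> J \<Longrightarrow> continuous_on S (f j)"
  obtains g :: "'j \<Rightarrow> (nat \<Rightarrow> real) \<Rightarrow> real" where
    "\<And>j. j \<in> J \<Longrightarrow> continuous_on S (g j)"
    "\<And>j x. \<lbrakk>j \<in> J; x \<in> S\<rbrakk> \<Longrightarrow> \<bar>g j x - f j x\<bar> < \<epsilon>"
    "\<And>x p. \<lbrakk>x \<in> S; p \<in> P\<rbrakk> \<Longrightarrow> \<exists>j\<in>J. g j x \<noteq> p j"
proof -
  have "\<forall>j\<in>J. \<exists>g L. continuous_on S g \<and> (\<forall>x\<in>S. \<bar>f j x - g x\<bar> < \<epsilon>/2) \<and> L \<ge> 0 \<and>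
    (\<forall>x\<in>S. \<forall>y\<in>S. \<bar>g x - g y\<bar> \<le> L * (\<Sum>k\<le>i. \<bar>x k - y k\<bar>))"
  proof
    fix j assume "j \<in> J"
    have "x k = 0" if "x \<in> S" "k > i" for x k using that S by (auto simp: sphere_set_def)
    note 0 = this
    show "\<exists>g L. continuous_on S g \<and> (\<forall>x\<in>S. \<bar>f j x - g x\<bar> < \<epsilon>/2) \<and> L \<ge> 0 \<and>
      (\<forall>x\<in>S. \<forall>y\<in>S. \<bar>g x - g y\<bar> \<le> L * (\<Sum>k\<le>i. \<bar>x k - y k\<bar>))"
    proof (rule lipschitz_approximation[where S=S and i=i and f="f j" and \<epsilon>="\<epsilon>/2"])
      show "x k = 0" if "x \<in> S" "i < k" for x k using 0 that by blast
          show "compact S" "continuous_on S (f j)" "\<epsilon>/2 > 0" using S(1) f[OF \<open>j \<in> J\<close>] \<epsilon> by auto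
    qed blast
  qed
  from bchoice[OF this] obtain h where "\<forall>j\<in>J. \<exists>L. continuous_on S (h j) \<and> (\<forall>x\<in>S. \<bar>f j x - h j x\<bar> < \<epsilon>/2) \<and> L \<ge> 0 \<and>
    (\<forall>x\<in>S. \<forall>y\<in>S. \<bar>h j x - h j y\<bar> \<le> L * (\<Sum>k\<le>i. \<bar>x k - y k\<bar>))" ..
  from bchoice[OF this] obtain L where hL: "\<forall>j\<in>J. continuous_on S (h j) \<and> (\<forall>x\<in>S. \<bar>f j x - h j x\<bar> < \<epsilon>/2) \<and> L j \<ge> 0 \<and>
    (\<forall>x\<in>S. \<forall>y\<in>S. \<bar>h j x - h j y\<bar> \<le> L j * (\<Sum>k\<le>i. \<bar>x k - y k\<bar>))" ..
  then have h: "\<And>j. j \<in> J \<Longrightarrow> continuous_on S (h j)"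
      "\<And>j x. j \<in> J \<Longrightarrow> x \<in> S \<Longrightarrow> \<bar>f j x - h j x\<bar> < \<epsilon>/2" "\<And>j. j \<in> J \<Longrightarrow> L j \<ge> 0"
      "\<And>j x y. \<lbrakk>j \<in> J; x \<in> S; y \<in> S\<rbrakk> \<Longrightarrow> \<bar>h j x - h j y\<bar> \<le> L j * (\<Sum>k\<le>i. \<bar>x k - y k\<bar>)"
    by blast+
  define \<Lambda> where "\<Lambda> = (\<Sum>j\<in>J. L j)"
  have \<Lambda>: "L j \<le> \<Lambda>" if "j \<in> J" for j
    unfolding \<Lambda>_def using that J h(3) by (intro member_le_sum) auto
  have \<Lambda>0: "\<Lambda> \<ge> 0" unfolding \<Lambda>_def by (intro sum_nonneg h(3))
  define C where "C = real (i + 2 * i * (i + 1))"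
  have C0: "C \<ge> 0" by (simp add: C_def)
  \<comment> \<open>the ratio of \<open>N\<close> and \<open>M\<close> that makes \<open>h\<close> vary by less than \<open>\<eta>\<close> in a box; it must not depend on \<open>M\<close>\<close>
  define c where "c = nat \<lceil>2 * \<Lambda> * C / \<epsilon>\<rceil> + 1"
  have c: "2 * \<Lambda> * C / \<epsilon> < c" unfolding c_def by linarith
  define A where "A = card P * ((i + 1) * (2 * (3 * c) ^ i))"
  \<comment> \<open>\<open>A * M ^ i\<close> bounds the number of pairs of a point of \<open>P\<close> and a box\<close>
  define M where "M = A + 1"
  define N where "N = c * M"
  have N: "N \<ge> 1" by (simp add: N_def M_def c_def)
  define \<eta> where "\<eta> = \<epsilon> / (2 * M)"
  have \<eta>: "\<eta> > 0" using \<epsilon> by (simp add: \<eta>_def M_def)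
  have small: "\<Lambda> * (C / N) < \<eta>"
  proof -
    have M0: "real M > 0" "real c > 0" by (simp_all add: M_def c_def)
    have "2 * \<Lambda> * C < c * \<epsilon>" using c \<epsilon> by (simp add: pos_divide_less_eq)
    then show ?thesis using M0 by (simp add: \<eta>_def N_def field_simps)
  qed
  obtain \<beta> :: "(nat \<Rightarrow> real) \<Rightarrow> nat \<times> bool \<times> (nat \<Rightarrow> int)" where \<beta>:
    "finite (\<beta> ` sphere_set i)" "card (\<beta> ` sphere_set i) \<le> (i + 1) * (2 * (2 * N + 1) ^ i)"
    "\<And>x y. \<lbrakk>x \<in> sphere_set i; y \<in> sphere_set i; \<beta> x = \<beta> y\<rbrakk> \<Longrightarrow> (\<Sum>k\<le>i. \<bar>x k - y k\<bar>) \<le> C / N"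
    using sphere_box_cover[OF N, of i] unfolding C_def by blast
  have "\<exists>v\<in>PiE J (\<lambda>_. {..<M}). \<forall>x\<in>S. \<forall>p\<in>P. \<exists>j\<in>J. h j x + v j * \<eta> \<noteq> p j"
  proof (rule ccontr)
    assume "\<not> ?thesis"
    then have "\<forall>v\<in>PiE J (\<lambda>_. {..<M}). \<exists>x p. x \<in> S \<and> p \<in> P \<and> (\<forall>j\<in>J. h j x + v j * \<eta> = p j)"
      by blast
    then obtain X Q where XQ: "\<And>v. v \<in> PiE J (\<lambda>_. {..<M}) \<Longrightarrow> X v \<in> S \<and> Q v \<in> P \<and> (\<forall>j\<in>J. h j (X v) + v j * \<eta> = Q v j)"
      by metis
    have "inj_on (\<lambda>v. (Q v, \<beta> (X v))) (PiE J (\<lambda>_. {..<M}))"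
    proof (rule inj_onI)
      fix v w assume v: "v \<in> PiE J (\<lambda>_. {..<M})" and w: "w \<in> PiE J (\<lambda>_. {..<M})"
        and eq: "(Q v, \<beta> (X v)) = (Q w, \<beta> (X w))"
      have "v j = w j" if j: "j \<in> J" for j
      proof -
        have "h j (X v) + v j * \<eta> = h j (X w) + w j * \<eta>"
          using XQ[OF v] XQ[OF w] eq j by simp
        then have "(real (v j) - real (w j)) * \<eta> = - (h j (X v) - h j (X w))"
          by (simp add: left_diff_distrib)
        then have "\<bar>real (v j) - real (w j)\<bar> * \<eta> = \<bar>h j (X v) - h j (X w)\<bar>"
          using \<eta> by (metis abs_minus_cancel abs_mult abs_of_pos)
        also have "\<dots> \<le> L j * (\<Sum>k\<le>i. \<bar>X v k - X w k\<bar>)" using XQ[OF v] XQ[OF w] h(4)[OF j] by blast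
        also have "\<dots> \<le> \<Lambda> * (C / N)"
          using XQ[OF v] XQ[OF w] S eq by (intro mult_mono \<Lambda>[OF j] \<beta>(3) \<Lambda>0) (auto intro: sum_nonneg)
        also have "\<dots> < 1 * \<eta>" using small by simp
        finally have "\<bar>real (v j) - real (w j)\<bar> < 1" using \<eta> mult_less_cancel_right_pos by blast
        then show ?thesis by linarith
      qed
      then show "v = w" using v w by (meson PiE_ext)
    qed
    then have "card (PiE J (\<lambda>_. {..<M})) \<le> card (P \<times> \<beta> ` sphere_set i)"
      using XQ S P \<beta>(1) by (intro card_inj_on_le) auto
    then have "M ^ card J \<le> card P * card (\<beta> ` sphere_set i)"
      using J by (simp add: card_PiE card_cartesian_product)
    also have "\<dots> \<le> card P * ((i + 1) * (2 * (3 * c * M) ^ i))"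
    proof -
      have "(2 * N + 1) ^ i \<le> (3 * c * M) ^ i" using N by (intro power_mono) (auto simp: N_def)
      then show ?thesis using \<beta>(2) by (meson le_trans mult_le_mono2)
    qed
    also have "\<dots> = A * M ^ i" by (simp add: A_def power_mult_distrib algebra_simps)
    also have "\<dots> < M ^ Suc i" by (simp add: M_def)
    also have "\<dots> \<le> M ^ card J" using J by (intro power_increasing) (auto simp: M_def)
    finally show False by simp
  qed
  then obtain v where v: "v \<in> PiE J (\<lambda>_. {..<M})"
    "\<And>x p. x \<in> S \<Longrightarrow> p \<in> P \<Longrightarrow> \<exists>j\<in>J. h j x + v j * \<eta> \<noteq> p j" by blast
  show ?thesis
  proof
    show "continuous_on S (\<lambda>x. h j x + v j * \<eta>)" if "j \<in> J" for j
      using h(1)[OF that] by (intro continuous_intros)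
    show "\<exists>j\<in>J. h j x + v j * \<eta> \<noteq> p j" if "x \<in> S" "p \<in> P" for x p using v(2) that .
    show "\<bar>h j x + v j * \<eta> - f j x\<bar> < \<epsilon>" if "j \<in> J" "x \<in> S" for j x
    proof -
      have "v j < M" using v(1) that by auto
      then have "v j * \<eta> \<le> M * \<eta>" using \<eta> by (intro mult_right_mono) auto
      also have "M * \<eta> = \<epsilon>/2" by (simp add: \<eta>_def M_def field_simps)
      finally have "v j * \<eta> \<le> \<epsilon>/2" .
      moreover have "v j * \<eta> \<ge> 0" using \<eta> by simp
      ultimately show ?thesis using h(2)[OF that] by (simp add: abs_if split: if_splits)
    qed
  qed
qed

text \<open>The cut-off \<open>\<mu>\<close> is \<open>1\<close> where the distance of \<open>F x\<close> from \<open>P\<close> is at most \<open>\<epsilon> / 2\<close>, so that the map agrees with \<open>G\<close>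
  there. Elsewhere the distance from \<open>P\<close> exceeds the displacement, which is less than \<open>\<epsilon> / 2\<close>.\<close>

lemma damped_perturbation:
  fixes F G :: "nat \<Rightarrow> 'x \<Rightarrow> complex"
  assumes F: "\<And>i. i < n \<Longrightarrow> continuous_map K euclidean (F i)"
    and P: "finite P" and \<epsilon>: "\<epsilon> > 0"
    and near: "\<And>x. x \<in> topspace K \<Longrightarrow> (\<Sum>i<n. cmod (G i x - F i x)) < \<epsilon>/2"
    and avoid: "\<And>x p. \<lbrakk>x \<in> topspace K; p \<in> P\<rbrakk> \<Longrightarrow> \<exists>i<n. G i x \<noteq> p i"
  obtains \<mu> :: "'x \<Rightarrow> real" where "continuous_map K euclideanreal \<mu>" "\<And>x. 0 \<le> \<mu> x" "\<And>x. \<mu> x \<le> 1"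
    "\<And>x. \<lbrakk>x \<in> topspace K; \<And>p. p \<in> P \<Longrightarrow> (\<Sum>i<n. cmod (F i x - p i)) \<ge> \<epsilon>\<rbrakk> \<Longrightarrow> \<mu> x = 0"
    "\<And>x p. \<lbrakk>x \<in> topspace K; p \<in> P\<rbrakk> \<Longrightarrow> \<exists>i<n. F i x + \<mu> x * (G i x - F i x) \<noteq> p i"
proof -
  define d where "d x p = (\<Sum>i<n. cmod (F i x - p i))" for x and p :: "nat \<Rightarrow> complex"
  define \<mu> where "\<mu> x = min 1 (\<Sum>p\<in>P. max 0 (2 - 2 / \<epsilon> * d x p))" for x
  have "continuous_map K euclideanreal (\<lambda>x. d x p)" for p
    unfolding d_def by (intro continuous_map_sum continuous_map_norm continuous_map_diff F continuous_map_canonical_const) auto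
  then have "continuous_map K euclideanreal \<mu>"
    unfolding \<mu>_def using P
    by (intro continuous_map_real_min continuous_map_sum continuous_map_real_max continuous_map_diff
        continuous_map_real_mult continuous_map_canonical_const)
  moreover have "0 \<le> \<mu> x" "\<mu> x \<le> 1" for x by (auto simp: \<mu>_def sum_nonneg)
  moreover have "\<mu> x = 0" if "\<And>p. p \<in> P \<Longrightarrow> d x p \<ge> \<epsilon>" for x
  proof -
    have "max 0 (2 - 2 / \<epsilon> * d x p) = 0" if "p \<in> P" for p
      using \<open>\<And>p. p \<in> P \<Longrightarrow> d x p \<ge> \<epsilon>\<close>[OF that] \<epsilon> by (simp add: field_simps)
    then show ?thesis by (simp add: \<mu>_def)
  qed
  moreover have "\<exists>i<n. F i x + \<mu> x * (G i x - F i x) \<noteq> p i" if x: "x \<in> topspace K" and p: "p \<in> P" for x p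
  proof (cases "d x p \<le> \<epsilon> / 2")
    case True
    then have "1 \<le> max 0 (2 - 2 / \<epsilon> * d x p)" using \<epsilon> by (simp add: field_simps)
    also have "\<dots> \<le> (\<Sum>p\<in>P. max 0 (2 - 2 / \<epsilon> * d x p))" using P p by (intro member_le_sum) auto
    finally have "\<mu> x = 1" by (simp add: \<mu>_def)
    then show ?thesis using avoid[OF x p] by simp
  next
    case False
    show ?thesis
    proof (rule ccontr)
      assume "\<not> ?thesis"
      then have "d x p = (\<Sum>i<n. cmod (F i x - (F i x + \<mu> x * (G i x - F i x))))"
        unfolding d_def by (intro sum.cong) auto
      also have "\<dots> = \<mu> x * (\<Sum>i<n. cmod (G i x - F i x))"
        using \<open>0 \<le> \<mu> x\<close> by (simp add: norm_mult sum_distrib_left)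
      also have "\<dots> \<le> 1 * (\<Sum>i<n. cmod (G i x - F i x))"
        using \<open>\<mu> x \<le> 1\<close> by (intro mult_right_mono sum_nonneg) auto
      also have "\<dots> < \<epsilon> / 2" using near[OF x] by simp
      finally show False using False by simp
    qed
  qed
  ultimately show ?thesis using that unfolding d_def by blast
qed

section \<open>Monic polynomials and their roots\<close>

text \<open>Up to sign, its coefficients are the elementary symmetric functions of the tuple.\<close>

definition root_poly :: "nat set \<Rightarrow> (nat \<Rightarrow> complex) \<Rightarrow> complex poly"
  where "root_poly I a = (\<Prod>i\<in>I. [:- a i, 1:])"

lemma degree_root_poly: "finite I \<Longrightarrow> degree (root_poly I a) = card I"
  by (simp add: root_poly_def degree_prod_sum_eq)

lemma monic_root_poly: "finite I \<Longrightarrow> coeff (root_poly I a) (card I) = 1"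
  using lead_coeff_prod[of "\<lambda>i. [:- a i, 1:]" I] by (simp add: root_poly_def degree_prod_sum_eq)

lemma root_poly_eqI:
  assumes "finite I" "\<And>j. j < card I \<Longrightarrow> coeff (root_poly I a) j = coeff (root_poly I b) j"
  shows "root_poly I a = root_poly I b"
proof (rule poly_eqI)
  fix j
  consider "j < card I" | "j = card I" | "j > card I" by linarith
  then show "coeff (root_poly I a) j = coeff (root_poly I b) j"
    by cases (use assms in \<open>simp_all add: monic_root_poly coeff_eq_0 degree_root_poly\<close>)
qed

lemma continuous_map_coeff_root_poly:
  assumes "finite I" "\<And>i. i \<in> I \<Longrightarrow> continuous_map T euclidean (\<lambda>x. b x i)"
  shows "continuous_map T euclidean (\<lambda>x. coeff (root_poly I (b x)) j)"
  using assms
proof (induction I arbitrary: j rule: finite_induct)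
  case empty
  then show ?case by (simp add: root_poly_def)
next
  case (insert i I)
  have eq: "coeff (root_poly (insert i I) (b x)) j =
      (if j = 0 then 0 else coeff (root_poly I (b x)) (j - 1)) - b x i * coeff (root_poly I (b x)) j" for x
    using insert.hyps by (simp add: root_poly_def coeff_pCons split: nat.splits)
  show ?case
    unfolding eq using insert
    by (cases "j = 0"; simp; intro continuous_intros continuous_map_complex_mult; simp)
qed

text \<open>Both tuples list the roots of the polynomial with their multiplicities.\<close>

lemma root_poly_eq_imp_permutes:
  assumes "finite I" "root_poly I a = root_poly I b"
  obtains p where "p permutes I" "\<And>i. i \<in> I \<Longrightarrow> b i = a (p i)"
proof -
  have "proots (root_poly I a) = image_mset a (mset_set I)" for a
  proof -
    have "proots (root_poly I a) = (\<Sum>i\<in>I. {#a i#})"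
      unfolding root_poly_def by (subst proots_prod) auto
    also have "\<dots> = image_mset a (mset_set I)"
      using assms(1) by (induction I rule: finite_induct) auto
    finally show ?thesis .
  qed
  then have "image_mset b (mset_set I) = image_mset a (mset_set I)"
    using assms(2) by metis
  then show ?thesis
    using image_mset_eq_implies_permutes[OF assms(1)] that by metis
qed

lemma root_poly_permute:
  assumes "bij_betw p I I" "\<And>i. i \<in> I \<Longrightarrow> b i = a (p i)"
  shows "root_poly I b = root_poly I a"
  unfolding root_poly_def
  by (subst prod.reindex_bij_betw[OF assms(1), symmetric]) (simp add: assms(2))

text \<open>The fundamental theorem of algebra, with the roots listed by a given index set.\<close>

lemma monic_poly_is_root_poly:
  fixes q :: "complex poly"
  assumes "finite I" "degree q = card I" "lead_coeff q = 1"
  obtains a where "q = root_poly I a"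
proof -
  obtain r where r: "smult (lead_coeff q) (\<Prod>i<degree q. [:- r i, 1:]) = q"
    using complex_poly_decompose' .
  obtain h where h: "bij_betw h I {..<card I}"
    using ex_bij_betw_finite_nat[OF assms(1)] by (auto simp: atLeast0LessThan)
  have "q = (\<Prod>i<card I. [:- r i, 1:])" using r assms by simp
  also have "\<dots> = root_poly I (r \<circ> h)"
    unfolding root_poly_def by (subst prod.reindex_bij_betw[OF h, symmetric]) simp
  finally show ?thesis using that by blast
qed

lemma poly_root_poly: "poly (root_poly I a) z = (\<Prod>i\<in>I. z - a i)"
  by (simp add: root_poly_def poly_prod)

text \<open>Roots depend continuously on the coefficients. Let \<open>p\<close> and \<open>q\<close> be the polynomials with roots \<open>a\<close> and \<open>b\<close>, and
  let \<open>z\<close> be a root of \<open>q\<close>. It is bounded in terms of the coefficients, so \<open>p(z) = p(z) - q(z)\<close> is small if the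
  coefficients are close. But \<open>p(z)\<close> is the product of the differences \<open>z - a l\<close>, so one of these is small.\<close>

lemma roots_near:
  assumes "finite I" "\<eta> > 0"
  obtains \<epsilon> where "\<epsilon> > 0"
    "\<And>b i. \<lbrakk>\<And>j. j < card I \<Longrightarrow> cmod (coeff (root_poly I b) j - coeff (root_poly I a) j) < \<epsilon>; i \<in> I\<rbrakk>
       \<Longrightarrow> \<exists>l\<in>I. cmod (b i - a l) < \<eta>"
proof -
  define k where "k = card I"
  define c where "c = coeff (root_poly I a)"
  \<comment> \<open>a bound for the roots of all monic polynomials with coefficients within \<open>1\<close> of \<open>c\<close>\<close>
  define R where "R = 1 + (\<Sum>j<k. cmod (c j) + 1)"
  define \<epsilon> where "\<epsilon> = min 1 (\<eta> ^ k / ((k + 1) * R ^ k))"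
  have R1: "R \<ge> 1" unfolding R_def by (simp add: sum_nonneg)
  have \<epsilon>: "\<epsilon> > 0" "\<epsilon> \<le> 1" using assms R1 by (simp_all add: \<epsilon>_def zero_less_mult_iff)
  have "\<exists>l\<in>I. cmod (b i - a l) < \<eta>"
    if b: "\<And>j. j < card I \<Longrightarrow> cmod (coeff (root_poly I b) j - coeff (root_poly I a) j) < \<epsilon>" and i: "i \<in> I"
    for b i
  proof (rule ccontr)
    assume "\<not> ?thesis"
    then have far: "\<And>l. l \<in> I \<Longrightarrow> \<eta> \<le> cmod (b i - a l)" by force
    define z where "z = b i"
    define d where "d = coeff (root_poly I b)"
    have k: "k > 0" using i assms(1) by (auto simp: k_def card_gt_0_iff)
    \<comment> \<open>both polynomials are monic, so only the lower coefficients contribute to their difference\<close>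
    have exp: "poly (root_poly I b') z = (\<Sum>j<k. coeff (root_poly I b') j * z ^ j) + z ^ k" for b'
      using assms(1)
      by (simp add: poly_altdef degree_root_poly k_def monic_root_poly flip: lessThan_Suc_atMost)
    have 0: "poly (root_poly I b) z = 0"
      using i assms(1) by (simp add: poly_root_poly z_def) (metis)
    have dc: "cmod (d j - c j) \<le> \<epsilon>" if "j < k" for j
      using b[of j] that by (simp add: d_def c_def k_def)
    have zR: "cmod z \<le> R"
    proof (cases "cmod z \<le> 1")
      case True then show ?thesis using R1 by simp
    next
      case False
      have "cmod z * cmod z ^ (k - 1) = cmod (z ^ k)"
        using k by (simp add: norm_power flip: power_Suc)
      also have "z ^ k = - (\<Sum>j<k. d j * z ^ j)"
        using 0 exp[of b] by (simp add: d_def eq_neg_iff_add_eq_0 add.commute)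
      also have "cmod \<dots> \<le> (\<Sum>j<k. cmod (d j) * cmod z ^ j)"
        by (simp add: norm_minus_cancel) (rule order_trans[OF norm_sum], simp add: norm_mult norm_power)
      also have "\<dots> \<le> (\<Sum>j<k. (cmod (c j) + 1) * cmod z ^ (k - 1))"
      proof (rule sum_mono)
        fix j assume "j \<in> {..<k}"
        then have j: "j < k" by simp
        have "cmod (d j) \<le> cmod (c j) + cmod (d j - c j)"
          using norm_triangle_sub by blast
        also have "\<dots> \<le> cmod (c j) + 1" using dc[OF j] \<epsilon> by simp
        finally show "cmod (d j) * cmod z ^ j \<le> (cmod (c j) + 1) * cmod z ^ (k - 1)"
          using False j by (intro mult_mono power_increasing) auto
      qed
      also have "\<dots> \<le> R * cmod z ^ (k - 1)"
        unfolding R_def sum_distrib_right[symmetric] by (simp add: algebra_simps)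
      finally have "cmod z * cmod z ^ (k - 1) \<le> R * cmod z ^ (k - 1)" .
      moreover have "0 < cmod z ^ (k - 1)" using False by (intro zero_less_power) linarith
      ultimately show ?thesis by (simp add: mult_le_cancel_right)
    qed
    have "\<eta> ^ k = (\<Prod>l\<in>I. \<eta>)" by (simp add: k_def)
    also have "\<dots> \<le> (\<Prod>l\<in>I. cmod (z - a l))"
      using far assms by (intro prod_mono) (auto simp: z_def)
    also have "\<dots> = cmod (poly (root_poly I a) z)"
      by (simp add: poly_root_poly prod_norm)
    also have "poly (root_poly I a) z = (\<Sum>j<k. (c j - d j) * z ^ j)"
    proof -
      have "poly (root_poly I a) z = poly (root_poly I a) z - poly (root_poly I b) z" using 0 by simp
      then show ?thesis unfolding exp[of a] exp[of b]
        by (simp add: c_def d_def left_diff_distrib sum_subtractf)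
    qed
    also have "cmod \<dots> \<le> (\<Sum>j<k. \<epsilon> * R ^ k)"
    proof (rule sum_norm_le)
      fix j assume "j \<in> {..<k}"
      then have j: "j < k" by simp
      have "cmod z ^ j \<le> R ^ j" using zR by (simp add: power_mono)
      also have "\<dots> \<le> R ^ k" using R1 j by (simp add: power_increasing)
      finally show "cmod ((c j - d j) * z ^ j) \<le> \<epsilon> * R ^ k"
        using dc[OF j] \<epsilon> by (simp add: norm_mult norm_power norm_minus_commute mult_mono)
    qed
    also have "\<dots> = real k * (\<epsilon> * R ^ k)" by simp
    also have "\<dots> < real (k + 1) * (\<epsilon> * R ^ k)" using \<epsilon> R1 by simp
    also have "\<dots> \<le> \<eta> ^ k"
    proof -
      have "\<epsilon> \<le> \<eta> ^ k / ((k + 1) * R ^ k)" by (simp add: \<epsilon>_def)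
      moreover have "0 < (k + 1) * R ^ k" using R1 by simp
      ultimately show ?thesis by (simp add: pos_le_divide_eq algebra_simps)
    qed
    finally show False by simp
  qed
  with \<epsilon>(1) that show ?thesis by blast
qed

section \<open>Order statistics\<close>

definition order_stat :: "nat \<Rightarrow> (nat \<Rightarrow> real) \<Rightarrow> nat \<Rightarrow> real"
  where "order_stat m t j = sort (map t [0..<m]) ! j"

lemma order_stat_permute:
  assumes "bij_betw p {..<m} {..<m}" "\<And>i. i < m \<Longrightarrow> s i = t (p i)"
  shows "order_stat m s = order_stat m t"
proof -
  have "mset (map s [0..<m]) = image_mset t (image_mset p (mset_set {..<m}))"
    unfolding mset_map mset_upt multiset.map_comp atLeast0LessThan
    using assms(2) by (intro image_mset_cong) simp
  also have "image_mset p (mset_set {..<m}) = mset_set {..<m}"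
    using assms(1) by (simp add: bij_betw_def image_mset_mset_set)
  also have "image_mset t (mset_set {..<m}) = mset (map t [0..<m])"
    unfolding mset_map mset_upt by (simp add: atLeast0LessThan)
  finally have "sort (map s [0..<m]) = sort (map t [0..<m])"
    by (metis mset_sort properties_for_sort sorted_sort)
  then show ?thesis by (simp add: order_stat_def fun_eq_iff)
qed

lemma order_stat_mono: "\<lbrakk>i \<le> j; j < m\<rbrakk> \<Longrightarrow> order_stat m t i \<le> order_stat m t j"
  unfolding order_stat_def by (intro sorted_nth_mono) auto

lemma order_stat_eq_permute:
  obtains p where "p permutes {..<m}" "\<And>j. j < m \<Longrightarrow> order_stat m t j = t (p j)"
proof -
  have "mset (sort (map t [0..<m])) = mset (map t [0..<m])" by simp
  then obtain p where p: "p permutes {..<length (map t [0..<m])}"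
    "permute_list p (map t [0..<m]) = sort (map t [0..<m])"
    by (rule mset_eq_permutation)
  have "order_stat m t j = t (p j)" if "j < m" for j
  proof -
    have "p j < m" using permutes_in_image[OF p(1), of j] that by simp
    then show ?thesis
      unfolding order_stat_def p(2)[symmetric] using p(1) that by (simp add: permute_list_nth)
  qed
  with p(1) that show ?thesis by simp
qed

text \<open>Each \<open>order_stat\<close> is 1-Lipschitz for the maximum norm: the \<open>j + 1\<close> indices at which \<open>s\<close> is
  smallest cannot all be among the \<open>j\<close> indices at which \<open>t\<close> is smallest.\<close>

lemma order_stat_le:
  assumes "\<And>i. i < m \<Longrightarrow> t i \<le> s i + d" "j < m"
  shows "order_stat m t j \<le> order_stat m s j + d"
proof -
  obtain p where p: "p permutes {..<m}" "\<And>j. j < m \<Longrightarrow> order_stat m s j = s (p j)"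
    using order_stat_eq_permute[of m s] by blast
  obtain q where q: "q permutes {..<m}" "\<And>j. j < m \<Longrightarrow> order_stat m t j = t (q j)"
    using order_stat_eq_permute[of m t] by blast
  have "\<not> p ` {..j} \<subseteq> q ` {..<j}"
  proof
    assume "p ` {..j} \<subseteq> q ` {..<j}"
    then have "card (p ` {..j}) \<le> card (q ` {..<j})" by (intro card_mono) auto
    also have "\<dots> \<le> j" using card_image_le[of "{..<j}" q] by simp
    finally show False
      using card_image[OF permutes_inj_on[OF p(1), of "{..j}"]] by simp
  qed
  then obtain l where l: "l \<le> j" "p l \<notin> q ` {..<j}" by auto
  have "p l < m" using permutes_in_image[OF p(1), of l] l(1) assms(2) by simp
  then have "p l \<in> q ` {..<m}" using permutes_image[OF q(1)] by simp
  then obtain l' where l': "l' < m" "p l = q l'" by auto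
  then have "j \<le> l'" using l(2) by (metis imageI lessThan_iff not_le)
  then have "order_stat m t j \<le> order_stat m t l'" using l' order_stat_mono by blast
  also have "\<dots> = t (p l)" using q l' by simp
  also have "\<dots> \<le> s (p l) + d" using assms(1) \<open>p l < m\<close> by blast
  also have "s (p l) = order_stat m s l" using p l(1) assms(2) by simp
  also have "\<dots> \<le> order_stat m s j" using l(1) assms(2) order_stat_mono by blast
  finally show ?thesis by simp
qed

lemma continuous_map_order_stat:
  assumes "\<And>i. i < m \<Longrightarrow> continuous_map T euclidean (\<lambda>x. t x i)" "j < m"
  shows "continuous_map T euclidean (\<lambda>x. order_stat m (t x) j)"
proof -
  have "continuous_map T Met_TC.mtopology (\<lambda>x. order_stat m (t x) j)"
    unfolding Met_TC.continuous_map_to_metric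
  proof (intro ballI allI impI)
    fix x and \<epsilon> :: real
    assume x: "x \<in> topspace T" and \<epsilon>: "\<epsilon> > 0"
    define U where "U = (\<Inter>i\<in>{..<m}. {y \<in> topspace T. t y i \<in> ball (t x i) (\<epsilon>/2)})"
    have "openin T U" unfolding U_def
    proof (intro openin_INT2 openin_continuous_map_preimage)
      fix i assume "i \<in> {..<m}"
      then show "continuous_map T euclidean (\<lambda>y. t y i)" using assms(1) by simp
    qed (use assms(2) in auto)
    moreover have "x \<in> U" using x \<epsilon> by (simp add: U_def)
    moreover have "order_stat m (t y) j \<in> Met_TC.mball (order_stat m (t x) j) \<epsilon>" if "y \<in> U" for y
    proof -
      have d: "\<bar>t x i - t y i\<bar> < \<epsilon>/2" if "i < m" for i
        using \<open>y \<in> U\<close> that by (auto simp: U_def dist_real_def)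
      have "order_stat m (t y) j \<le> order_stat m (t x) j + \<epsilon>/2"
        using d assms(2) by (intro order_stat_le) (smt (verit) field_sum_of_halves)+
      moreover have "order_stat m (t x) j \<le> order_stat m (t y) j + \<epsilon>/2"
        using d assms(2) by (intro order_stat_le) (smt (verit) field_sum_of_halves)+
      ultimately show ?thesis using \<epsilon> by (simp add: dist_real_def)
    qed
    ultimately show "\<exists>U. openin T U \<and> x \<in> U \<and> (\<forall>y\<in>U. order_stat m (t y) j \<in> Met_TC.mball (order_stat m (t x) j) \<epsilon>)"
      by blast
  qed
  then show ?thesis by simp
qed

section \<open>The reduced symmetric product as a space of configurations\<close>

abbreviation tuples :: "nat \<Rightarrow> 'a topology \<Rightarrow> (nat \<Rightarrow> 'a) topology"
  where "tuples n X \<equiv> product_topology (\<lambda>_. X) {..<n}"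

definition config :: "nat \<Rightarrow> 'a topology \<Rightarrow> 'a \<Rightarrow> (nat \<Rightarrow> 'a) \<Rightarrow> (nat \<Rightarrow> 'a) set set"
  where "config n X e x = collapse_map (sp_lower X e n) (sp_class n x)"

lemma in_tuples: "x \<in> topspace (tuples n X) \<longleftrightarrow> (\<forall>i<n. x i \<in> topspace X) \<and> (\<forall>i\<ge>n. x i = undefined)"
  by (auto simp: PiE_iff extensional_def)

lemma sp_class_self: "x \<in> sp_class n x"
  unfolding sp_class_def by (auto intro!: exI[of _ id] permutes_id)

lemma sp_class_eq_iff: "sp_class n x = sp_class n y \<longleftrightarrow> (\<exists>p. p permutes {..<n} \<and> y = x \<circ> p)"
proof
  assume "sp_class n x = sp_class n y"
  then have "y \<in> sp_class n x" using sp_class_self[of y n] by simp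
  then show "\<exists>p. p permutes {..<n} \<and> y = x \<circ> p" by (auto simp: sp_class_def)
next
  assume "\<exists>p. p permutes {..<n} \<and> y = x \<circ> p"
  then show "sp_class n x = sp_class n y" using sp_class_comp by metis
qed

lemma tuples_permute:
  assumes "p permutes {..<n}" "x \<in> topspace (tuples n X)"
  shows "x \<circ> p \<in> topspace (tuples n X)"
proof -
  have "p i < n" if "i < n" for i using permutes_in_image[OF assms(1), of i] that by simp
  moreover have "p i = i" if "i \<ge> n" for i using permutes_not_in[OF assms(1), of i] that by simp
  ultimately show ?thesis using assms(2) unfolding in_tuples by simp
qed

lemma topspace_sym_prod: "topspace (sym_prod n X) = sp_class n ` topspace (tuples n X)"
  by (simp add: sym_prod_def Let_def topspace_final_topology del: topspace_product_topology)

lemma sp_class_in_lower: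
  assumes "x \<in> topspace (tuples n X)" "e \<in> topspace X"
  shows "sp_class n x \<in> sp_lower X e n \<longleftrightarrow> (\<exists>i<n. x i = e)"
proof (cases n)
  case (Suc m)
  show ?thesis
  proof
    assume "sp_class n x \<in> sp_lower X e n"
    then obtain y where y: "sp_class n x = sp_class n (case_nat e y)"
      by (auto simp: Suc topspace_sym_prod sp_incl_class simp del: topspace_product_topology)
    then obtain p where p: "p permutes {..<n}" "case_nat e y = x \<circ> p" by (auto simp: sp_class_eq_iff)
    then have "x (p 0) = e" by (metis comp_apply nat.case(1))
    moreover have "p 0 < n" using permutes_in_image[OF p(1), of 0] by (simp add: Suc)
    ultimately show "\<exists>i<n. x i = e" by blast
  next
    assume "\<exists>i<n. x i = e"
    then obtain i where i: "i < n" "x i = e" by blast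
    define p where "p = Transposition.transpose 0 i"
    have p: "p permutes {..<n}" using i by (simp add: p_def permutes_swap_id)
    define y where "y = x \<circ> p"
    have y: "y \<in> topspace (tuples n X)" using tuples_permute[OF p assms(1)] by (simp add: y_def)
    have "y = case_nat e (y \<circ> Suc)"
      using i by (auto simp: y_def p_def fun_eq_iff split: nat.splits)
    moreover have "y \<circ> Suc \<in> topspace (tuples m X)" using y unfolding in_tuples by (simp add: Suc)
    moreover have "sp_class n x = sp_class n y" by (simp add: y_def sp_class_comp[OF p])
    ultimately have "sp_class n x = sp_incl e m (sp_class m (y \<circ> Suc))"
      "sp_class m (y \<circ> Suc) \<in> topspace (sym_prod m X)"
      using sp_incl_class[of e m "y \<circ> Suc"] unfolding topspace_sym_prod Suc by (metis, blast)
    then show "sp_class n x \<in> sp_lower X e n" unfolding Suc sp_lower.simps by (rule image_eqI)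
  qed
qed simp

lemma collapse_map_eq_iff: "collapse_map A x = collapse_map A y \<longleftrightarrow> x \<in> A \<and> y \<in> A \<or> x = y"
  unfolding collapse_map_def by (metis singletonD singletonI)

lemma config_eq_iff:
  assumes "x \<in> topspace (tuples n X)" "y \<in> topspace (tuples n X)" "e \<in> topspace X"
  shows "config n X e x = config n X e y \<longleftrightarrow>
    (\<exists>i<n. x i = e) \<and> (\<exists>i<n. y i = e) \<or> (\<exists>p. p permutes {..<n} \<and> y = x \<circ> p)"
proof -
  let ?L = "sp_lower X e n"
  have eq: "config n X e x = config n X e y \<longleftrightarrow>
     sp_class n x \<in> ?L \<and> sp_class n y \<in> ?L \<or> sp_class n x = sp_class n y"
    unfolding config_def by (rule collapse_map_eq_iff)
  show ?thesis unfolding eq sp_class_in_lower[OF assms(1,3)] sp_class_in_lower[OF assms(2,3)] sp_class_eq_iff ..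
qed

lemma quotient_map_config:
  assumes "n \<ge> 1" "e \<in> topspace X"
  shows "quotient_map (tuples n X) (reduced_sym_prod n X e) (config n X e)"
proof -
  have 1: "quotient_map (tuples n X) (sym_prod n X) (sp_class n)"
    by (simp only: sym_prod_def Let_def quotient_map_final_topology)
  have "(\<lambda>i\<in>{..<n}. e) \<in> topspace (tuples n X)" using assms by simp
  then have L: "\<exists>c\<in>topspace (sym_prod n X). c \<in> sp_lower X e n"
    using sp_class_in_lower[where x="\<lambda>i\<in>{..<n}. e" and n=n and X=X and e=e] assms unfolding topspace_sym_prod
    by (metis (no_types, lifting) imageI lessThan_iff less_le_trans restrict_apply' zero_less_one)
  then have "sp_lower X e n \<in> collapse_map (sp_lower X e n) ` topspace (sym_prod n X)"
    by (metis collapse_map_def imageI)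
  then have "insert (sp_lower X e n) (collapse_map (sp_lower X e n) ` topspace (sym_prod n X)) =
      collapse_map (sp_lower X e n) ` topspace (sym_prod n X)"
    by (rule insert_absorb)
  then have 2: "quotient_map (sym_prod n X) (reduced_sym_prod n X e) (collapse_map (sp_lower X e n))"
    by (simp add: reduced_sym_prod_def collapse_def quotient_map_final_topology)
  have "config n X e = collapse_map (sp_lower X e n) \<circ> sp_class n" by (simp add: config_def fun_eq_iff)
  then show ?thesis using quotient_map_compose[OF 1 2] by simp
qed

lemma continuous_map_permute:
  assumes "p permutes {..<n}"
  shows "continuous_map (tuples n X) (tuples n X) (\<lambda>x. x \<circ> p)"
  unfolding continuous_map_componentwise
proof (intro conjI ballI)
  show "(\<lambda>x. x \<circ> p) ` topspace (tuples n X) \<subseteq> extensional {..<n}"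
    using tuples_permute[OF assms] by (fastforce simp: PiE_iff)
  fix k assume "k \<in> {..<n}"
  then show "continuous_map (tuples n X) X (\<lambda>x. (x \<circ> p) k)"
    using permutes_in_image[OF assms, of k] continuous_map_product_projection[of "p k" "{..<n}" "\<lambda>_. X"] by simp
qed

text \<open>The saturation of a closed set \<open>A\<close> of tuples consists of its finitely many permuted copies and, if \<open>A\<close> meets
  the set of tuples with an entry \<open>e\<close>, of that whole closed set.\<close>

lemma closed_map_config:
  assumes "n \<ge> 1" "e \<in> topspace X" "closedin X {e}"
  shows "closed_map (tuples n X) (reduced_sym_prod n X e) (config n X e)"
  unfolding closed_map_def
proof (intro allI impI)
  fix A assume A: "closedin (tuples n X) A"
  let ?T = "topspace (tuples n X)"
  let ?q = "config n X e"
  have "closedin (tuples n X) {x \<in> ?T. x i = e}" if "i < n" for i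
    using closedin_continuous_map_preimage[OF continuous_map_product_projection[of i "{..<n}" "\<lambda>_. X"] assms(3)] that by simp
  then have E: "closedin (tuples n X) (\<Union>i\<in>{..<n}. {x \<in> ?T. x i = e})"
    by (intro closedin_Union) auto
  have P: "closedin (tuples n X) (\<Union>p\<in>{p. p permutes {..<n}}. {x \<in> ?T. x \<circ> p \<in> A})"
    using closedin_continuous_map_preimage[OF continuous_map_permute A]
    by (intro closedin_Union) (auto simp: finite_permutations)
  have AT: "A \<subseteq> ?T" using A closedin_subset by blast
  have "{x \<in> ?T. ?q x \<in> ?q ` A} = (\<Union>p\<in>{p. p permutes {..<n}}. {x \<in> ?T. x \<circ> p \<in> A}) \<union>
      (if \<exists>x\<in>A. \<exists>i<n. x i = e then (\<Union>i\<in>{..<n}. {x \<in> ?T. x i = e}) else {})" (is "?l = ?r")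
  proof (rule set_eqI)
    fix x
    show "x \<in> ?l \<longleftrightarrow> x \<in> ?r"
    proof (cases "x \<in> ?T")
      case True
      then have "?q x = ?q a \<longleftrightarrow> (\<exists>i<n. x i = e) \<and> (\<exists>i<n. a i = e) \<or> (\<exists>p. p permutes {..<n} \<and> a = x \<circ> p)"
        if "a \<in> A" for a using config_eq_iff[OF True _ assms(2)] that AT by blast
      then have "x \<in> ?l \<longleftrightarrow> (\<exists>a\<in>A. (\<exists>i<n. x i = e) \<and> (\<exists>i<n. a i = e) \<or> (\<exists>p. p permutes {..<n} \<and> a = x \<circ> p))"
        using True by (auto simp: image_iff simp del: topspace_product_topology)
      then show ?thesis using True by (auto simp del: topspace_product_topology)
    qed (auto simp del: topspace_product_topology)
  qed
  then have "closedin (tuples n X) {x \<in> ?T. ?q x \<in> ?q ` A}"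
    using E P by (auto intro: closedin_Un)
  moreover have "?q ` A \<subseteq> topspace (reduced_sym_prod n X e)"
    using AT quotient_imp_surjective_map[OF quotient_map_config[OF assms(1,2)]] by blast
  ultimately show "closedin (reduced_sym_prod n X e) (?q ` A)"
    using quotient_map_config[OF assms(1,2)] by (auto simp: quotient_map_closedin)
qed

section \<open>Configurations in the charts of the cells\<close>

definition closed_nbhd :: "complex set \<Rightarrow> real \<Rightarrow> complex set"
  where "closed_nbhd Z \<delta> = (\<Union>c\<in>Z. cball c \<delta>)"

definition open_nbhd :: "complex set \<Rightarrow> real \<Rightarrow> complex set"
  where "open_nbhd Z \<delta> = (\<Union>c\<in>Z. ball c \<delta>)"

text \<open>What the argument needs to know about a two-complex with one-skeleton \<open>S\<close>: charts \<open>u\<close> around the centres of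
  the two-cells and \<open>v\<close> around the midpoints of the one-cells, and deformations that clear the cells
  outside a small neighbourhood of the centres. All two-cells are charted by a single subset of
  the plane and all one-cells by a single subset of the real line, with centres \<open>Z2\<close> and \<open>Z1\<close>; so
  points of different cells can be listed by one polynomial, and sorted.\<close>

locale cell_charts =
  fixes X :: "'a topology" and S :: "'a set" and e :: 'a
    and u v :: "complex \<Rightarrow> 'a" and Z1 Z2 :: "complex set"
  assumes Hausdorff: "Hausdorff_space X" and closed_S: "closedin X S" and e_in: "e \<in> S"
    and fin: "finite Z1" "finite Z2" and Z1_real: "Z1 \<subseteq> \<real>"
    and v: "continuous_map (top_of_set (closed_nbhd Z1 (1/2) \<inter> \<real>)) X v" "inj_on v (closed_nbhd Z1 (1/2) \<inter> \<real>)"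
      "v ` (closed_nbhd Z1 (1/2) \<inter> \<real>) \<subseteq> S - {e}" "openin (subtopology X S) (v ` (open_nbhd Z1 (1/2) \<inter> \<real>))"
    and u: "continuous_map (top_of_set (closed_nbhd Z2 (1/2))) X u" "inj_on u (closed_nbhd Z2 (1/2))"
      "u ` closed_nbhd Z2 (1/2) \<subseteq> topspace X - S" "openin X (u ` open_nbhd Z2 (1/2))"
    and push: "\<And>\<delta>. \<delta> > 0 \<Longrightarrow> \<exists>H. continuous_map (prod_topology (top_of_set {0..1::real}) X) X H \<and>
       (\<forall>x\<in>topspace X. H (0, x) = x) \<and> (\<forall>t\<in>{0..1}. H (t, e) = e) \<and> (\<forall>t\<in>{0..1}. \<forall>x\<in>S. H (t, x) \<in> S) \<and>
       (\<forall>x\<in>topspace X - S - u ` closed_nbhd Z2 \<delta>. H (1, x) \<in> S) \<and>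
       (\<forall>x\<in>S - v ` (closed_nbhd Z1 \<delta> \<inter> \<real>). H (1, x) = e)"
begin

lemma e_X: "e \<in> topspace X" and S_X: "S \<subseteq> topspace X"
  using e_in closedin_subset[OF closed_S] by auto

lemma closed_e: "closedin X {e}"
  by (rule closedin_Hausdorff_singleton[OF Hausdorff e_X])

lemma compact_closed_nbhd: "compact (closed_nbhd Z1 \<delta> \<inter> \<real>)" "compact (closed_nbhd Z2 \<delta>)"
proof -
  have *: "compact (closed_nbhd Z \<delta>)" if "finite Z" for Z
    unfolding closed_nbhd_def by (intro compact_UN that) simp
  show "compact (closed_nbhd Z1 \<delta> \<inter> \<real>)" "compact (closed_nbhd Z2 \<delta>)"
    using *[OF fin(1)] *[OF fin(2)] closed_complex_Reals by (auto intro: compact_Int_closed)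
qed

end

text \<open>The configurations of interest have \<open>m\<close> points in the one-cells, listed first, and \<open>n - m\<close> in the two-cells.\<close>

locale config_stage = cell_charts +
  fixes n m :: nat
  assumes n1: "n \<ge> 1" and mn: "m \<le> n"
begin

abbreviation "Y \<equiv> reduced_sym_prod n X e"
abbreviation "T \<equiv> tuples n (euclidean :: complex topology)"

definition chart :: "nat \<Rightarrow> complex \<Rightarrow> 'a"
  where "chart i = (if i < m then v else u)"

definition polybox :: "real \<Rightarrow> (nat \<Rightarrow> complex) set"
  where "polybox \<delta> = PiE {..<n} (\<lambda>i. if i < m then closed_nbhd Z1 \<delta> \<inter> \<real> else closed_nbhd Z2 \<delta>)"

definition open_polybox :: "(nat \<Rightarrow> complex) set"
  where "open_polybox = PiE {..<n} (\<lambda>i. if i < m then open_nbhd Z1 (1/2) \<inter> \<real> else open_nbhd Z2 (1/2))"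

definition centres :: "(nat \<Rightarrow> complex) set"
  where "centres = PiE {..<n} (\<lambda>i. if i < m then Z1 else Z2)"

definition place :: "(nat \<Rightarrow> complex) \<Rightarrow> nat \<Rightarrow> 'a"
  where "place b = (\<lambda>i\<in>{..<n}. chart i (b i))"

definition realise :: "(nat \<Rightarrow> complex) \<Rightarrow> (nat \<Rightarrow> 'a) set set"
  where "realise b = config n X e (place b)"

text \<open>The condition \<open>k \<le> n\<close> leaves only the base point in level \<open>n + 1\<close>.\<close>

definition level :: "nat \<Rightarrow> (nat \<Rightarrow> 'a) set set set"
  where "level k = config n X e ` {x \<in> topspace (tuples n X). (\<exists>i<n. x i = e) \<or> k \<le> n \<and> (\<forall>i<k. x i \<in> S)}"

lemma quotient_config: "quotient_map (tuples n X) Y (config n X e)"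
  using quotient_map_config n1 e_X .

lemma closed_config: "closed_map (tuples n X) Y (config n X e)"
  using closed_map_config n1 e_X closed_e .

lemma topspace_Y: "topspace Y = config n X e ` topspace (tuples n X)"
  using quotient_imp_surjective_map[OF quotient_config] ..

lemma level_0: "level 0 = topspace Y"
  unfolding level_def topspace_Y by simp

lemma const_tuple: "(\<lambda>i\<in>{..<n}. e) \<in> topspace (tuples n X)"
  using e_X by simp

lemma level_top: "level (Suc n) = {config n X e (\<lambda>i\<in>{..<n}. e)}"
proof -
  have "config n X e x = config n X e (\<lambda>i\<in>{..<n}. e)" if "x \<in> topspace (tuples n X)" "\<exists>i<n. x i = e" for x
    using config_eq_iff[OF that(1) const_tuple e_X] that(2) n1 by auto
  then show ?thesis
    unfolding level_def using const_tuple n1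
    by (auto simp del: topspace_product_topology intro!: image_eqI[of _ _ "\<lambda>i\<in>{..<n}. e"] exI[of _ 0])
qed

lemma level_m: "level m = config n X e ` {x \<in> topspace (tuples n X). \<forall>i<m. x i \<in> S}" (is "_ = _ ` ?A")
proof (rule subset_antisym)
  show "level m \<subseteq> config n X e ` ?A"
    unfolding level_def
  proof (rule image_subsetI)
    fix x assume x: "x \<in> {x \<in> topspace (tuples n X). (\<exists>i<n. x i = e) \<or> m \<le> n \<and> (\<forall>i<m. x i \<in> S)}"
    show "config n X e x \<in> config n X e ` ?A"
    proof (cases "\<exists>i<n. x i = e")
      case True
      then have "config n X e x = config n X e (\<lambda>i\<in>{..<n}. e)"
        using config_eq_iff[OF _ const_tuple e_X, of x] x n1 by auto
      moreover have "(\<lambda>i\<in>{..<n}. e) \<in> ?A" using const_tuple mn e_in by simp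
      ultimately show ?thesis by (rule image_eqI)
    next
      case False
      then have "x \<in> ?A" using x by blast
      then show ?thesis by (rule imageI)
    qed
  qed
  show "config n X e ` ?A \<subseteq> level m" unfolding level_def using mn by (intro image_mono) blast
qed

lemma open_polybox_subset: "open_polybox \<subseteq> polybox (1/2)"
  unfolding open_polybox_def polybox_def by (intro PiE_mono) (auto simp: open_nbhd_def closed_nbhd_def less_imp_le)

lemma polybox_mono: "\<delta> \<le> \<delta>' \<Longrightarrow> polybox \<delta> \<subseteq> polybox \<delta>'"
  unfolding polybox_def by (intro PiE_mono) (force simp: closed_nbhd_def)

lemma centres_subset: "\<delta> \<ge> 0 \<Longrightarrow> centres \<subseteq> polybox \<delta>"
  unfolding polybox_def centres_def using Z1_real by (intro PiE_mono) (auto simp: closed_nbhd_def)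

lemma finite_centres: "finite centres"
  unfolding centres_def using fin by (intro finite_PiE) auto

lemma compact_polybox: "compactin T (polybox \<delta>)"
  unfolding polybox_def compactin_PiE using compact_closed_nbhd by auto

lemma polybox_coord:
  assumes "b \<in> polybox (1/2)" "i < n"
  shows "i < m \<Longrightarrow> b i \<in> closed_nbhd Z1 (1/2) \<inter> \<real>" "\<not> i < m \<Longrightarrow> b i \<in> closed_nbhd Z2 (1/2)"
  using assms by (auto simp: polybox_def PiE_iff split: if_splits dest!: bspec[of _ _ i])

lemma place_in:
  assumes "b \<in> polybox (1/2)"
  shows "place b \<in> topspace (tuples n X)" "\<And>i. i < n \<Longrightarrow> place b i \<in> S \<longleftrightarrow> i < m"
    "\<And>i. i < n \<Longrightarrow> place b i \<noteq> e"
proof -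
  have *: "i < m \<Longrightarrow> place b i \<in> S - {e}" "\<not> i < m \<Longrightarrow> place b i \<in> topspace X - S" if "i < n" for i
    using polybox_coord[OF assms that] v(3) u(3) that by (auto simp: place_def chart_def)
  show "place b \<in> topspace (tuples n X)"
    using * S_X unfolding in_tuples by (metis DiffD1 not_less place_def lessThan_iff restrict_apply subsetD)
  show "i < n \<Longrightarrow> place b i \<in> S \<longleftrightarrow> i < m" "i < n \<Longrightarrow> place b i \<noteq> e" for i
    using *[of i] e_in by auto
qed

lemma continuous_place: "continuous_map (subtopology T (polybox (1/2))) (tuples n X) place"
  unfolding continuous_map_componentwise
proof (intro conjI ballI)
  show "place ` topspace (subtopology T (polybox (1/2))) \<subseteq> extensional {..<n}"
    by (auto simp: place_def)
  fix i assume i: "i \<in> {..<n}"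
  let ?U = "if i < m then closed_nbhd Z1 (1/2) \<inter> \<real> else closed_nbhd Z2 (1/2)"
  have "continuous_map (subtopology T (polybox (1/2))) (top_of_set ?U) (\<lambda>b. b i)"
    unfolding continuous_map_in_subtopology
    using i polybox_coord by (auto intro!: continuous_map_from_subtopology continuous_map_product_projection)
  moreover have "continuous_map (top_of_set ?U) X (chart i)"
    using u(1) v(1) by (simp add: chart_def)
  ultimately have "continuous_map (subtopology T (polybox (1/2))) X (chart i \<circ> (\<lambda>b. b i))"
    by (rule continuous_map_compose)
  then show "continuous_map (subtopology T (polybox (1/2))) X (\<lambda>b. place b i)"
    using i by (simp add: place_def o_def)
qed

text \<open>The permutation maps the first \<open>m\<close> slots into the slots of \<open>x\<close> with an entry in \<open>S\<close>. There are only \<open>m\<close> of these,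
  so it permutes them.\<close>

lemma permutation_splits:
  assumes p: "p permutes {..<n}" and x: "\<And>i. i < n \<Longrightarrow> x i \<in> S \<longleftrightarrow> i < m" and y: "\<And>i. i < m \<Longrightarrow> (x \<circ> p) i \<in> S"
    and i: "i < n"
  shows "p i < m \<longleftrightarrow> i < m"
proof -
  have pn: "p j < n" if "j < n" for j using permutes_in_image[OF p, of j] that by simp
  have sub: "p ` {..<m} \<subseteq> {..<m}" using x y pn mn by (force simp: less_le_trans)
  moreover have inj: "inj_on p {..<m}" using permutes_inj_on[OF p] .
  ultimately have eq: "p ` {..<m} = {..<m}" by (simp add: card_subset_eq card_image)
  show ?thesis
  proof
    assume "p i < m"
    then have "p i \<in> p ` {..<m}" using eq by simp
    then obtain j where "j < m" "p i = p j" by auto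
    then show "i < m" using permutes_inj[OF p] by (simp add: inj_eq)
  next
    assume "i < m" then show "p i < m" using sub by auto
  qed
qed

lemma permutation_splits_bij:
  assumes p: "p permutes {..<n}" and "\<And>i. i < n \<Longrightarrow> p i < m \<longleftrightarrow> i < m"
  shows "bij_betw p {..<m} {..<m}" "bij_betw p {m..<n} {m..<n}"
proof -
  have pn: "p j < n" if "j < n" for j using permutes_in_image[OF p, of j] that by simp
  have "p ` {..<m} \<subseteq> {..<m}" using assms(2) mn by auto
  then show "bij_betw p {..<m} {..<m}"
    using permutes_inj_on[OF p] by (simp add: bij_betw_def card_subset_eq card_image)
  have "p ` {m..<n} \<subseteq> {m..<n}" using assms(2) pn by (auto simp: leI)
  then show "bij_betw p {m..<n} {m..<n}"
    using permutes_inj_on[OF p] by (simp add: bij_betw_def card_subset_eq card_image)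
qed

text \<open>Points of arcs and points of discs cannot be exchanged, and the charts are injective.\<close>

lemma realise_eq_imp:
  assumes b: "b \<in> polybox (1/2)" "b' \<in> polybox (1/2)" and eq: "realise b = realise b'"
  obtains p where "p permutes {..<n}" "\<And>i. i < n \<Longrightarrow> p i < m \<longleftrightarrow> i < m" "\<And>i. i < n \<Longrightarrow> b' i = b (p i)"
proof -
  have "\<not> (\<exists>i<n. place b i = e)" using place_in(3)[OF b(1)] by blast
  then obtain p where p: "p permutes {..<n}" "place b' = place b \<circ> p"
    using eq config_eq_iff[OF place_in(1)[OF b(1)] place_in(1)[OF b(2)] e_X] unfolding realise_def by blast
  have split: "p i < m \<longleftrightarrow> i < m" if "i < n" for i
    using permutation_splits[OF p(1) place_in(2)[OF b(1)] _ that] place_in(2)[OF b(2)] mn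
    by (metis order_less_le_trans p(2))
  have "b' i = b (p i)" if i: "i < n" for i
  proof -
    have pn: "p i < n" using permutes_in_image[OF p(1), of i] i by simp
    have "place b' i = place b (p i)" using p(2) by simp
    then have "chart i (b' i) = chart i (b (p i))"
      using i pn split[OF i] by (simp add: place_def chart_def)
    then show ?thesis
      using polybox_coord[OF b(1) pn] polybox_coord[OF b(2) i] split[OF i] u(2) v(2)
      by (cases "i < m") (auto simp: chart_def dest: inj_onD)
  qed
  with p(1) split that show ?thesis by blast
qed

lemma realise_permute:
  assumes "b \<in> polybox (1/2)" "p permutes {..<n}" "\<And>i. i < n \<Longrightarrow> p i < m \<longleftrightarrow> i < m" "\<And>i. i < n \<Longrightarrow> b' i = b (p i)"
    and b': "b' \<in> polybox (1/2)"
  shows "realise b' = realise b"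
proof -
  have "place b' = place b \<circ> p"
  proof
    fix i show "place b' i = (place b \<circ> p) i"
      using assms permutes_in_image[OF assms(2), of i] permutes_not_in[OF assms(2), of i]
      by (cases "i < n") (auto simp: place_def chart_def)
  qed
  then show ?thesis
    using config_eq_iff[OF place_in(1)[OF assms(1)] place_in(1)[OF b'] e_X] assms(2) unfolding realise_def by metis
qed

text \<open>Sorting the real entries makes \<open>coords (sort_real b)\<close> depend only on the configuration \<open>realise b\<close>.\<close>

definition sort_real :: "(nat \<Rightarrow> complex) \<Rightarrow> nat \<Rightarrow> complex"
  where "sort_real b = (\<lambda>i\<in>{..<n}. if i < m then of_real (order_stat m (\<lambda>j. Re (b j)) i) else b i)"

text \<open>Sorting is kept separate from \<open>coords\<close>, so that coordinates make sense also for tuples whose real entries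
  are not in increasing order.\<close>

definition coords :: "(nat \<Rightarrow> complex) \<Rightarrow> nat \<Rightarrow> complex"
  where "coords b = (\<lambda>i\<in>{..<n}. if i < m then b i else coeff (root_poly {m..<n} b) (i - m))"

lemma continuous_coords: "continuous_map T T coords"
  unfolding continuous_map_componentwise
proof (intro conjI ballI)
  show "coords ` topspace T \<subseteq> extensional {..<n}" by (auto simp: coords_def)
  fix i assume i: "i \<in> {..<n}"
  have proj: "continuous_map T euclidean (\<lambda>b. b j)" if "j < n" for j
    using continuous_map_product_projection[of j "{..<n}" "\<lambda>_. euclidean"] that by simp
  have "continuous_map T euclidean (\<lambda>b. coeff (root_poly {m..<n} b) (i - m))"
    by (intro continuous_map_coeff_root_poly proj) auto
  then show "continuous_map T euclidean (\<lambda>b. coords b i)"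
    using i proj[of i] by (cases "i < m") (simp_all add: coords_def)
qed

lemma continuous_sort_real: "continuous_map T T sort_real"
  unfolding continuous_map_componentwise
proof (intro conjI ballI)
  show "sort_real ` topspace T \<subseteq> extensional {..<n}" by (auto simp: sort_real_def)
  fix i assume i: "i \<in> {..<n}"
  have proj: "continuous_map T euclidean (\<lambda>b. b j)" if "j < n" for j
    using continuous_map_product_projection[of j "{..<n}" "\<lambda>_. euclidean"] that by simp
  have Re: "continuous_map T euclidean (\<lambda>b. Re (b j))" if "j < n" for j
    using proj[OF that] by (simp add: continuous_map_atin tendsto_Re)
  have "continuous_map T euclidean (\<lambda>b. order_stat m (\<lambda>j. Re (b j)) i)" if "i < m"
    using that mn by (intro continuous_map_order_stat Re) auto
  then have "continuous_map T euclidean (\<lambda>b. complex_of_real (order_stat m (\<lambda>j. Re (b j)) i))" if "i < m"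
    using that by (simp add: continuous_map_atin tendsto_of_real)
  then show "continuous_map T euclidean (\<lambda>b. sort_real b i)"
    using i proj[of i] by (cases "i < m") (simp_all add: sort_real_def)
qed

lemma sort_real_props:
  assumes b: "b \<in> polybox (1/2)"
  obtains p where "p permutes {..<n}" "\<And>i. i < n \<Longrightarrow> p i < m \<longleftrightarrow> i < m" "\<And>i. i < n \<Longrightarrow> sort_real b i = b (p i)"
proof -
  obtain p where p: "p permutes {..<m}" "\<And>j. j < m \<Longrightarrow> order_stat m (\<lambda>j. Re (b j)) j = Re (b (p j))"
    using order_stat_eq_permute[of m "\<lambda>j. Re (b j)"] by blast
  have pn: "p permutes {..<n}" using p(1) mn by (auto intro: permutes_subset)
  moreover have pm: "p i < m \<longleftrightarrow> i < m" for i using permutes_in_image[OF p(1), of i] by simp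
  moreover have "sort_real b i = b (p i)" if i: "i < n" for i
  proof (cases "i < m")
    case True
    have "b (p i) \<in> \<real>" using polybox_coord(1)[OF b, of "p i"] pm True mn by auto
    then show ?thesis using True i p(2) by (simp add: sort_real_def)
  next
    case False
    then show ?thesis using i permutes_not_in[OF p(1), of i] by (simp add: sort_real_def)
  qed
  ultimately show ?thesis using that by blast
qed

lemma permuted_PiE:
  assumes "b \<in> PiE {..<n} (\<lambda>i. if i < m then A else B)" "p permutes {..<n}"
    "\<And>i. i < n \<Longrightarrow> p i < m \<longleftrightarrow> i < m" "\<And>i. i < n \<Longrightarrow> b' i = b (p i)" "b' \<in> extensional {..<n}"
  shows "b' \<in> PiE {..<n} (\<lambda>i. if i < m then A else B)"
proof (rule PiE_I)
  fix i assume i: "i \<in> {..<n}"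
  then have "p i \<in> {..<n}" using permutes_in_image[OF assms(2), of i] by simp
  then have "b (p i) \<in> (if p i < m then A else B)" using assms(1) by (rule PiE_mem[rotated])
  then show "b' i \<in> (if i < m then A else B)" using assms(3,4) i by simp
qed (use assms(5) in \<open>simp add: extensional_def\<close>)

lemma sort_real_extensional: "sort_real b \<in> extensional {..<n}"
  by (simp only: sort_real_def restrict_extensional)

lemma sort_real_polybox:
  assumes b: "b \<in> polybox (1/2)"
  shows "sort_real b \<in> polybox (1/2)" "realise (sort_real b) = realise b"
proof -
  obtain p where p: "p permutes {..<n}" "\<And>i. i < n \<Longrightarrow> p i < m \<longleftrightarrow> i < m" "\<And>i. i < n \<Longrightarrow> sort_real b i = b (p i)"
    using sort_real_props[OF b] by blast
  show 1: "sort_real b \<in> polybox (1/2)"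
    using permuted_PiE[OF b[unfolded polybox_def] p sort_real_extensional] unfolding polybox_def .
  show "realise (sort_real b) = realise b"
    using realise_permute[OF b p 1] .
qed

lemma realise_eq_imp_coords:
  assumes b: "b \<in> polybox (1/2)" "b' \<in> polybox (1/2)" and eq: "realise b = realise b'"
  shows "coords (sort_real b) = coords (sort_real b')"
proof -
  obtain p where p: "p permutes {..<n}" "\<And>i. i < n \<Longrightarrow> p i < m \<longleftrightarrow> i < m" "\<And>i. i < n \<Longrightarrow> b' i = b (p i)"
    using realise_eq_imp[OF b eq] by blast
  note bij = permutation_splits_bij[OF p(1,2)]
  have "order_stat m (\<lambda>j. Re (b' j)) = order_stat m (\<lambda>j. Re (b j))"
    using order_stat_permute[OF bij(1), of "\<lambda>j. Re (b' j)" "\<lambda>j. Re (b j)"] p(3) mn by simp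
  moreover have "root_poly {m..<n} (sort_real b') = root_poly {m..<n} (sort_real b)"
  proof (rule root_poly_permute[OF bij(2)])
    fix i assume i: "i \<in> {m..<n}"
    then have "p i \<in> {m..<n}" using bij(2) by (auto simp: bij_betw_def)
    then show "sort_real b' i = sort_real b (p i)" using i p(3) by (simp add: sort_real_def)
  qed
  ultimately show ?thesis unfolding coords_def by (auto simp: fun_eq_iff sort_real_def)
qed

text \<open>The coefficients determine the monic polynomial, and this determines its roots up to their order.\<close>

lemma coords_eq_imp_realise:
  assumes b: "b \<in> polybox (1/2)" "b' \<in> polybox (1/2)" and eq: "coords b = coords b'"
  shows "realise b = realise b'"
proof -
  have "coeff (root_poly {m..<n} b) j = coeff (root_poly {m..<n} b') j" if "j < card {m..<n}" for j
  proof -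
    have "m + j < n" using that by simp
    then show ?thesis using fun_cong[OF eq, of "m + j"] by (simp add: coords_def)
  qed
  then have "root_poly {m..<n} b = root_poly {m..<n} b'"
    by (intro root_poly_eqI) auto
  then obtain p where p: "p permutes {m..<n}" "\<And>i. i \<in> {m..<n} \<Longrightarrow> b' i = b (p i)"
    using root_poly_eq_imp_permutes[of "{m..<n}" b b'] by auto
  have pn: "p permutes {..<n}" using p(1) by (rule permutes_subset) auto
  have low: "p i = i" if "i < m" for i using permutes_not_in[OF p(1), of i] that by simp
  have "p i < m \<longleftrightarrow> i < m" if "i < n" for i
    using low[of i] permutes_in_image[OF p(1), of i] that by (cases "i < m") auto
  moreover have "b' i = b (p i)" if "i < n" for i
    using fun_cong[OF eq, of i] low[of i] p(2)[of i] that by (cases "i < m") (auto simp: coords_def)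
  ultimately show ?thesis using realise_permute[OF b(1) pn _ _ b(2)] by simp
qed

end

section \<open>Coordinates near the central configurations\<close>

context config_stage
begin

abbreviation "W \<equiv> coords ` polybox (1/2)"
abbreviation "N \<equiv> realise ` polybox (1/2)"

lemma topspace_polybox: "topspace (subtopology T (polybox \<delta>)) = polybox \<delta>"
  using compactin_subset_topspace[OF compact_polybox] by auto

lemma compact_space_polybox: "compact_space (subtopology T (polybox \<delta>))"
  using compact_space_subtopology[OF compact_polybox] .

lemma Hausdorff_T: "Hausdorff_space T"
  by (simp add: Hausdorff_space_product_topology)

lemma realise_closed_continuous:
  "continuous_map (subtopology T (polybox (1/2))) Y realise"
  "closed_map (subtopology T (polybox (1/2))) Y realise"
proof -
  have eq: "realise = config n X e \<circ> place" by (simp add: realise_def fun_eq_iff)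
  show "continuous_map (subtopology T (polybox (1/2))) Y realise"
    unfolding eq by (rule continuous_map_compose[OF continuous_place quotient_imp_continuous_map[OF quotient_config]])
  have "Hausdorff_space (tuples n X)" using Hausdorff by (simp add: Hausdorff_space_product_topology)
  then have "closed_map (subtopology T (polybox (1/2))) (tuples n X) place"
    by (intro continuous_imp_closed_map continuous_place compact_space_polybox)
  then show "closed_map (subtopology T (polybox (1/2))) Y realise"
    unfolding eq using closed_config by (rule closed_map_compose)
qed

lemma closedin_realise_polybox:
  assumes "\<delta> \<le> 1/2" shows "closedin Y (realise ` polybox \<delta>)"
proof -
  have "closedin T (polybox \<delta>)"
    by (rule compactin_imp_closedin[OF Hausdorff_T compact_polybox])
  then have "closedin (subtopology T (polybox (1/2))) (polybox \<delta>)"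
    by (rule closedin_subset_topspace[OF _ polybox_mono[OF assms]])
  then show ?thesis using realise_closed_continuous(2) by (simp add: closed_map_def)
qed

text \<open>The coordinates are continuous on the set of configurations since \<open>realise\<close> is a closed map on the polybox,
  hence a quotient map onto its image.\<close>

lemma coords_of_config:
  obtains \<theta> where "continuous_map (subtopology Y N) T \<theta>"
    "\<And>b. b \<in> polybox (1/2) \<Longrightarrow> \<theta> (realise b) = coords (sort_real b)"
proof -
  have q: "quotient_map (subtopology T (polybox (1/2))) (subtopology Y N) realise"
    using closed_quotient_onto_image[OF realise_closed_continuous] unfolding topspace_polybox .
  have c: "continuous_map (subtopology T (polybox (1/2))) T (coords \<circ> sort_real)"
    by (intro continuous_map_compose[OF continuous_map_from_subtopology[OF continuous_sort_real] continuous_coords])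
  show ?thesis
  proof (rule quotient_map_lift_exists[OF q c])
    show "(coords \<circ> sort_real) b = (coords \<circ> sort_real) b'"
      if "b \<in> topspace (subtopology T (polybox (1/2)))" "b' \<in> topspace (subtopology T (polybox (1/2)))"
        "realise b = realise b'" for b b'
      using that realise_eq_imp_coords[of b b'] unfolding topspace_polybox o_apply by blast
    fix \<theta>
    assume "continuous_map (subtopology Y N) T \<theta>"
      "\<And>b. b \<in> topspace (subtopology T (polybox (1/2))) \<Longrightarrow> \<theta> (realise b) = (coords \<circ> sort_real) b"
    then show ?thesis using that[of \<theta>] unfolding topspace_polybox o_apply by blast
  qed
qed

text \<open>Conversely the configuration depends continuously on the coordinates, since \<open>coords\<close> is a continuous map
  from a compact space to a Hausdorff space and therefore a quotient map onto its image.\<close>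

lemma config_of_coords:
  obtains g where "continuous_map (subtopology T W) Y g" "\<And>b. b \<in> polybox (1/2) \<Longrightarrow> g (coords b) = realise b"
proof -
  have c: "continuous_map (subtopology T (polybox (1/2))) T coords"
    by (rule continuous_map_from_subtopology[OF continuous_coords])
  then have "closed_map (subtopology T (polybox (1/2))) T coords"
    by (intro continuous_imp_closed_map compact_space_polybox Hausdorff_T)
  then have q: "quotient_map (subtopology T (polybox (1/2))) (subtopology T W) coords"
    using closed_quotient_onto_image[OF c] unfolding topspace_polybox by blast
  show ?thesis
  proof (rule quotient_map_lift_exists[OF q realise_closed_continuous(1)])
    show "realise b = realise b'"
      if "b \<in> topspace (subtopology T (polybox (1/2)))" "b' \<in> topspace (subtopology T (polybox (1/2)))"
        "coords b = coords b'" for b b'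
      using that coords_eq_imp_realise[of b b'] unfolding topspace_polybox by blast
    fix g
    assume "continuous_map (subtopology T W) Y g"
      "\<And>b. b \<in> topspace (subtopology T (polybox (1/2))) \<Longrightarrow> g (coords b) = realise b"
    then show ?thesis using that[of g] unfolding topspace_polybox by blast
  qed
qed

lemma realise_in_level: "b \<in> polybox (1/2) \<Longrightarrow> realise b \<in> level m"
  unfolding level_m realise_def using place_in mn by (intro imageI) auto

lemma place_mem:
  assumes "b \<in> open_polybox" "i < n"
  shows "place b i \<in> (if i < m then v ` (open_nbhd Z1 (1/2) \<inter> \<real>) else u ` open_nbhd Z2 (1/2))"
  using assms by (auto simp: open_polybox_def place_def chart_def PiE_iff split: if_splits dest!: bspec[of _ _ i])

lemma place_surj:
  assumes x: "x \<in> topspace (tuples n X)"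
    and "\<And>i. i < n \<Longrightarrow> x i \<in> (if i < m then v ` A else u ` B)"
  obtains b where "b \<in> PiE {..<n} (\<lambda>i. if i < m then A else B)" "x = place b"
proof -
  have "\<exists>z. z \<in> (if i < m then A else B) \<and> x i = chart i z" if "i < n" for i
    using assms(2)[OF that] by (auto simp: chart_def split: if_splits)
  then obtain z where z: "\<And>i. i < n \<Longrightarrow> z i \<in> (if i < m then A else B) \<and> x i = chart i (z i)" by metis
  have "(\<lambda>i\<in>{..<n}. z i) \<in> PiE {..<n} (\<lambda>i. if i < m then A else B)" using z by auto
  moreover have "x = place (\<lambda>i\<in>{..<n}. z i)"
  proof
    fix i show "x i = place (\<lambda>i\<in>{..<n}. z i) i"
      using z[of i] x unfolding in_tuples by (cases "i < n") (auto simp: place_def)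
  qed
  ultimately show ?thesis using that by blast
qed

text \<open>The other points of level \<open>m\<close> are the image under the closed map \<open>config\<close> of the closed set \<open>A\<close> of the tuples
  that have their first \<open>m\<close> entries in \<open>S\<close> and some entry outside the open set that its chart covers.\<close>

lemma openin_realise:
  obtains O' where "openin Y O'" "realise ` open_polybox = O' \<inter> level m"
proof -
  define R where "R i = (if i < m then S - v ` (open_nbhd Z1 (1/2) \<inter> \<real>) else topspace X - u ` open_nbhd Z2 (1/2))" for i
  have R: "closedin X (R i)" for i
  proof -
    have "closedin (subtopology X S) (S - v ` (open_nbhd Z1 (1/2) \<inter> \<real>))"
      using v(4) S_X by (metis closedin_diff closedin_topspace topspace_subtopology_subset)
    then have "closedin X (S - v ` (open_nbhd Z1 (1/2) \<inter> \<real>))" using closed_S by (rule closedin_trans_full)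
    moreover have "closedin X (topspace X - u ` open_nbhd Z2 (1/2))" using u(4) by (rule closedin_diff[OF closedin_topspace])
    ultimately show ?thesis by (simp add: R_def)
  qed
  have pre: "closedin (tuples n X) {x \<in> topspace (tuples n X). x i \<in> C}" if "closedin X C" "i < n" for C i
    using closedin_continuous_map_preimage[OF continuous_map_product_projection[of i "{..<n}" "\<lambda>_. X"] that(1)] that(2) by simp
  define A where "A = {x \<in> topspace (tuples n X). (\<forall>i<m. x i \<in> S) \<and> (\<exists>i<n. x i \<in> R i)}"
  have Aeq: "A = (\<Inter>i\<in>{..<m}. {x \<in> topspace (tuples n X). x i \<in> S}) \<inter> (\<Union>i\<in>{..<n}. {x \<in> topspace (tuples n X). x i \<in> R i})"
    unfolding A_def by auto
  have "closedin (tuples n X) A"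
  proof (cases "m = 0")
    case True
    then have "A = (\<Union>i\<in>{..<n}. {x \<in> topspace (tuples n X). x i \<in> R i})" by (auto simp: A_def)
    then show ?thesis using pre R by (auto intro!: closedin_Union)
  next
    case False
    then show ?thesis unfolding Aeq
      using pre R closed_S mn by (intro closedin_Int closedin_INT closedin_Union) auto
  qed
  then have closed: "closedin Y (config n X e ` A)" using closed_config by (simp add: closed_map_def)
  have disj: "realise b \<notin> config n X e ` A" if b: "b \<in> open_polybox" for b
  proof
    assume "realise b \<in> config n X e ` A"
    then obtain x where x: "x \<in> A" "realise b = config n X e x" by blast
    then have xT: "x \<in> topspace (tuples n X)" by (simp add: A_def)
    have bb: "b \<in> polybox (1/2)" using b open_polybox_subset by blast
    have "\<not> (\<exists>i<n. place b i = e)" using place_in(3)[OF bb] by blast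
    then obtain p where p: "p permutes {..<n}" "x = place b \<circ> p"
      using x(2) config_eq_iff[OF place_in(1)[OF bb] xT e_X] unfolding realise_def by blast
    have split: "p i < m \<longleftrightarrow> i < m" if "i < n" for i
      using permutation_splits[OF p(1) place_in(2)[OF bb] _ that] x(1) p(2) unfolding A_def by blast
    obtain i where i: "i < n" "x i \<in> R i" using x(1) by (auto simp: A_def)
    have "p i < n" using permutes_in_image[OF p(1), of i] i(1) by simp
    from place_mem[OF b this] show False
      using i split[OF i(1)] p(2) by (auto simp: R_def split: if_splits)
  qed
  have cover: "y \<in> realise ` open_polybox" if "y \<in> level m" "y \<notin> config n X e ` A" for y
  proof -
    obtain x where x: "x \<in> topspace (tuples n X)" "\<forall>i<m. x i \<in> S" "y = config n X e x"
      using \<open>y \<in> level m\<close> unfolding level_m by blast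
    have "x \<notin> A" using that x(3) by blast
    then have "\<forall>i<n. x i \<notin> R i" using x by (simp add: A_def)
    then have "x i \<in> (if i < m then v ` (open_nbhd Z1 (1/2) \<inter> \<real>) else u ` open_nbhd Z2 (1/2))" if "i < n" for i
      using that x(1,2) unfolding in_tuples by (auto simp: R_def split: if_splits)
    then obtain b where "b \<in> open_polybox" "x = place b"
      using place_surj[OF x(1)] unfolding open_polybox_def by blast
    then show ?thesis using x(3) unfolding realise_def by blast
  qed
  show ?thesis
  proof
    show "openin Y (topspace Y - config n X e ` A)" using closed by (rule openin_diff[OF openin_topspace])
    have "realise b \<in> topspace Y" if "b \<in> open_polybox" for b
      using place_in(1)[of b] that open_polybox_subset unfolding topspace_Y realise_def by blast
    then have "realise b \<in> (topspace Y - config n X e ` A) \<inter> level m" if "b \<in> open_polybox" for b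
      using that disj[OF that] realise_in_level[OF subsetD[OF open_polybox_subset that]] by blast
    then show "realise ` open_polybox = (topspace Y - config n X e ` A) \<inter> level m"
      using cover by (intro subset_antisym image_subsetI subsetI) (assumption, blast)
  qed
qed

text \<open>The monic polynomial with prescribed coefficients has a full set of roots by the fundamental theorem of
  algebra, and these are close to centres of discs if the coefficients are close to those of a
  central configuration.\<close>

lemma coords_neighbourhood:
  obtains \<epsilon> where "\<epsilon> > 0"
    "\<And>z a. \<lbrakk>z \<in> extensional {..<n}; \<And>i. i < m \<Longrightarrow> z i \<in> \<real>; a \<in> centres; (\<Sum>i<n. cmod (z i - coords a i)) < \<epsilon>\<rbrakk>
       \<Longrightarrow> z \<in> coords ` open_polybox"
proof -
  let ?I = "{m..<n}"
  have "\<exists>\<epsilon>>0. \<forall>b i. (\<forall>j<card ?I. cmod (coeff (root_poly ?I b) j - coeff (root_poly ?I a) j) < \<epsilon>) \<longrightarrow> i \<in> ?I \<longrightarrow>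
      (\<exists>l\<in>?I. cmod (b i - a l) < 1/2)" for a
    using roots_near[of ?I "1/2" a] by (metis finite_atLeastLessThan half_gt_zero zero_less_one)
  then obtain E where E: "\<And>a. E a > 0"
    "\<And>a b i. \<lbrakk>\<forall>j<card ?I. cmod (coeff (root_poly ?I b) j - coeff (root_poly ?I a) j) < E a; i \<in> ?I\<rbrakk> \<Longrightarrow> \<exists>l\<in>?I. cmod (b i - a l) < 1/2"
    by metis
  define \<epsilon> where "\<epsilon> = Min (insert (1/2) (E ` centres))"
  have \<epsilon>: "\<epsilon> > 0" "\<epsilon> \<le> 1/2" "\<And>a. a \<in> centres \<Longrightarrow> \<epsilon> \<le> E a"
    unfolding \<epsilon>_def using finite_centres E(1) by (subst Min_gr_iff; auto) (rule Min_le; simp add: finite_centres)+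
  show ?thesis
  proof
    fix z a assume z: "z \<in> extensional {..<n}" "\<And>i. i < m \<Longrightarrow> z i \<in> \<real>" and a: "a \<in> centres"
      and sum: "(\<Sum>i<n. cmod (z i - coords a i)) < \<epsilon>"
    have near: "cmod (z i - coords a i) < \<epsilon>" if "i < n" for i
    proof -
      have "cmod (z i - coords a i) \<le> (\<Sum>i<n. cmod (z i - coords a i))" using that by (intro member_le_sum) auto
      then show ?thesis using sum by simp
    qed
    define k where "k = n - m"
    have k: "card ?I = k" by (simp add: k_def)
    define q where "q = (\<Sum>j<k. monom (z (m + j)) j) + monom 1 k"
    have cq: "coeff q j = (if j < k then z (m + j) else if j = k then 1 else 0)" for j
    proof -
      have "coeff q j = (\<Sum>l<k. if l = j then z (m + l) else 0) + (if k = j then 1 else 0)"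
        by (simp add: q_def coeff_sum)
      also have "\<dots> = (if j < k then z (m + j) else if j = k then 1 else 0)"
        by (subst sum.delta) auto
      finally show ?thesis .
    qed
    have dq: "degree q = k"
    proof (rule antisym)
      show "degree q \<le> k" by (rule degree_le) (simp add: cq)
      show "k \<le> degree q" by (rule le_degree) (simp add: cq)
    qed
    obtain b' where b': "q = root_poly ?I b'"
      using monic_poly_is_root_poly[of ?I q] dq cq[of k] k by auto
    define b where "b = (\<lambda>i\<in>{..<n}. if i < m then z i else b' i)"
    have rp: "root_poly ?I b = q" unfolding b' root_poly_def by (intro prod.cong) (auto simp: b_def)
    have "coords b = z"
    proof
      fix i show "coords b i = z i"
      proof (cases "i < n \<and> m \<le> i")
        case True
        then have "coords b i = coeff q (i - m)" by (simp add: coords_def rp)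
        also have "\<dots> = z i" using True unfolding cq k_def by auto
        finally show ?thesis .
      next
        case False
        then show ?thesis using z(1) by (cases "i < n") (auto simp: coords_def b_def extensional_def)
      qed
    qed
    moreover have "b \<in> open_polybox"
      unfolding open_polybox_def
    proof (rule PiE_I)
      fix i assume i: "i \<in> {..<n}"
      show "b i \<in> (if i < m then open_nbhd Z1 (1/2) \<inter> \<real> else open_nbhd Z2 (1/2))"
      proof (cases "i < m")
        case True
        have "a i \<in> Z1" using a i True by (auto simp: centres_def PiE_iff split: if_splits dest!: bspec[of _ _ i])
        moreover have "cmod (a i - z i) < 1/2"
          using near[of i] i True \<epsilon>(2) by (simp add: coords_def norm_minus_commute)
        ultimately show ?thesis using True i z(2)[OF True] by (auto simp: b_def open_nbhd_def dist_norm)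
      next
        case False
        have "cmod (coeff (root_poly ?I b) j - coeff (root_poly ?I a) j) < E a" if j: "j < card ?I" for j
        proof -
          have "m + j < n" using j by simp
          then have "coords a (m + j) = coeff (root_poly ?I a) j" by (simp add: coords_def)
          then show ?thesis using near[OF \<open>m + j < n\<close>] \<epsilon>(3)[OF a] j by (simp add: rp cq k_def)
        qed
        then obtain l where l: "l \<in> ?I" "cmod (b i - a l) < 1/2" using E(2)[of b a i] i False by auto
        have "a l \<in> Z2" using a l(1) by (auto simp: centres_def PiE_iff split: if_splits dest!: bspec[of _ _ l])
        then show ?thesis using False l(2) by (auto simp: open_nbhd_def dist_norm norm_minus_commute)
      qed
    qed (simp add: b_def)
    ultimately show "z \<in> coords ` open_polybox" by blast
  qed (rule \<epsilon>(1))
qed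

end

section \<open>Moving a sphere off the central configurations\<close>

context config_stage
begin

lemma centres_coord: "\<lbrakk>a \<in> centres; i < m\<rbrakk> \<Longrightarrow> a i \<in> Z1"
  using mn by (auto simp: centres_def PiE_iff split: if_splits dest!: bspec[of _ _ i])

lemma coords_low: "i < m \<Longrightarrow> coords b i = b i"
  using mn by (simp add: coords_def)

text \<open>The \<open>m\<close> real and \<open>n - m\<close> complex coordinates have \<open>2 * n - m\<close> real components, more than the dimension of the
  sphere.\<close>

lemma avoiding_target_generic:
  assumes K: "compact K" "K \<subseteq> sphere_set d" and d: "d < 2 * n - m" and \<epsilon>: "\<epsilon> > 0"
    and F: "\<And>i. i < n \<Longrightarrow> continuous_on K (F i)" and F_real: "\<And>i x. \<lbrakk>i < m; x \<in> K\<rbrakk> \<Longrightarrow> F i x \<in> \<real>"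
    and P: "finite P"
  obtains G :: "nat \<Rightarrow> (nat \<Rightarrow> real) \<Rightarrow> complex" where
    "\<And>i. i < n \<Longrightarrow> continuous_on K (G i)" "\<And>i x. \<lbrakk>i < m; x \<in> K\<rbrakk> \<Longrightarrow> G i x \<in> \<real>"
    "\<And>x. x \<in> K \<Longrightarrow> (\<Sum>i<n. cmod (G i x - F i x)) < \<epsilon>/2"
    "\<And>x p. \<lbrakk>x \<in> K; p \<in> P\<rbrakk> \<Longrightarrow> \<exists>i<n. G i x \<noteq> p i"
proof -
  define part where "part z b = (if b then Im z else Re z)" for z :: complex and b
  define J where "J = {..<n} \<times> {False} \<union> {m..<n} \<times> {True}"
  have "card J = n + (n - m)"
    unfolding J_def by (subst card_Un_disjoint) (auto simp: card_cartesian_product)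
  then have J: "finite J" "card J > d" using d mn by (auto simp: J_def)
  define \<epsilon>' where "\<epsilon>' = \<epsilon> / (8 * n)"
  have \<epsilon>': "\<epsilon>' > 0" using \<epsilon> n1 by (simp add: \<epsilon>'_def)
  define f where "f = (\<lambda>(i, b) x. part (F i x) b)"
  have f: "continuous_on K (f j)" if "j \<in> J" for j
  proof -
    obtain i b where j: "j = (i, b)" by (metis surj_pair)
    then have "i < n" using that by (auto simp: J_def)
    then show ?thesis using F[of i] by (cases b) (auto simp: f_def j part_def intro: continuous_intros)
  qed
  obtain g where g: "\<And>j. j \<in> J \<Longrightarrow> continuous_on K (g j)"
      "\<And>j x. \<lbrakk>j \<in> J; x \<in> K\<rbrakk> \<Longrightarrow> \<bar>g j x - f j x\<bar> < \<epsilon>'"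
      "\<And>x p. \<lbrakk>x \<in> K; p \<in> (\<lambda>p (i, b). part (p i) b) ` P\<rbrakk> \<Longrightarrow> \<exists>j\<in>J. g j x \<noteq> p j"
    using generic_avoidance[where f=f, OF K J finite_imageI[OF P, of "\<lambda>p (i, b). part (p i) b"] \<epsilon>' f] by blast
  define G where "G i x = Complex (g (i, False) x) (if i < m then 0 else g (i, True) x)" for i x
  have J_mem: "(i, False) \<in> J \<longleftrightarrow> i < n" "(i, True) \<in> J \<longleftrightarrow> m \<le> i \<and> i < n" for i by (auto simp: J_def)
  show ?thesis
  proof
    show "continuous_on K (G i)" if "i < n" for i
    proof -
      have "continuous_on K (\<lambda>x. if i < m then 0 else g (i, True) x)"
        using g(1)[of "(i, True)"] that J_mem by (cases "i < m") auto
      then show ?thesis unfolding G_def using g(1)[of "(i, False)"] that J_mem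
        by (intro continuous_on_Complex) auto
    qed
    show "G i x \<in> \<real>" if "i < m" for i x using that by (simp add: G_def complex_is_Real_iff)
    show "(\<Sum>i<n. cmod (G i x - F i x)) < \<epsilon>/2" if x: "x \<in> K" for x
    proof -
      have "cmod (G i x - F i x) \<le> 2 * \<epsilon>'" if i: "i \<in> {..<n}" for i
      proof -
        have "\<bar>Re (G i x - F i x)\<bar> \<le> \<epsilon>'"
          using g(2)[of "(i, False)" x] x i J_mem by (simp add: G_def f_def part_def)
        moreover have "\<bar>Im (G i x - F i x)\<bar> \<le> \<epsilon>'"
        proof (cases "i < m")
          case True
          then show ?thesis using F_real[OF True x] \<epsilon>' by (simp add: G_def complex_is_Real_iff)
        next
          case False
          then show ?thesis using g(2)[of "(i, True)" x] x i J_mem by (simp add: G_def f_def part_def)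
        qed
        ultimately show ?thesis using cmod_le[of "G i x - F i x"] by linarith
      qed
      then have "(\<Sum>i<n. cmod (G i x - F i x)) \<le> of_nat (card {..<n}) * (2 * \<epsilon>')"
        by (rule sum_bounded_above)
      also have "\<dots> < \<epsilon>/2" using \<epsilon> n1 by (simp add: \<epsilon>'_def field_simps)
      finally show ?thesis .
    qed
    show "\<exists>i<n. G i x \<noteq> p i" if xp: "x \<in> K" "p \<in> P" for x p
    proof -
      obtain j where "j \<in> J" and neq: "g j x \<noteq> (\<lambda>(i, b). part (p i) b) j" using g(3)[OF xp(1) imageI[OF xp(2)]] by blast
      obtain i b where j: "j = (i, b)" by (metis surj_pair)
      have "G i x \<noteq> p i"
        using neq \<open>j \<in> J\<close> J_mem by (cases b) (auto simp: j G_def part_def complex_eq_iff)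
      moreover have "i < n" using \<open>j \<in> J\<close> by (auto simp: j J_def)
      ultimately show ?thesis by blast
    qed
  qed
qed

text \<open>Adding \<open>\<eta> * (i + 1)\<close> to the \<open>i\<close>-th of the sorted real coordinates makes them pairwise distinct. The \<open>m\<close> real
  coordinates of a central configuration are not, since they take at most \<open>card Z1 < m\<close> values.\<close>

lemma avoiding_target_crowded:
  assumes m: "card Z1 < m" and \<epsilon>: "\<epsilon> > 0"
    and F: "\<And>i. i < n \<Longrightarrow> continuous_on K (F i)" and F_real: "\<And>i x. \<lbrakk>i < m; x \<in> K\<rbrakk> \<Longrightarrow> F i x \<in> \<real>"
    and F_mono: "\<And>i j x. \<lbrakk>i \<le> j; j < m; x \<in> K\<rbrakk> \<Longrightarrow> Re (F i x) \<le> Re (F j x)"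
  obtains G :: "nat \<Rightarrow> (nat \<Rightarrow> real) \<Rightarrow> complex" where
    "\<And>i. i < n \<Longrightarrow> continuous_on K (G i)" "\<And>i x. \<lbrakk>i < m; x \<in> K\<rbrakk> \<Longrightarrow> G i x \<in> \<real>"
    "\<And>x. x \<in> K \<Longrightarrow> (\<Sum>i<n. cmod (G i x - F i x)) < \<epsilon>/2"
    "\<And>x p. \<lbrakk>x \<in> K; p \<in> coords ` centres\<rbrakk> \<Longrightarrow> \<exists>i<n. G i x \<noteq> p i"
proof -
  \<comment> \<open>each of the at most \<open>n\<close> shifts is at most \<open>\<eta> * n\<close>, so they add up to at most \<open>\<epsilon> / 4\<close>\<close>
  define \<eta> where "\<eta> = \<epsilon> / (4 * n * n)"
  have \<eta>: "\<eta> > 0" using \<epsilon> n1 by (simp add: \<eta>_def)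
  define G where "G i x = F i x + of_real (if i < m then \<eta> * Suc i else 0)" for i x
  show ?thesis
  proof
    show "continuous_on K (G i)" if "i < n" for i
      unfolding G_def using F[OF that] by (intro continuous_intros)
    show "G i x \<in> \<real>" if "i < m" "x \<in> K" for i x
      unfolding G_def using F_real[OF that] by (intro Reals_add) auto
    show "(\<Sum>i<n. cmod (G i x - F i x)) < \<epsilon>/2" for x
    proof -
      have "cmod (G i x - F i x) \<le> \<eta> * n" if i: "i \<in> {..<n}" for i
        using i \<eta> by (simp add: G_def del: of_nat_Suc)
      then have "(\<Sum>i<n. cmod (G i x - F i x)) \<le> of_nat (card {..<n}) * (\<eta> * n)"
        by (rule sum_bounded_above)
      also have "\<dots> < \<epsilon>/2" using \<epsilon> n1 by (simp add: \<eta>_def field_simps)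
      finally show ?thesis .
    qed
    show "\<exists>i<n. G i x \<noteq> p i" if x: "x \<in> K" and p: "p \<in> coords ` centres" for x p
    proof (rule ccontr)
      assume "\<not> ?thesis"
      then have eq: "G i x = p i" if "i < m" for i using that mn by auto
      obtain a where a: "a \<in> centres" "p = coords a" using p by blast
      have "Re (p i) < Re (p j)" if "i < j" "j < m" for i j
      proof -
        have "Re (F i x) + \<eta> * Suc i < Re (F j x) + \<eta> * Suc j"
          using that F_mono[of i j x] x \<eta> by (intro add_le_less_mono mult_strict_left_mono) auto
        then show ?thesis using eq[of i] eq[of j] that by (simp add: G_def flip: eq)
      qed
      then have "inj_on p {..<m}"
        by (intro inj_onI) (metis lessThan_iff less_irrefl nat_neq_iff)
      moreover have "p ` {..<m} \<subseteq> Z1" using centres_coord[OF a(1)] by (auto simp: a(2) coords_low)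
      ultimately have "m \<le> card Z1" using card_inj_on_le[OF _ _ fin(1), of p "{..<m}"] by simp
      then show False using m by simp
    qed
  qed
qed

text \<open>The map is changed only where its coordinates come close to those of a central configuration. There the
  homotopy is linear in the coordinates. It need not preserve the order of the real coordinates, but
  every tuple of real and complex coordinates near a central one still describes a configuration.\<close>

lemma avoid_centres:
  assumes f: "continuous_map (nsphere d) Y f" and fl: "f ` topspace (nsphere d) \<subseteq> level m"
    and d: "d < 2 * n - m \<or> card Z1 < m"
  obtains f' where "homotopic_with (\<lambda>_. True) (nsphere d) Y f f'" "f' ` topspace (nsphere d) \<subseteq> level m"
    "f' ` topspace (nsphere d) \<inter> realise ` centres = {}"
proof -
  let ?S = "topspace (nsphere d)"
  define K where "K = {x \<in> ?S. f x \<in> N}"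
  have closedN: "closedin Y N" using closedin_realise_polybox by simp
  have K: "closedin (nsphere d) K"
    unfolding K_def using closedin_continuous_map_preimage[OF f closedN] .
  have KS: "K \<subseteq> sphere_set d" unfolding K_def topspace_nsphere by blast
  have "compactin (nsphere d) K" using closedin_compact_space[OF compact_space_nsphere K] .
  then have Kc: "compact K"
    by (simp add: nsphere_eq_top_of_set compactin_subtopology)
  have Ktop: "subtopology (nsphere d) K = top_of_set K"
    using KS by (simp add: nsphere_eq_top_of_set subtopology_subtopology Int_absorb1)
  obtain \<theta> where \<theta>: "continuous_map (subtopology Y N) T \<theta>"
    "\<And>b. b \<in> polybox (1/2) \<Longrightarrow> \<theta> (realise b) = coords (sort_real b)" using coords_of_config by blast
  obtain g where g: "continuous_map (subtopology T W) Y g"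
    "\<And>b. b \<in> polybox (1/2) \<Longrightarrow> g (coords b) = realise b" using config_of_coords by blast
  define F where "F i x = \<theta> (f x) i" for i x
  have repr: "\<exists>b\<in>polybox (1/2). f x = realise b \<and> (\<forall>i. F i x = coords (sort_real b) i)" if x: "x \<in> K" for x
  proof -
    obtain b where "b \<in> polybox (1/2)" "f x = realise b" using x unfolding K_def by blast
    then show ?thesis using \<theta>(2) by (auto simp: F_def)
  qed
  have gF: "g (\<lambda>i\<in>{..<n}. F i x) = f x" if x: "x \<in> K" for x
  proof -
    obtain b where b: "b \<in> polybox (1/2)" "f x = realise b" "\<forall>i. F i x = coords (sort_real b) i"
      using repr[OF x] by blast
    have "(\<lambda>i\<in>{..<n}. F i x) = coords (sort_real b)" using b(3) by (auto simp: coords_def)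
    then show ?thesis using g(2) sort_real_polybox[OF b(1)] b(2) by simp
  qed
  have contF: "continuous_map (subtopology (nsphere d) K) euclidean (F i)" if "i < n" for i
  proof -
    have "continuous_map (subtopology (nsphere d) K) (subtopology Y N) f"
      unfolding continuous_map_in_subtopology using f by (auto simp: K_def intro: continuous_map_from_subtopology)
    then have "continuous_map (subtopology (nsphere d) K) T (\<theta> \<circ> f)" using \<theta>(1) by (rule continuous_map_compose)
    then show ?thesis
      using that unfolding continuous_map_componentwise F_def o_def by blast
  qed
  then have contF': "continuous_on K (F i)" if "i < n" for i using that by (simp add: Ktop)
  have F_real: "F i x \<in> \<real>" if "i < m" "x \<in> K" for i x
    using repr[OF that(2)] that(1) mn by (auto simp: coords_low sort_real_def)
  have F_mono: "Re (F i x) \<le> Re (F j x)" if "i \<le> j" "j < m" "x \<in> K" for i j x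
    using repr[OF that(3)] that(1,2) mn order_stat_mono[OF that(1,2)]
    by (auto simp: coords_low sort_real_def)
  obtain \<epsilon>0 where \<epsilon>0: "\<epsilon>0 > 0"
    "\<And>z a. \<lbrakk>z \<in> extensional {..<n}; \<And>i. i < m \<Longrightarrow> z i \<in> \<real>; a \<in> centres; (\<Sum>i<n. cmod (z i - coords a i)) < \<epsilon>0\<rbrakk>
       \<Longrightarrow> z \<in> coords ` open_polybox" using coords_neighbourhood by blast
  \<comment> \<open>the perturbation adds less than \<open>\<epsilon> / 2\<close> to a distance of at most \<open>\<epsilon>\<close>, and this must stay below \<open>\<epsilon>0\<close>\<close>
  define \<epsilon> where "\<epsilon> = \<epsilon>0 / 2"
  have \<epsilon>: "\<epsilon> > 0" using \<epsilon>0 by (simp add: \<epsilon>_def)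
  let ?P = "coords ` centres"
  have P: "finite ?P" using finite_centres by simp
  obtain G where G: "\<And>i. i < n \<Longrightarrow> continuous_on K (G i)" "\<And>i x. \<lbrakk>i < m; x \<in> K\<rbrakk> \<Longrightarrow> G i x \<in> \<real>"
    "\<And>x. x \<in> K \<Longrightarrow> (\<Sum>i<n. cmod (G i x - F i x)) < \<epsilon>/2"
    "\<And>x p. \<lbrakk>x \<in> K; p \<in> ?P\<rbrakk> \<Longrightarrow> \<exists>i<n. G i x \<noteq> p i"
  proof (cases "d < 2 * n - m")
    case True
    show ?thesis using avoiding_target_generic[where F=F, OF Kc KS True \<epsilon> contF' F_real P] that by blast
  next
    case False
    then have "card Z1 < m" using d by simp
    show ?thesis using avoiding_target_crowded[where F=F and K=K, OF \<open>card Z1 < m\<close> \<epsilon> contF' F_real F_mono] that by blast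
  qed
  have topK: "topspace (subtopology (nsphere d) K) = K" using closedin_subset[OF K] by auto
  obtain \<mu> :: "(nat \<Rightarrow> real) \<Rightarrow> real" where \<mu>:
    "continuous_map (subtopology (nsphere d) K) euclideanreal \<mu>" "\<And>x. 0 \<le> \<mu> x" "\<And>x. \<mu> x \<le> 1"
    "\<And>x. \<lbrakk>x \<in> K; \<And>p. p \<in> ?P \<Longrightarrow> (\<Sum>i<n. cmod (F i x - p i)) \<ge> \<epsilon>\<rbrakk> \<Longrightarrow> \<mu> x = 0"
    "\<And>x p. \<lbrakk>x \<in> K; p \<in> ?P\<rbrakk> \<Longrightarrow> \<exists>i<n. F i x + \<mu> x * (G i x - F i x) \<noteq> p i"
    using damped_perturbation[of n "subtopology (nsphere d) K" F ?P \<epsilon> G, OF contF P \<epsilon>] G(3,4) unfolding topK by blast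
  define dst where "dst p x = (\<Sum>i<n. cmod (F i x - p i))" for p x
  have contd: "continuous_map (subtopology (nsphere d) K) euclideanreal (dst p)" for p
    unfolding dst_def by (intro continuous_map_sum continuous_map_norm continuous_map_diff contF continuous_map_canonical_const) auto
  \<comment> \<open>the homotopy moves \<open>f\<close> on the closed set \<open>A\<close> and is constant on the complement of \<open>U\<close>, which is closed in the sphere because \<open>f\<close> maps \<open>U\<close> into an open subset of level \<open>m\<close> where the coordinates are defined\<close>
  define A where "A = (\<Union>p\<in>?P. {x \<in> K. dst p x \<le> \<epsilon>})"
  define U where "U = (\<Union>p\<in>?P. {x \<in> K. dst p x < \<epsilon>})"
  have A: "closedin (nsphere d) A"
    unfolding A_def
  proof (intro closedin_Union)
    show "closedin (nsphere d) C" if "C \<in> (\<lambda>p. {x \<in> K. dst p x \<le> \<epsilon>}) ` ?P" for C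
    proof -
      obtain p where "C = {x \<in> K. dst p x \<le> \<epsilon>}" using \<open>C \<in> _\<close> by blast
      then have "C = {x \<in> topspace (subtopology (nsphere d) K). dst p x \<in> {..\<epsilon>}}" unfolding topK by simp
      then have "closedin (subtopology (nsphere d) K) C"
        using closedin_continuous_map_preimage[OF contd, of "{..\<epsilon>}" p] by simp
      then show ?thesis using K by (rule closedin_trans_full)
    qed
  qed (use P in auto)
  have AK: "A \<subseteq> K" by (auto simp: A_def)
  define h where "h = (\<lambda>(t, x). \<lambda>i\<in>{..<n}. F i x + (t * \<mu> x) * (G i x - F i x))"
  have h_near: "h (t, x) \<in> coords ` open_polybox" if x: "x \<in> A" and t: "t \<in> {0..1}" for t x
  proof -
    obtain a where a: "a \<in> centres" "dst (coords a) x \<le> \<epsilon>" using x by (auto simp: A_def)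
    have xK: "x \<in> K" using x AK by blast
    show ?thesis
    proof (rule \<epsilon>0(2)[OF _ _ a(1)])
      show "h (t, x) \<in> extensional {..<n}" by (simp add: h_def)
      show "h (t, x) i \<in> \<real>" if "i < m" for i
        using that mn F_real[OF that xK] G(2)[OF that xK] by (simp add: h_def)
      have "(\<Sum>i<n. cmod (h (t, x) i - coords a i)) \<le> (\<Sum>i<n. cmod (F i x - coords a i) + cmod (G i x - F i x))"
      proof (rule sum_mono)
        fix i assume "i \<in> {..<n}"
        then have "h (t, x) i - coords a i = (F i x - coords a i) + (t * \<mu> x) * (G i x - F i x)"
          by (simp add: h_def)
        also have "cmod \<dots> \<le> cmod (F i x - coords a i) + cmod (complex_of_real (t * \<mu> x) * (G i x - F i x))"
          by (rule norm_triangle_ineq)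
        also have "cmod (complex_of_real (t * \<mu> x) * (G i x - F i x)) = (t * \<mu> x) * cmod (G i x - F i x)"
          using t \<mu>(2)[of x] by (simp add: norm_mult)
        also have "\<dots> \<le> 1 * cmod (G i x - F i x)"
          using t \<mu>(2,3)[of x] by (intro mult_right_mono mult_le_one) auto
        finally show "cmod (h (t, x) i - coords a i) \<le> cmod (F i x - coords a i) + cmod (G i x - F i x)" by simp
      qed
      also have "\<dots> < \<epsilon>0"
        using a(2) G(3)[OF xK] \<epsilon> by (simp add: sum.distrib dst_def \<epsilon>_def)
      finally show "(\<Sum>i<n. cmod (h (t, x) i - coords a i)) < \<epsilon>0" .
    qed
  qed
  have h0: "h (t, x) = (\<lambda>i\<in>{..<n}. F i x)" if "t = 0 \<or> \<mu> x = 0" for t x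
    using that by (auto simp: h_def)
  have U: "openin (nsphere d) U"
  proof -
    obtain O' where O': "openin Y O'" "realise ` open_polybox = O' \<inter> level m" using openin_realise by blast
    define V where "V = {x \<in> ?S. f x \<in> O'}"
    have V: "openin (nsphere d) V" unfolding V_def using f O'(1) by (rule openin_continuous_map_preimage)
    have VK: "V \<subseteq> K"
    proof
      fix x assume "x \<in> V"
      then have "f x \<in> O' \<inter> level m" "x \<in> ?S" using fl by (auto simp: V_def)
      then show "x \<in> K" unfolding O'(2)[symmetric] K_def using open_polybox_subset by blast
    qed
    have "f x \<in> realise ` open_polybox" if x: "x \<in> U" for x
    proof -
      have xA: "x \<in> A" using x by (force simp: U_def A_def)
      then have "(\<lambda>i\<in>{..<n}. F i x) \<in> coords ` open_polybox" using h_near[of x 0] h0[of 0 x] by simp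
      then obtain b where b: "b \<in> open_polybox" "(\<lambda>i\<in>{..<n}. F i x) = coords b" by blast
      then have "f x = realise b" using gF[of x] xA AK g(2)[OF subsetD[OF open_polybox_subset b(1)]] by auto
      then show ?thesis using b(1) by blast
    qed
    then have UV: "U \<subseteq> V" unfolding O'(2) V_def using AK closedin_subset[OF K] by (auto simp: U_def)
    have eq: "U = (\<Union>p\<in>?P. V \<inter> {x \<in> K. dst p x < \<epsilon>})" using UV by (auto simp: U_def)
    have "openin (nsphere d) (V \<inter> {x \<in> K. dst p x < \<epsilon>})" for p
    proof -
      have "openin (subtopology (nsphere d) K) {x \<in> K. dst p x < \<epsilon>}"
        using openin_continuous_map_preimage[OF contd, of "{..<\<epsilon>}" p] unfolding topK by simp
      then obtain Q where "openin (nsphere d) Q" "{x \<in> K. dst p x < \<epsilon>} = Q \<inter> K" unfolding openin_subtopology by blast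
      then have "V \<inter> {x \<in> K. dst p x < \<epsilon>} = V \<inter> Q" using VK by blast
      then show ?thesis using openin_Int[OF V \<open>openin (nsphere d) Q\<close>] by simp
    qed
    then show ?thesis unfolding eq by (intro openin_Union) blast
  qed
  define B where "B = ?S - U"
  have B: "closedin (nsphere d) B" unfolding B_def using U by (rule closedin_diff[OF closedin_topspace])
  have AB: "\<mu> x = 0" if "x \<in> A" "x \<in> B" for x
  proof (rule \<mu>(4))
    show "x \<in> K" using that AK by blast
    show "\<epsilon> \<le> (\<Sum>i<n. cmod (F i x - p i))" if "p \<in> ?P" for p
      using \<open>x \<in> B\<close> \<open>x \<in> K\<close> that by (auto simp: B_def U_def dst_def not_less)
  qed
  let ?I = "top_of_set {0..1::real}"
  let ?C = "prod_topology ?I (nsphere d)"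
  define H where "H = (\<lambda>q. if q \<in> {0..1} \<times> A then g (h q) else f (snd q))"
  have "continuous_map ?C Y H"
    unfolding H_def
  proof (rule continuous_map_paste_closed)
    show "closedin ?C ({0..1} \<times> A)" "closedin ?C ({0..1} \<times> B)"
      using A B by (auto simp: closedin_prod_Times_iff)
    have "A \<union> B = ?S" using closedin_subset[OF A] by (auto simp: B_def U_def A_def less_imp_le)
    then show "{0..1} \<times> A \<union> {0..1} \<times> B = topspace ?C" by (auto simp: topspace_prod_topology)
    have sub: "subtopology ?C ({0..1} \<times> A) = prod_topology ?I (subtopology (nsphere d) A)"
      by (simp add: prod_topology_subtopology(2) subtopology_subtopology flip: subtopology_Times)
    have tA: "topspace (subtopology (nsphere d) A) = A" using closedin_subset[OF A] by auto
    have pt: "continuous_map (prod_topology ?I (subtopology (nsphere d) A)) euclidean (\<lambda>q. \<phi> (snd q))"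
      if "continuous_map (subtopology (nsphere d) K) euclidean \<phi>" for \<phi> :: "(nat \<Rightarrow> real) \<Rightarrow> complex"
    proof -
      have "continuous_map (subtopology (nsphere d) A) euclidean \<phi>"
        using continuous_map_from_subtopology_mono[OF that AK] .
      from continuous_map_compose[OF continuous_map_snd this] show ?thesis by (simp add: o_def)
    qed
    have cof: "continuous_map (subtopology (nsphere d) K) euclidean (\<lambda>x. complex_of_real (\<mu> x))"
      using \<mu>(1) by (rule continuous_map_complex_of_real)
    have tm: "continuous_map (prod_topology ?I (subtopology (nsphere d) A)) euclidean (\<lambda>q. complex_of_real (fst q))"
      by (rule continuous_map_complex_of_real[OF continuous_map_cylinder_time])
    have "continuous_map (prod_topology ?I (subtopology (nsphere d) A)) (subtopology T W) h"
      unfolding continuous_map_in_subtopology continuous_map_componentwise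
    proof (intro conjI ballI)
      fix i assume "i \<in> {..<n}"
      then have i: "i < n" by simp
      have cG: "continuous_map (subtopology (nsphere d) K) euclidean (G i)" using G(1)[OF i] by (simp add: Ktop)
      have "continuous_map (prod_topology ?I (subtopology (nsphere d) A)) euclidean
          (\<lambda>q. F i (snd q) + (complex_of_real (fst q) * complex_of_real (\<mu> (snd q))) * (G i (snd q) - F i (snd q)))"
        by (intro continuous_map_add continuous_map_diff continuous_map_complex_mult tm pt[OF cof] pt[OF cG] pt[OF contF[OF i]])
      then show "continuous_map (prod_topology ?I (subtopology (nsphere d) A)) euclidean (\<lambda>q. h q i)"
        using i by (simp add: h_def case_prod_unfold)
    next
      show "h ` topspace (prod_topology ?I (subtopology (nsphere d) A)) \<subseteq> extensional {..<n}"
        by (auto simp: h_def)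
      show "h \<in> topspace (prod_topology ?I (subtopology (nsphere d) A)) \<rightarrow> W"
        using h_near open_polybox_subset unfolding topspace_prod_topology tA by fastforce
    qed
    then show "continuous_map (subtopology ?C ({0..1} \<times> A)) Y (\<lambda>q. g (h q))"
      unfolding sub using continuous_map_compose[OF _ g(1)] by (fastforce simp: o_def)
    show "continuous_map (subtopology ?C ({0..1} \<times> B)) Y (\<lambda>q. f (snd q))"
      using continuous_map_compose[OF continuous_map_snd f, of ?I] by (simp add: o_def continuous_map_from_subtopology)
    show "g (h q) = f (snd q)" if "q \<in> {0..1} \<times> A" "q \<in> {0..1} \<times> B" for q
    proof -
      obtain t x where q: "q = (t, x)" by (metis surj_pair)
      have "h (t, x) = (\<lambda>i\<in>{..<n}. F i x)" using that AB by (intro h0) (auto simp: q)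
      then show ?thesis using gF that AK by (auto simp: q)
    qed
  qed
  moreover have "H (0, x) = f x" for x
    using gF[of x] AK h0[of 0 x] by (auto simp: H_def)
  ultimately have hom: "homotopic_with (\<lambda>_. True) (nsphere d) Y f (\<lambda>x. H (1, x))"
    unfolding homotopic_with_def by (intro exI[of _ H]) simp
  have end_repr: "\<exists>b\<in>open_polybox. h (1, x) = coords b \<and> H (1, x) = realise b" if x: "x \<in> A" for x
  proof -
    obtain b where b: "b \<in> open_polybox" "h (1, x) = coords b" using h_near[OF x, of 1] by auto
    then show ?thesis using g(2)[OF subsetD[OF open_polybox_subset b(1)]] x by (auto simp: H_def)
  qed
  have "H (1, x) \<in> level m \<and> H (1, x) \<notin> realise ` centres" if x: "x \<in> ?S" for x
  proof (cases "x \<in> A")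
    case True
    then obtain b where b: "b \<in> open_polybox" "h (1, x) = coords b" "H (1, x) = realise b" using end_repr by blast
    have bb: "b \<in> polybox (1/2)" using b(1) open_polybox_subset by blast
    have "H (1, x) \<notin> realise ` centres"
    proof
      assume "H (1, x) \<in> realise ` centres"
      then obtain a where a: "a \<in> centres" "realise a = realise b" using b(3) by auto
      have ab: "a \<in> polybox (1/2)" using centres_subset[of "1/2"] a(1) by auto
      obtain p where p: "p permutes {..<n}" "\<And>i. i < n \<Longrightarrow> p i < m \<longleftrightarrow> i < m" "\<And>i. i < n \<Longrightarrow> b i = a (p i)"
        using realise_eq_imp[OF ab bb a(2)] by blast
      have "b \<in> extensional {..<n}" using bb by (simp add: polybox_def PiE_iff)
      then have "b \<in> centres" using permuted_PiE[OF a(1)[unfolded centres_def] p] unfolding centres_def by blast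
      then have "coords b \<in> ?P" by blast
      then obtain i where "i < n" "F i x + \<mu> x * (G i x - F i x) \<noteq> coords b i" using \<mu>(5)[of x] True AK by blast
      then show False using fun_cong[OF b(2), of i] by (simp add: h_def)
    qed
    then show ?thesis using realise_in_level[OF bb] b(3) by simp
  next
    case False
    have "f x \<notin> realise ` centres"
    proof
      assume "f x \<in> realise ` centres"
      then obtain a where a: "a \<in> centres" "f x = realise a" by blast
      have ab: "a \<in> polybox (1/2)" using centres_subset[of "1/2"] a(1) by auto
      have xK: "x \<in> K" using x a(2) ab by (auto simp: K_def)
      obtain p where p: "p permutes {..<n}" "\<And>i. i < n \<Longrightarrow> p i < m \<longleftrightarrow> i < m" "\<And>i. i < n \<Longrightarrow> sort_real a i = a (p i)"
        using sort_real_props[OF ab] by blast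
      have "sort_real a \<in> centres"
        using permuted_PiE[OF a(1)[unfolded centres_def] p sort_real_extensional] unfolding centres_def .
      moreover have "dst (coords (sort_real a)) x = 0"
        using \<theta>(2)[OF ab] a(2) by (simp add: dst_def F_def)
      ultimately have "x \<in> A" using xK \<epsilon> by (force simp: A_def)
      then show False using False by blast
    qed
    then show ?thesis using fl x False by (auto simp: H_def)
  qed
  then have "(\<lambda>x. H (1, x)) ` ?S \<subseteq> level m" "(\<lambda>x. H (1, x)) ` ?S \<inter> realise ` centres = {}" by auto
  with hom that show ?thesis by blast
qed

end

section \<open>Pushing a sphere into the next level\<close>

lemma in_all_closed_nbhds_imp_mem:
  assumes "finite Z" "\<And>k::nat. z \<in> closed_nbhd Z (1 / (k + 2))"
  shows "z \<in> Z"
proof (rule ccontr)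
  assume "z \<notin> Z"
  obtain r where r: "r > 0" "\<And>c. c \<in> Z \<Longrightarrow> c \<noteq> z \<Longrightarrow> r \<le> dist z c" using finite_set_avoid[OF assms(1), of z] by auto
  obtain k where k: "1 / real (Suc k) < r" using r(1) nat_approx_posE by blast
  obtain c where c: "c \<in> Z" "dist c z \<le> 1 / (real k + 2)" using assms(2)[of k] by (auto simp: closed_nbhd_def)
  have "r \<le> dist c z" using r(2)[OF c(1)] c(1) \<open>z \<notin> Z\<close> by (auto simp: dist_commute)
  moreover have "1 / (real k + 2) \<le> 1 / real (Suc k)" by (simp add: frac_le)
  ultimately show False using c(2) k by linarith
qed

context config_stage
begin

text \<open>The preimages of the shrinking closed sets \<open>realise ` polybox (1 / (k + 2))\<close> intersect in the preimage of the
  central configurations, which is empty. By compactness one of them is empty.\<close>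

lemma avoid_polybox:
  assumes f: "continuous_map (nsphere d) Y f" and avoid: "f ` topspace (nsphere d) \<inter> realise ` centres = {}"
  obtains \<delta> where "\<delta> > 0" "\<delta> \<le> 1/2" "f ` topspace (nsphere d) \<inter> realise ` polybox \<delta> = {}"
proof -
  let ?S = "topspace (nsphere d)"
  define r where "r k = 1 / (real k + 2)" for k
  have r: "r k > 0" "r k \<le> 1/2" for k by (simp_all add: r_def frac_le)
  define C where "C k = {x \<in> ?S. f x \<in> realise ` polybox (r k)}" for k
  have "\<exists>k. C k = {}"
  proof (rule ccontr)
    assume "\<nexists>k. C k = {}"
    moreover have "closedin (nsphere d) (C k)" for k
      unfolding C_def by (rule closedin_continuous_map_preimage[OF f closedin_realise_polybox[OF r(2)]])
    moreover have "decseq C"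
    proof (rule decseq_SucI)
      fix k have "r (Suc k) \<le> r k" by (simp add: r_def frac_le)
      then show "C (Suc k) \<subseteq> C k" using polybox_mono[of "r (Suc k)" "r k"] by (auto simp: C_def)
    qed
    ultimately have "(\<Inter>k. C k) \<noteq> {}" by (intro compact_space_imp_nest[OF compact_space_nsphere]) auto
    then obtain x where x: "\<And>k. x \<in> C k" by blast
    have "x \<in> ?S" using x[of 0] by (simp add: C_def)
    obtain b where b0: "b \<in> polybox (r 0)" "f x = realise b" using x[of 0] by (auto simp: C_def)
    have bh: "b \<in> polybox (1/2)" using b0(1) by (simp add: r_def)
    have bk: "b \<in> polybox (r k)" for k
    proof -
      obtain b' where b': "b' \<in> polybox (r k)" "f x = realise b'" using x[of k] by (auto simp: C_def)
      have "b' \<in> polybox (1/2)" using b'(1) polybox_mono[OF r(2)] by blast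
      moreover have "realise b' = realise b" using b0(2) b'(2) by simp
      ultimately obtain p where p: "p permutes {..<n}" "\<And>i. i < n \<Longrightarrow> p i < m \<longleftrightarrow> i < m" "\<And>i. i < n \<Longrightarrow> b i = b' (p i)"
        using realise_eq_imp[OF _ bh] by blast
      have "b \<in> extensional {..<n}" using bh by (simp add: polybox_def PiE_iff)
      then show ?thesis using permuted_PiE[OF b'(1)[unfolded polybox_def] p] unfolding polybox_def by blast
    qed
    have "b \<in> centres"
      unfolding centres_def
    proof (rule PiE_I)
      fix i assume i: "i \<in> {..<n}"
      have mem: "b i \<in> (if i < m then closed_nbhd Z1 (r k) \<inter> \<real> else closed_nbhd Z2 (r k))" for k
        using PiE_mem[OF bk[unfolded polybox_def] i] .
      show "b i \<in> (if i < m then Z1 else Z2)"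
      proof (cases "i < m")
        case True
        then have "b i \<in> closed_nbhd Z1 (1 / (real k + 2))" for k using mem[of k] by (simp add: r_def)
        then show ?thesis using True in_all_closed_nbhds_imp_mem[OF fin(1), of "b i"] by simp
      next
        case False
        then have "b i \<in> closed_nbhd Z2 (1 / (real k + 2))" for k using mem[of k] by (simp add: r_def)
        then show ?thesis using False in_all_closed_nbhds_imp_mem[OF fin(2), of "b i"] by simp
      qed
    qed (use bh in \<open>auto simp: polybox_def PiE_iff extensional_def\<close>)
    then show False using avoid b0(2) \<open>x \<in> ?S\<close> by blast
  qed
  then obtain k where "C k = {}" ..
  then have "f ` ?S \<inter> realise ` polybox (r k) = {}" by (auto simp: C_def)
  then show ?thesis using that r by blast
qed

text \<open>The deformation of \<open>X\<close> acts on all points of a configuration simultaneously. Suppose that the first \<open>m\<close>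
  points are in \<open>S\<close>. If none of them is sent to \<open>e\<close> and none of the others is sent into \<open>S\<close>, then all
  points are within \<open>\<delta>\<close> of the centres of their cells, and this case has been excluded.\<close>

lemma push_level:
  assumes f: "continuous_map (nsphere d) Y f" and fl: "f ` topspace (nsphere d) \<subseteq> level m"
    and avoid: "f ` topspace (nsphere d) \<inter> realise ` centres = {}"
  obtains f' where "homotopic_with (\<lambda>_. True) (nsphere d) Y f f'" "f' ` topspace (nsphere d) \<subseteq> level (Suc m)"
proof -
  let ?S = "topspace (nsphere d)"
  let ?I = "top_of_set {0..1::real}"
  obtain \<delta> where \<delta>: "\<delta> > 0" "\<delta> \<le> 1/2" "f ` ?S \<inter> realise ` polybox \<delta> = {}"
    using avoid_polybox[OF f avoid] by blast
  obtain H where H: "continuous_map (prod_topology ?I X) X H" "\<And>x. x \<in> topspace X \<Longrightarrow> H (0, x) = x"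
     "\<And>t. t \<in> {0..1} \<Longrightarrow> H (t, e) = e" "\<And>t x. \<lbrakk>t \<in> {0..1}; x \<in> S\<rbrakk> \<Longrightarrow> H (t, x) \<in> S"
     "\<And>x. \<lbrakk>x \<in> topspace X; x \<notin> S; x \<notin> u ` closed_nbhd Z2 \<delta>\<rbrakk> \<Longrightarrow> H (1, x) \<in> S"
     "\<And>x. \<lbrakk>x \<in> S; x \<notin> v ` (closed_nbhd Z1 \<delta> \<inter> \<real>)\<rbrakk> \<Longrightarrow> H (1, x) = e"
    using push[OF \<delta>(1)] by auto
  define M where "M = (\<lambda>(t, x). \<lambda>i\<in>{..<n}. H (t, x i))"
  have M: "continuous_map (prod_topology ?I (tuples n X)) (tuples n X) M"
    unfolding continuous_map_componentwise
  proof (intro conjI ballI)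
    show "M ` topspace (prod_topology ?I (tuples n X)) \<subseteq> extensional {..<n}" by (auto simp: M_def)
    fix i assume i: "i \<in> {..<n}"
    have "continuous_map (prod_topology ?I (tuples n X)) X (\<lambda>q. snd q i)"
      using continuous_map_compose[OF continuous_map_snd continuous_map_product_projection[OF i]] by (fastforce simp: o_def)
    then have "continuous_map (prod_topology ?I (tuples n X)) (prod_topology ?I X) (\<lambda>q. (fst q, snd q i))"
      by (intro continuous_map_pairedI continuous_map_fst)
    from continuous_map_compose[OF this H(1)]
    show "continuous_map (prod_topology ?I (tuples n X)) X (\<lambda>q. M q i)"
      using i by (simp add: M_def o_def case_prod_unfold)
  qed
  let ?q = "\<lambda>(t::real, x). (t, config n X e x)"
  have q: "quotient_map (prod_topology ?I (tuples n X)) (prod_topology ?I Y) ?q"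
  proof (rule quotient_map_prod_right[OF _ _ quotient_config])
    have "compact_space ?I" by (simp add: compact_space_subtopology)
    moreover show "Hausdorff_space ?I \<or> regular_space ?I" by (simp add: Hausdorff_space_subtopology)
    ultimately show "locally_compact_space ?I" by (simp add: compact_imp_locally_compact_space)
  qed
  have Mt: "M (t, x) \<in> topspace (tuples n X)" if "t \<in> {0..1}" "x \<in> topspace (tuples n X)" for t x
  proof -
    have "(t, x) \<in> topspace (prod_topology ?I (tuples n X))" using that unfolding topspace_prod_topology by simp
    then show ?thesis using continuous_map_image_subset_topspace[OF M] by blast
  qed
  have resp: "config n X e (M (t, x)) = config n X e (M (t, y))"
    if t: "t \<in> {0..1}" and xy: "x \<in> topspace (tuples n X)" "y \<in> topspace (tuples n X)" "config n X e x = config n X e y" for t x y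
  proof -
    from xy(3) consider "\<exists>i<n. x i = e" "\<exists>i<n. y i = e" | p where "p permutes {..<n}" "y = x \<circ> p"
      using config_eq_iff[OF xy(1,2) e_X] by blast
    then show ?thesis
    proof cases
      case 1
      have "M (t, z) i = e" if "i < n" "z i = e" for z i using that H(3)[OF t] by (simp add: M_def)
      then have "\<exists>i<n. M (t, x) i = e" "\<exists>i<n. M (t, y) i = e" using 1 by blast+
      then show ?thesis using config_eq_iff[OF Mt[OF t xy(1)] Mt[OF t xy(2)] e_X] by blast
    next
      case 2
      have "M (t, y) = M (t, x) \<circ> p"
      proof
        fix i show "M (t, y) i = (M (t, x) \<circ> p) i"
          using permutes_in_image[OF 2(1), of i] permutes_not_in[OF 2(1), of i]
          by (cases "i < n") (simp_all add: M_def 2(2))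
      qed
      then show ?thesis using config_eq_iff[OF Mt[OF t xy(1)] Mt[OF t xy(2)] e_X] 2(1) by blast
    qed
  qed
  have c: "continuous_map (prod_topology ?I (tuples n X)) Y (config n X e \<circ> M)"
    using M quotient_imp_continuous_map[OF quotient_config] by (rule continuous_map_compose)
  obtain G where G: "continuous_map (prod_topology ?I Y) Y G"
    "\<And>t x. \<lbrakk>t \<in> {0..1}; x \<in> topspace (tuples n X)\<rbrakk> \<Longrightarrow> G (t, config n X e x) = config n X e (M (t, x))"
  proof (rule quotient_map_lift_exists[OF q c])
    show "(config n X e \<circ> M) a = (config n X e \<circ> M) b"
      if ab: "a \<in> topspace (prod_topology ?I (tuples n X))" "b \<in> topspace (prod_topology ?I (tuples n X))" "?q a = ?q b" for a b
    proof -
      obtain t x s y where eq: "a = (t, x)" "b = (s, y)" by (metis surj_pair)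
      have tx: "t \<in> {0..1}" "x \<in> topspace (tuples n X)" "y \<in> topspace (tuples n X)" "s = t" "config n X e x = config n X e y"
        using ab unfolding eq topspace_prod_topology by auto
      show ?thesis using resp[OF tx(1,2,3,5)] tx(4) by (simp add: eq)
    qed
    fix G assume G: "continuous_map (prod_topology ?I Y) Y G"
      "\<And>a. a \<in> topspace (prod_topology ?I (tuples n X)) \<Longrightarrow> G (?q a) = (config n X e \<circ> M) a"
    have "G (t, config n X e x) = config n X e (M (t, x))" if "t \<in> {0..1}" "x \<in> topspace (tuples n X)" for t x
    proof -
      have "(t, x) \<in> topspace (prod_topology ?I (tuples n X))" using that unfolding topspace_prod_topology by simp
      from G(2)[OF this] show ?thesis by simp
    qed
    with G(1) that show ?thesis by blast
  qed
  \<comment> \<open>\<open>G\<close> is the deformation of the reduced symmetric product that \<open>H\<close> induces\<close>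
  define K where "K = (\<lambda>(t, x). G (t, f x))"
  have "continuous_map (prod_topology ?I (nsphere d)) (prod_topology ?I Y) (\<lambda>q. (fst q, f (snd q)))"
    using continuous_map_compose[OF continuous_map_snd f, of ?I]
    by (intro continuous_map_pairedI continuous_map_fst) (simp add: o_def)
  from continuous_map_compose[OF this G(1)]
  have K: "continuous_map (prod_topology ?I (nsphere d)) Y K" by (simp add: K_def o_def case_prod_unfold)
  have K0: "K (0, x) = f x" if x: "x \<in> ?S" for x
  proof -
    obtain z where z: "z \<in> topspace (tuples n X)" "f x = config n X e z"
      using continuous_map_image_subset_topspace[OF f] x unfolding topspace_Y by blast
    have "M (0, z) = z"
    proof
      fix i show "M (0, z) i = z i"
        using z(1) H(2)[of "z i"] unfolding in_tuples by (cases "i < n") (simp_all add: M_def)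
    qed
    then show ?thesis using G(2)[OF _ z(1), of 0] z(2) by (simp add: K_def)
  qed
  have "homotopic_with (\<lambda>_. True) (nsphere d) Y f (\<lambda>x. K (1, x))"
    using K K0 by (subst homotopic_with) auto
  moreover have "K (1, x) \<in> level (Suc m)" if x: "x \<in> ?S" for x
  proof -
    obtain z where z: "z \<in> topspace (tuples n X)" "\<forall>i<m. z i \<in> S" "f x = config n X e z"
      using fl x unfolding level_m by blast
    have zX: "z i \<in> topspace X" if "i < n" for i using z(1) that unfolding in_tuples by blast
    let ?w = "M (1, z)"
    have w: "?w \<in> topspace (tuples n X)" using Mt[OF _ z(1), of 1] by simp
    have wi: "?w i = H (1, z i)" if "i < n" for i using that by (simp add: M_def)
    have Kx: "K (1, x) = config n X e ?w" using G(2)[OF _ z(1), of 1] z(3) by (simp add: K_def)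
    have wS: "?w i \<in> S" if "i < m" for i using wi[of i] that mn z(2) H(4)[of 1 "z i"] by simp
    consider i where "i < n" "?w i = e" | i where "i < n" "m \<le> i" "?w i \<in> S"
      | "\<forall>i<n. ?w i \<noteq> e" "\<forall>i<n. m \<le> i \<longrightarrow> ?w i \<notin> S"
      using leI by blast
    then show ?thesis
    proof cases
      case 1
      then show ?thesis unfolding Kx level_def using w by blast
    next
      case 2
      \<comment> \<open>bring the additional point of \<open>S\<close> into slot \<open>m\<close>\<close>
      define p where "p = Transposition.transpose i m"
      have p: "p permutes {..<n}" using 2 by (auto simp: p_def permutes_swap_id)
      have wp: "?w \<circ> p \<in> topspace (tuples n X)" using tuples_permute[OF p w] .
      have low: "(?w \<circ> p) j \<in> S" if "j < Suc m" for j
        using that 2 wS by (cases "j = m") (auto simp: p_def transpose_apply_other)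
      have eq: "config n X e ?w = config n X e (?w \<circ> p)"
        unfolding config_eq_iff[OF w wp e_X] using p by blast
      have "Suc m \<le> n" using 2 by simp
      then have "?w \<circ> p \<in> {x \<in> topspace (tuples n X). (\<exists>i<n. x i = e) \<or> Suc m \<le> n \<and> (\<forall>i<Suc m. x i \<in> S)}"
        using wp low by blast
      then show ?thesis unfolding Kx level_def eq by (rule imageI)
    next
      case 3
      have "z i \<in> (if i < m then v ` (closed_nbhd Z1 \<delta> \<inter> \<real>) else u ` closed_nbhd Z2 \<delta>)" if i: "i < n" for i
      proof (cases "i < m")
        case True
        then show ?thesis using 3(1) i wi[OF i] z(2) H(6)[of "z i"] by auto
      next
        case False
        then have "H (1, z i) \<notin> S" using 3(2) i wi[OF i] by auto
        then have "z i \<notin> S" using H(4)[of 1 "z i"] by auto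
        then show ?thesis using False \<open>H (1, z i) \<notin> S\<close> H(5)[OF zX[OF i]] by auto
      qed
      then obtain b where b: "b \<in> polybox \<delta>" "z = place b"
        using place_surj[OF z(1), of "closed_nbhd Z1 \<delta> \<inter> \<real>" "closed_nbhd Z2 \<delta>"] unfolding polybox_def by blast
      then have "f x = realise b" using z(3) by (simp add: realise_def)
      then show ?thesis using \<delta>(3) x b(1) by blast
    qed
  qed
  ultimately show ?thesis using that[of "\<lambda>x. K (1, x)"] by blast
qed

end

context cell_charts
begin

text \<open>For \<open>m \<le> card Z1\<close> the assumption on \<open>d\<close> gives \<open>d < 2 * n - m\<close>. The other values of \<open>m\<close> are the crowded case.\<close>

lemma nullhomotopic:
  assumes n: "n \<ge> 1" and f: "continuous_map (nsphere d) (reduced_sym_prod n X e) f" and d: "d < 2 * n - min (card Z1) n"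
  shows "\<exists>a. homotopic_with (\<lambda>_. True) (nsphere d) (reduced_sym_prod n X e) f (\<lambda>_. a)"
proof -
  let ?Y = "reduced_sym_prod n X e" and ?S = "topspace (nsphere d)"
  let ?level = "config_stage.level X S e n"
  have "\<exists>g. homotopic_with (\<lambda>_. True) (nsphere d) ?Y f g \<and> g ` ?S \<subseteq> ?level k" if "k \<le> Suc n" for k
    using that
  proof (induction k)
    case 0
    interpret config_stage X S e u v Z1 Z2 n 0 by unfold_locales (use n in auto)
    have "f ` ?S \<subseteq> level 0" using continuous_map_image_subset_topspace[OF f] unfolding level_0 .
    then show ?case using f by (intro exI[of _ f]) simp
  next
    case (Suc m)
    then obtain g where g: "homotopic_with (\<lambda>_. True) (nsphere d) ?Y f g" "g ` ?S \<subseteq> ?level m" by auto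
    interpret config_stage X S e u v Z1 Z2 n m by unfold_locales (use n Suc.prems in auto)
    have "d < 2 * n - m \<or> card Z1 < m" using d Suc.prems by (auto simp: min_def split: if_splits)
    then obtain g' where g': "homotopic_with (\<lambda>_. True) (nsphere d) ?Y g g'" "g' ` ?S \<subseteq> level m"
        "g' ` ?S \<inter> realise ` centres = {}"
      using avoid_centres[OF homotopic_with_imp_continuous_maps[OF g(1), THEN conjunct2] g(2)] by blast
    obtain g'' where g'': "homotopic_with (\<lambda>_. True) (nsphere d) ?Y g' g''" "g'' ` ?S \<subseteq> level (Suc m)"
      using push_level[OF homotopic_with_imp_continuous_maps[OF g'(1), THEN conjunct2] g'(2,3)] by blast
    show ?case
      using homotopic_with_trans[OF homotopic_with_trans[OF g(1) g'(1)] g''(1)] g''(2) by blast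
  qed
  then obtain g where g: "homotopic_with (\<lambda>_. True) (nsphere d) ?Y f g" "g ` ?S \<subseteq> ?level (Suc n)" by blast
  interpret config_stage X S e u v Z1 Z2 n n by unfold_locales (use n in auto)
  obtain a where "\<forall>x\<in>?S. g x = a" using g(2) unfolding level_top by blast
  then have "homotopic_with (\<lambda>_. True) (nsphere d) ?Y f (\<lambda>_. a)"
    using homotopic_with_eq[OF g(1), of f "\<lambda>_. a"] by auto
  then show ?thesis by blast
qed

lemma m_connected_reduced_sym_prod:
  assumes "n \<ge> 1" shows "m_connected (2 * n - min (card Z1) n - 1) (reduced_sym_prod n X e)"
proof (rule m_connectedI)
  interpret config_stage X S e u v Z1 Z2 n n by unfold_locales (use assms in auto)
  show "topspace (reduced_sym_prod n X e) \<noteq> {}" using const_tuple unfolding topspace_Y by blast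
  fix i f assume i: "i \<le> 2 * n - min (card Z1) n - 1" and "continuous_map (nsphere i) (reduced_sym_prod n X e) f"
  have "min (card Z1) n \<le> n" by simp
  then have "i < 2 * n - min (card Z1) n" using i assms by linarith
  with \<open>continuous_map (nsphere i) (reduced_sym_prod n X e) f\<close>
  show "\<exists>a. homotopic_with (\<lambda>_. True) (nsphere i) (reduced_sym_prod n X e) f (\<lambda>_. a)"
    by (rule nullhomotopic[OF assms])
qed

end

section \<open>Expanding the cells of a two-complex\<close>

definition clamp1 :: "real \<Rightarrow> real"
  where "clamp1 x = max (-1) (min 1 x)"

text \<open>A finite complex given by characteristic maps of its cells: \<open>\<kappa> j\<close> for the one-cells, parametrised by the
  interval from \<open>-1\<close> to \<open>1\<close>, and \<open>\<Phi> l\<close> for the two-cells.\<close>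

locale two_cell_complex =
  fixes X :: "'a topology" and S :: "'a set" and e :: 'a and w r :: nat
    and \<kappa> :: "nat \<Rightarrow> real \<Rightarrow> 'a" and \<Phi> :: "nat \<Rightarrow> complex \<Rightarrow> 'a"
  assumes Hausdorff: "Hausdorff_space X" and closed_S: "closedin X S"
    and arc_continuous: "\<And>j. j < w \<Longrightarrow> continuous_map (top_of_set {-1..1}) X (\<kappa> j)"
    and arc_base: "\<And>j \<tau>. \<lbrakk>j < w; \<bar>\<tau>\<bar> \<le> 1\<rbrakk> \<Longrightarrow> \<kappa> j \<tau> = e \<longleftrightarrow> \<bar>\<tau>\<bar> = 1"
    and arc_inj: "\<And>j k \<tau> \<sigma>. \<lbrakk>j < w; k < w; \<bar>\<tau>\<bar> < 1; \<bar>\<sigma>\<bar> < 1; \<kappa> j \<tau> = \<kappa> k \<sigma>\<rbrakk> \<Longrightarrow> j = k \<and> \<tau> = \<sigma>"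
    and S_eq: "S = insert e (\<Union>j<w. \<kappa> j ` {-1..1})"
    and disc_continuous: "\<And>l. l < r \<Longrightarrow> continuous_map (top_of_set (cball 0 1)) X (\<Phi> l)"
    and disc_boundary: "\<And>l z. \<lbrakk>l < r; cmod z = 1\<rbrakk> \<Longrightarrow> \<Phi> l z \<in> S"
    and disc_interior: "\<And>l z. \<lbrakk>l < r; cmod z < 1\<rbrakk> \<Longrightarrow> \<Phi> l z \<in> topspace X - S"
    and disc_inj: "\<And>l k z y. \<lbrakk>l < r; k < r; cmod z < 1; cmod y < 1; \<Phi> l z = \<Phi> k y\<rbrakk> \<Longrightarrow> l = k \<and> z = y"
    and disc_cover: "topspace X - S \<subseteq> (\<Union>l<r. \<Phi> l ` ball 0 1)"
    and disc_open: "\<And>l V. \<lbrakk>l < r; open V; V \<subseteq> ball 0 1\<rbrakk> \<Longrightarrow> openin X (\<Phi> l ` V)"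
begin

lemma arc_in_S: "\<lbrakk>j < w; \<bar>\<tau>\<bar> \<le> 1\<rbrakk> \<Longrightarrow> \<kappa> j \<tau> \<in> S"
  unfolding S_eq by (intro insertI2 UN_I[of j] imageI) auto

lemma e_S: "e \<in> S" by (simp add: S_eq)

lemma S_X: "S \<subseteq> topspace X" using closedin_subset[OF closed_S] .

lemma S_cases:
  assumes "p \<in> S"
  obtains "p = e" | j \<tau> where "j < w" "\<bar>\<tau>\<bar> < 1" "p = \<kappa> j \<tau>"
proof -
  consider "p = e" | j \<tau> where "j < w" "\<bar>\<tau>\<bar> \<le> 1" "p = \<kappa> j \<tau>"
    using assms unfolding S_eq by (auto simp: abs_le_iff)
  then show ?thesis
    using that arc_base by cases (auto simp: le_less)
qed

lemma X_cases:
  assumes "p \<in> topspace X"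
  obtains "p \<in> S" | l z where "l < r" "cmod z < 1" "p = \<Phi> l z"
  using assms disc_cover by fastforce

lemma closedin_arc_image: "\<lbrakk>j < w; compact A; A \<subseteq> {-1..1}\<rbrakk> \<Longrightarrow> closedin X (\<kappa> j ` A)"
  using image_compactin[OF _ arc_continuous, of A j] Hausdorff
  by (auto simp: compactin_subtopology intro: compactin_imp_closedin)

text \<open>Each arc is stretched by the factor \<open>1 + s\<close> about its midpoint, and what leaves the arc is sent to \<open>e\<close>.\<close>

definition expand_arc :: "real \<Rightarrow> 'a \<Rightarrow> 'a"
  where "expand_arc s p = (if p = e then e else
     let (j, \<tau>) = (SOME (j, \<tau>). j < w \<and> \<bar>\<tau>\<bar> < 1 \<and> p = \<kappa> j \<tau>) in \<kappa> j (clamp1 ((1 + s) * \<tau>)))"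

lemma expand_arc_e [simp]: "expand_arc s e = e" by (simp add: expand_arc_def)

text \<open>At the ends of the arc both sides are \<open>e\<close>; elsewhere the parameter chosen in the definition is unique.\<close>

lemma expand_arc_arc:
  assumes "j < w" "\<bar>\<tau>\<bar> \<le> 1" "s \<ge> 0"
  shows "expand_arc s (\<kappa> j \<tau>) = \<kappa> j (clamp1 ((1 + s) * \<tau>))"
proof (cases "\<bar>\<tau>\<bar> = 1")
  case True
  then have e: "\<kappa> j \<tau> = e" using arc_base[OF assms(1,2)] by simp
  have "\<bar>clamp1 ((1 + s) * \<tau>)\<bar> = 1" using True assms(3) by (auto simp: clamp1_def abs_if split: if_splits)
  then have "\<kappa> j (clamp1 ((1 + s) * \<tau>)) = e" using arc_base[OF assms(1)] by simp
  with e show ?thesis by simp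
next
  case False
  then have lt: "\<bar>\<tau>\<bar> < 1" using assms(2) by simp
  have "(SOME (k, \<sigma>). k < w \<and> \<bar>\<sigma>\<bar> < 1 \<and> \<kappa> j \<tau> = \<kappa> k \<sigma>) = (j, \<tau>)"
  proof (rule some_equality)
    show "case (j, \<tau>) of (k, \<sigma>) \<Rightarrow> k < w \<and> \<bar>\<sigma>\<bar> < 1 \<and> \<kappa> j \<tau> = \<kappa> k \<sigma>" using assms lt by simp
    show "q = (j, \<tau>)" if "case q of (k, \<sigma>) \<Rightarrow> k < w \<and> \<bar>\<sigma>\<bar> < 1 \<and> \<kappa> j \<tau> = \<kappa> k \<sigma>" for q
      using that arc_inj[OF assms(1) _ lt] by (cases q) auto
  qed
  moreover have "\<kappa> j \<tau> \<noteq> e" using arc_base[OF assms(1,2)] False by simp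
  ultimately show ?thesis by (simp add: expand_arc_def)
qed

lemma clamp1_bound: "\<bar>clamp1 x\<bar> \<le> 1" by (auto simp: clamp1_def)

lemma expand_arc_S: assumes "p \<in> S" "s \<ge> 0" shows "expand_arc s p \<in> S"
  using assms(1)
proof (cases p rule: S_cases)
  case (2 j \<tau>)
  then show ?thesis using expand_arc_arc[of j \<tau> s] assms(2) arc_in_S clamp1_bound by simp
qed (use e_S in auto)

lemma expand_arc_0: assumes "p \<in> S" shows "expand_arc 0 p = p"
  using assms
proof (cases p rule: S_cases)
  case (2 j \<tau>)
  then have "\<bar>\<tau>\<bar> \<le> 1" by simp
  then show ?thesis using expand_arc_arc[of j \<tau> 0] 2 by (simp add: clamp1_def abs_le_iff)
qed auto

text \<open>The disc is stretched by the factor \<open>1 + s\<close> about its centre. A point that would arrive at a radius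
  \<open>1 + t > 1\<close> goes instead to the boundary point on its ray, moved by the expansion of the arcs at
  time \<open>t\<close>. At radius \<open>1\<close> the two formulas agree, and on the boundary circle of the disc, where
  \<open>t = s\<close>, the result is the expansion of the arcs.\<close>

definition expand_disc :: "nat \<Rightarrow> real \<Rightarrow> complex \<Rightarrow> 'a"
  where "expand_disc l s z = (if (1 + s) * cmod z \<le> 1 then \<Phi> l ((1 + s) *\<^sub>R z)
     else expand_arc ((1 + s) * cmod z - 1) (\<Phi> l (sgn z)))"

definition expand :: "real \<Rightarrow> 'a \<Rightarrow> 'a"
  where "expand s p = (if p \<in> S then expand_arc s p else
     let (l, z) = (SOME (l, z). l < r \<and> cmod z < 1 \<and> p = \<Phi> l z) in expand_disc l s z)"

lemma expand_S: "p \<in> S \<Longrightarrow> expand s p = expand_arc s p" by (simp add: expand_def)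

text \<open>On the boundary of the disc the radial formula continues the expansion of the arcs.\<close>

lemma expand_disc_eq:
  assumes "l < r" "cmod z \<le> 1" "s \<ge> 0"
  shows "expand s (\<Phi> l z) = expand_disc l s z"
proof (cases "cmod z = 1")
  case True
  then have "\<Phi> l z \<in> S" using disc_boundary assms by blast
  moreover have "sgn z = z" using True by (simp add: sgn_div_norm)
  ultimately show ?thesis
    using True assms(3) expand_arc_0 by (cases "s = 0") (auto simp: expand_S expand_disc_def)
next
  case False
  then have lt: "cmod z < 1" using assms(2) by simp
  have "(SOME (k, y). k < r \<and> cmod y < 1 \<and> \<Phi> l z = \<Phi> k y) = (l, z)"
  proof (rule some_equality)
    show "case (l, z) of (k, y) \<Rightarrow> k < r \<and> cmod y < 1 \<and> \<Phi> l z = \<Phi> k y" using assms lt by simp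
    show "q = (l, z)" if "case q of (k, y) \<Rightarrow> k < r \<and> cmod y < 1 \<and> \<Phi> l z = \<Phi> k y" for q
      using that disc_inj[OF assms(1) _ lt] by (cases q) auto
  qed
  moreover have "\<Phi> l z \<notin> S" using disc_interior[OF assms(1) lt] by blast
  ultimately show ?thesis by (simp add: expand_def)
qed

lemma prod_top_of_set: "prod_topology (top_of_set A) (top_of_set B) = top_of_set (A \<times> B)"
  by (simp flip: subtopology_Times)

lemma expand_arc_continuous:
  "continuous_map (prod_topology (top_of_set {0..c}) (subtopology X S)) (subtopology X S) (\<lambda>(s, p). expand_arc s p)"
proof (rule continuous_map_closed_cover[where I="insert None (Some ` {..<w})"
      and A="\<lambda>i. {0..c} \<times> (case i of None \<Rightarrow> {e} | Some j \<Rightarrow> \<kappa> j ` {-1..1})"])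
  let ?P = "prod_topology (top_of_set {0..c}) (subtopology X S)"
  let ?f = "\<lambda>(s, p). expand_arc s p"
  have HS: "Hausdorff_space (subtopology X S)" using Hausdorff by (rule Hausdorff_space_subtopology)
  have HP: "Hausdorff_space ?P" using HS by (simp add: Hausdorff_space_prod_topology Hausdorff_space_subtopology)
  show "finite (insert None (Some ` {..<w}))" by simp
  have "closedin (subtopology X S) {e}"
    using HS e_S S_X by (intro closedin_Hausdorff_singleton) auto
  moreover have "closedin (subtopology X S) (\<kappa> j ` {-1..1})" if "j < w" for j
    using closedin_arc_image[OF that, of "{-1..1}"] arc_in_S[OF that] by (intro closedin_subset_topspace) (auto simp: abs_le_iff)
  ultimately show "closedin ?P ({0..c} \<times> (case i of None \<Rightarrow> {e} | Some j \<Rightarrow> \<kappa> j ` {-1..1}))"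
    if "i \<in> insert None (Some ` {..<w})" for i
    using that by (auto simp: closedin_prod_Times_iff)
  show "topspace ?P \<subseteq> (\<Union>i\<in>insert None (Some ` {..<w}). {0..c} \<times> (case i of None \<Rightarrow> {e} | Some j \<Rightarrow> \<kappa> j ` {-1..1}))"
    using S_eq by (auto simp: topspace_prod_topology)
  show "continuous_map (subtopology ?P ({0..c} \<times> (case i of None \<Rightarrow> {e} | Some j \<Rightarrow> \<kappa> j ` {-1..1}))) (subtopology X S) ?f"
    if "i \<in> insert None (Some ` {..<w})" for i
  proof (cases i)
    case None
    have "continuous_map (subtopology ?P ({0..c} \<times> {e})) (subtopology X S) (\<lambda>_. e)"
      using e_S S_X by auto
    then show ?thesis unfolding None option.case
      by (rule continuous_map_eq) auto
  next
    case (Some j)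
    then have j: "j < w" using that by auto
    let ?K = "top_of_set ({0..c} \<times> {-1..1::real})"
    let ?q = "\<lambda>(s, \<tau>). (s, \<kappa> j \<tau>)"
    have arc: "continuous_map (top_of_set {-1..1}) (subtopology X S) (\<kappa> j)"
      using arc_continuous[OF j] arc_in_S[OF j] by (auto simp: continuous_map_in_subtopology abs_le_iff)
    have q: "continuous_map ?K ?P ?q"
      unfolding prod_top_of_set[symmetric] case_prod_unfold
      by (intro continuous_map_pairedI continuous_map_fst continuous_map_compose[OF continuous_map_snd arc, unfolded o_def])
    have K: "compact_space ?K" by (simp add: compact_space_subtopology compact_Times)
    have "continuous_map ?K (top_of_set {-1..1}) (\<lambda>(s, \<tau>). clamp1 ((1 + s) * \<tau>))"
      using clamp1_bound by (auto simp: clamp1_def case_prod_unfold intro!: continuous_intros)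
    from continuous_map_compose[OF this arc]
    have "continuous_map ?K (subtopology X S) (\<lambda>(s, \<tau>). \<kappa> j (clamp1 ((1 + s) * \<tau>)))"
      by (simp add: o_def case_prod_unfold)
    then have "continuous_map ?K (subtopology X S) (?f \<circ> ?q)"
      by (rule continuous_map_eq) (auto simp: expand_arc_arc[OF j] abs_le_iff)
    from continuous_map_from_compact_image[OF HP K q this]
    have "continuous_map (subtopology ?P (?q ` topspace ?K)) (subtopology X S) ?f" .
    moreover have "?q ` topspace ?K = {0..c} \<times> \<kappa> j ` {-1..1}" by force
    ultimately show ?thesis unfolding Some option.case by metis
  qed
qed

lemma expand_disc_continuous:
  assumes l: "l < r" and c: "c \<ge> 0"
  shows "continuous_map (top_of_set ({0..c} \<times> cball 0 1)) X (\<lambda>(s, z). expand_disc l s z)"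
proof -
  let ?K = "top_of_set ({0..c} \<times> cball (0::complex) 1)"
  have "continuous_map ?K X (\<lambda>q. if (1 + fst q) * cmod (snd q) \<le> 1 then \<Phi> l ((1 + fst q) *\<^sub>R snd q)
     else expand_arc ((1 + fst q) * cmod (snd q) - 1) (\<Phi> l (sgn (snd q))))"
  proof (rule continuous_map_cases_le)
    show "continuous_map ?K euclideanreal (\<lambda>q. (1 + fst q) * cmod (snd q))"
      by (auto intro!: continuous_intros)
    show "continuous_map ?K euclideanreal (\<lambda>q. 1)" by simp
    let ?A = "{q \<in> {0..c} \<times> cball (0::complex) 1. (1 + fst q) * cmod (snd q) \<le> 1}"
    let ?B = "{q \<in> {0..c} \<times> cball (0::complex) 1. 1 \<le> (1 + fst q) * cmod (snd q)}"
    have "continuous_map (top_of_set ?A) (top_of_set (cball 0 1)) (\<lambda>q. (1 + fst q) *\<^sub>R snd q)"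
      by (auto intro!: continuous_intros)
    from continuous_map_compose[OF this disc_continuous[OF l]]
    show "continuous_map (subtopology ?K {q. q \<in> topspace ?K \<and> (1 + fst q) * cmod (snd q) \<le> 1}) X
        (\<lambda>q. \<Phi> l ((1 + fst q) *\<^sub>R snd q))"
      by (simp add: o_def subtopology_subtopology Int_absorb1 Collect_conj_eq)
    have nz: "snd q \<noteq> 0" if "q \<in> ?B" for q using that by auto
    have sgn: "continuous_map (top_of_set ?B) (top_of_set (sphere 0 1)) (\<lambda>q. sgn (snd q))"
      using nz by (auto simp: norm_sgn intro!: continuous_intros)
    have "continuous_map (top_of_set (sphere 0 1)) (subtopology X S) (\<Phi> l)"
      using disc_continuous[OF l] disc_boundary[OF l]
      by (auto simp: continuous_map_in_subtopology elim: continuous_map_from_subtopology_mono)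
    from continuous_map_compose[OF sgn this, unfolded o_def]
    have 1: "continuous_map (top_of_set ?B) (subtopology X S) (\<lambda>q. \<Phi> l (sgn (snd q)))" .
    have "(1 + s) * cmod z - 1 \<le> c" if "0 \<le> s" "s \<le> c" "cmod z \<le> 1" for s z
      using mult_mono[of "1 + s" "1 + c" "cmod z" 1] that by auto
    then have 2: "continuous_map (top_of_set ?B) (top_of_set {0..c}) (\<lambda>q. (1 + fst q) * cmod (snd q) - 1)"
      by (auto intro!: continuous_intros)
    have "continuous_map (top_of_set ?B) (subtopology X S) (\<lambda>q. expand_arc ((1 + fst q) * cmod (snd q) - 1) (\<Phi> l (sgn (snd q))))"
      using continuous_map_compose[OF continuous_map_pairedI[OF 2 1] expand_arc_continuous] by (simp add: o_def)
    then show "continuous_map (subtopology ?K {q. q \<in> topspace ?K \<and> 1 \<le> (1 + fst q) * cmod (snd q)}) X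
        (\<lambda>q. expand_arc ((1 + fst q) * cmod (snd q) - 1) (\<Phi> l (sgn (snd q))))"
      by (simp add: continuous_map_in_subtopology subtopology_subtopology Int_absorb1 Collect_conj_eq)
    show "\<Phi> l ((1 + fst q) *\<^sub>R snd q) = expand_arc ((1 + fst q) * cmod (snd q) - 1) (\<Phi> l (sgn (snd q)))"
      if q: "q \<in> topspace ?K" "(1 + fst q) * cmod (snd q) = 1" for q
    proof -
      have "snd q \<noteq> 0" using q by auto
      then have "cmod (sgn (snd q)) = 1" by (simp add: norm_sgn)
      moreover have "inverse (cmod (snd q)) = 1 + fst q" using q(2) by (metis inverse_unique mult.commute)
      then have "sgn (snd q) = (1 + fst q) *\<^sub>R snd q" by (simp only: sgn_div_norm)
      ultimately show ?thesis using expand_arc_0 disc_boundary[OF l, of "sgn (snd q)"] q(2) by simp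
    qed
  qed
  then show ?thesis by (simp add: expand_disc_def case_prod_unfold)
qed

text \<open>It suffices to look at the finitely many closed pieces \<open>S\<close> and \<open>\<Phi> l ` cball 0 1\<close>.\<close>

lemma expand_continuous:
  assumes c: "c \<ge> 0"
  shows "continuous_map (prod_topology (top_of_set {0..c}) X) X (\<lambda>(s, p). expand s p)"
proof (rule continuous_map_closed_cover[where I="insert None (Some ` {..<r})"
      and A="\<lambda>i. {0..c} \<times> (case i of None \<Rightarrow> S | Some l \<Rightarrow> \<Phi> l ` cball 0 1)"])
  let ?P = "prod_topology (top_of_set {0..c}) X"
  let ?f = "\<lambda>(s, p). expand s p"
  have HP: "Hausdorff_space ?P" using Hausdorff by (simp add: Hausdorff_space_prod_topology Hausdorff_space_subtopology)
  show "finite (insert None (Some ` {..<r}))" by simp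
  have "closedin X (\<Phi> l ` cball 0 1)" if "l < r" for l
    using image_compactin[OF _ disc_continuous[OF that], of "cball 0 1"] Hausdorff
    by (auto simp: compactin_subtopology intro: compactin_imp_closedin)
  then show "closedin ?P ({0..c} \<times> (case i of None \<Rightarrow> S | Some l \<Rightarrow> \<Phi> l ` cball 0 1))"
    if "i \<in> insert None (Some ` {..<r})" for i
    using that closed_S by (auto simp: closedin_prod_Times_iff)
  have "ball (0::complex) 1 \<subseteq> cball 0 1" by auto
  then have "topspace X \<subseteq> S \<union> (\<Union>l<r. \<Phi> l ` cball 0 1)" using disc_cover by blast
  then show "topspace ?P \<subseteq> (\<Union>i\<in>insert None (Some ` {..<r}). {0..c} \<times> (case i of None \<Rightarrow> S | Some l \<Rightarrow> \<Phi> l ` cball 0 1))"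
    by (auto simp: topspace_prod_topology)
  show "continuous_map (subtopology ?P ({0..c} \<times> (case i of None \<Rightarrow> S | Some l \<Rightarrow> \<Phi> l ` cball 0 1))) X ?f"
    if "i \<in> insert None (Some ` {..<r})" for i
  proof (cases i)
    case None
    have "subtopology ?P ({0..c} \<times> S) = prod_topology (top_of_set {0..c}) (subtopology X S)"
      by (simp add: subtopology_Times subtopology_subtopology)
    moreover have "continuous_map (prod_topology (top_of_set {0..c}) (subtopology X S)) X (\<lambda>(s, p). expand_arc s p)"
      using expand_arc_continuous continuous_map_into_fulltopology by blast
    ultimately have "continuous_map (subtopology ?P ({0..c} \<times> S)) X (\<lambda>(s, p). expand_arc s p)" by simp
    then show ?thesis unfolding None option.case by (rule continuous_map_eq) (auto simp: expand_S)
  next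
    case (Some l)
    then have l: "l < r" using that by auto
    let ?K = "top_of_set ({0..c} \<times> cball (0::complex) 1)"
    let ?q = "\<lambda>(s, z). (s, \<Phi> l z)"
    have q: "continuous_map ?K ?P ?q"
      unfolding prod_top_of_set[symmetric] case_prod_unfold
      by (intro continuous_map_pairedI continuous_map_fst
          continuous_map_compose[OF continuous_map_snd disc_continuous[OF l], unfolded o_def])
    have K: "compact_space ?K" by (simp add: compact_space_subtopology compact_Times)
    have "continuous_map ?K X (?f \<circ> ?q)"
      using expand_disc_continuous[OF l c] by (rule continuous_map_eq) (auto simp: expand_disc_eq[OF l])
    from continuous_map_from_compact_image[OF HP K q this]
    have "continuous_map (subtopology ?P (?q ` topspace ?K)) X ?f" .
    moreover have "?q ` topspace ?K = {0..c} \<times> \<Phi> l ` cball 0 1" by force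
    ultimately show ?thesis unfolding Some option.case by metis
  qed
qed

end

section \<open>Charts of the cells\<close>

text \<open>The spacing keeps the open discs of radius \<open>2\<close> about different centres disjoint.\<close>

definition centre :: "nat \<Rightarrow> complex"
  where "centre l = of_nat (4 * l)"

definition cell_index :: "complex \<Rightarrow> nat"
  where "cell_index z = nat \<lfloor>(Re z + 2) / 4\<rfloor>"

lemma cell_index_eq: "cmod (z - centre l) < 2 \<Longrightarrow> cell_index z = l"
proof -
  assume "cmod (z - centre l) < 2"
  then have "\<bar>Re z - 4 * real l\<bar> < 2"
    using abs_Re_le_cmod[of "z - centre l"] by (simp add: centre_def)
  then have "\<lfloor>(Re z + 2) / 4\<rfloor> = int l" by (simp add: floor_eq_iff abs_less_iff)
  then show ?thesis by (simp add: cell_index_def)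
qed

lemma mem_closed_nbhd_centres: "z \<in> closed_nbhd (centre ` {..<k}) \<delta> \<longleftrightarrow> (\<exists>l<k. cmod (z - centre l) \<le> \<delta>)"
  by (auto simp: closed_nbhd_def dist_norm norm_minus_commute)

lemma mem_open_nbhd_centres: "z \<in> open_nbhd (centre ` {..<k}) \<delta> \<longleftrightarrow> (\<exists>l<k. cmod (z - centre l) < \<delta>)"
  by (auto simp: open_nbhd_def dist_norm norm_minus_commute)

lemma card_centres: "card (centre ` {..<k}) = k"
  by (subst card_image) (auto simp: inj_on_def centre_def)

lemma continuous_map_glued_charts:
  assumes "closed R"
    and \<phi>: "\<And>l. l < k \<Longrightarrow> continuous_map (top_of_set (cball (centre l) (1/2) \<inter> R)) X (\<phi> l)"
    and f: "\<And>l z. cmod (z - centre l) < 2 \<Longrightarrow> f z = \<phi> l z"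
  shows "continuous_map (top_of_set (closed_nbhd (centre ` {..<k}) (1/2) \<inter> R)) X f" (is "continuous_map (top_of_set ?A) X f")
proof (rule continuous_map_closed_cover[where I="{..<k}" and A="\<lambda>l. cball (centre l) (1/2) \<inter> R"])
  fix l assume "l \<in> {..<k}"
  then have l: "l < k" by simp
  have sub: "cball (centre l) (1/2) \<inter> R \<subseteq> ?A" using l by (auto simp: closed_nbhd_def)
  show "closedin (top_of_set ?A) (cball (centre l) (1/2) \<inter> R)"
    using sub assms(1) by (intro closed_subset closed_Int) auto
  have "continuous_map (top_of_set (cball (centre l) (1/2) \<inter> R)) X f"
    using \<phi>[OF l]
  proof (rule continuous_map_eq)
    fix z assume "z \<in> topspace (top_of_set (cball (centre l) (1/2) \<inter> R))"
    then have "cmod (z - centre l) < 2" by (auto simp: dist_norm norm_minus_commute)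
    then show "\<phi> l z = f z" by (simp only: f)
  qed
  moreover have "subtopology (top_of_set ?A) (cball (centre l) (1/2) \<inter> R) = top_of_set (cball (centre l) (1/2) \<inter> R)"
    unfolding subtopology_subtopology using sub by (simp only: Int_absorb1)
  ultimately show "continuous_map (subtopology (top_of_set ?A) (cball (centre l) (1/2) \<inter> R)) X f" by simp
qed (auto simp: closed_nbhd_def)

context two_cell_complex
begin

definition disc_chart :: "complex \<Rightarrow> 'a"
  where "disc_chart z = \<Phi> (cell_index z) (z - centre (cell_index z))"

definition arc_chart :: "complex \<Rightarrow> 'a"
  where "arc_chart z = \<kappa> (cell_index z) (Re (z - centre (cell_index z)))"

lemma disc_chart_eq: "cmod (z - centre l) < 2 \<Longrightarrow> disc_chart z = \<Phi> l (z - centre l)"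
  by (simp add: disc_chart_def cell_index_eq)

lemma arc_chart_eq: "cmod (z - centre l) < 2 \<Longrightarrow> arc_chart z = \<kappa> l (Re (z - centre l))"
  by (simp add: arc_chart_def cell_index_eq)

lemma real_centre: "z \<in> \<real> \<Longrightarrow> cmod (z - centre l) = \<bar>Re (z - centre l)\<bar>"
  by (metis Reals_diff Reals_of_nat centre_def complex_is_Real_iff in_Reals_norm of_real_Re of_real_def norm_of_real)

text \<open>The complement in \<open>S\<close> is a finite union of compact sets.\<close>

lemma arc_open:
  assumes j: "j < w" shows "openin (subtopology X S) (\<kappa> j ` {-(1/2)<..<1/2})"
proof -
  \<comment> \<open>the base point, the other arcs, and the two outer quarters of the \<open>j\<close>-th arc\<close>
  let ?R = "insert e ((\<Union>k\<in>{..<w} - {j}. \<kappa> k ` {-1..1}) \<union> \<kappa> j ` ({-1..-(1/2)} \<union> {1/2..1}))"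
  have "closedin X {e}" using Hausdorff e_S S_X by (intro closedin_Hausdorff_singleton) auto
  moreover have "closedin X (\<Union>k\<in>{..<w} - {j}. \<kappa> k ` {-1..1})"
    using closedin_arc_image[of _ "{-1..1}"] by (intro closedin_Union) auto
  moreover have "closedin X (\<kappa> j ` ({-1..-(1/2)} \<union> {1/2..1}))"
    using closedin_arc_image[OF j, of "{-1..-(1/2)} \<union> {1/2..1}"] by (auto intro: compact_Un)
  ultimately have "closedin X ({e} \<union> ((\<Union>k\<in>{..<w} - {j}. \<kappa> k ` {-1..1}) \<union> \<kappa> j ` ({-1..-(1/2)} \<union> {1/2..1})))"
    by (intro closedin_Un)
  then have R: "closedin X ?R" by simp
  have "S - \<kappa> j ` {-(1/2)<..<1/2} = ?R"
  proof (rule set_eqI)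
    fix p
    have disj: "p \<notin> ?R" if \<tau>: "p = \<kappa> j \<tau>" "\<bar>\<tau>\<bar> < 1/2" for \<tau>
    proof
      assume "p \<in> ?R"
      moreover have "p \<noteq> e" using arc_base[OF j, of \<tau>] \<tau> by auto
      ultimately consider k \<sigma> where "k \<in> {..<w} - {j}" "\<sigma> \<in> {-1..1}" "p = \<kappa> k \<sigma>"
        | \<sigma> where "\<sigma> \<in> {-1..-(1/2)} \<union> {1/2..1}" "p = \<kappa> j \<sigma>" by blast
      then obtain k \<sigma> where k: "k < w" "\<bar>\<sigma>\<bar> \<le> 1" "p = \<kappa> k \<sigma>" "k \<noteq> j \<or> \<bar>\<sigma>\<bar> \<ge> 1/2"
      proof cases
        case (1 k \<sigma>)
        then show ?thesis using that[of k \<sigma>] by auto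
      next
        case (2 \<sigma>)
        then show ?thesis using that[of j \<sigma>] j by auto
      qed
      then have "\<bar>\<sigma>\<bar> < 1" using arc_base[of k \<sigma>] \<open>p \<noteq> e\<close> by simp
      then show False using arc_inj[of k j \<sigma> \<tau>] k j \<tau> by auto
    qed
    have cover: "p \<in> ?R \<union> \<kappa> j ` {-(1/2)<..<1/2}" if "p \<in> S"
      using that
    proof (cases p rule: S_cases)
      case (2 k \<sigma>)
      then show ?thesis
        by (cases "k = j"; cases "\<bar>\<sigma>\<bar> < 1/2") (force simp: abs_less_iff)+
    qed auto
    have RS: "?R \<subseteq> S" using arc_in_S j e_S by (force simp: abs_le_iff)
    have disj': "p \<notin> ?R" if "p \<in> \<kappa> j ` {-(1/2)<..<1/2}"
    proof -
      obtain \<tau> where "\<tau> \<in> {-(1/2)<..<1/2}" "p = \<kappa> j \<tau>" using \<open>p \<in> _\<close> by blast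
      then show ?thesis by (intro disj[of \<tau>]) auto
    qed
    define R where "R = ?R"
    show "p \<in> S - \<kappa> j ` {-(1/2)<..<1/2} \<longleftrightarrow> p \<in> ?R"
      using disj' cover RS unfolding R_def[symmetric] by blast
  qed
  then have eq: "\<kappa> j ` {-(1/2)<..<1/2} = topspace (subtopology X S) - ?R"
    using S_X arc_in_S[OF j] by (auto simp: abs_le_iff)
  have "?R \<subseteq> S" using \<open>S - _ = ?R\<close> by blast
  then have "closedin (subtopology X S) ?R" using R by (rule closedin_subset_topspace[rotated])
  then show ?thesis unfolding eq by (rule openin_diff[OF openin_topspace])
qed

text \<open>Expansion by the factor \<open>1 + 1 / \<delta>\<close> moves all points at distance more than \<open>\<delta>\<close> from the centre of their cell
  across the boundary of that cell.\<close>

lemma expansion_pushes: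
  assumes "\<delta> > 0"
  shows "\<exists>H. continuous_map (prod_topology (top_of_set {0..1::real}) X) X H \<and>
     (\<forall>x\<in>topspace X. H (0, x) = x) \<and> (\<forall>t\<in>{0..1}. H (t, e) = e) \<and> (\<forall>t\<in>{0..1}. \<forall>x\<in>S. H (t, x) \<in> S) \<and>
     (\<forall>x\<in>topspace X - S - disc_chart ` closed_nbhd (centre ` {..<r}) \<delta>. H (1, x) \<in> S) \<and>
     (\<forall>x\<in>S - arc_chart ` (closed_nbhd (centre ` {..<w}) \<delta> \<inter> \<real>). H (1, x) = e)"
proof -
  define c where "c = 1 / \<delta>"
  have c: "c > 0" "\<And>x. x > \<delta> \<Longrightarrow> (1 + c) * x > 1"
  proof -
    show "c > 0" using assms by (simp add: c_def)
    show "(1 + c) * x > 1" if "x > \<delta>" for x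
    proof -
      have "1 = c * \<delta>" using assms by (simp add: c_def)
      also have "\<dots> < c * x" using that \<open>c > 0\<close> by simp
      also have "\<dots> \<le> (1 + c) * x" using that assms by (simp add: algebra_simps)
      finally show ?thesis .
    qed
  qed
  define H where "H = (\<lambda>(t, p). expand (c * t) p)"
  have "continuous_map (top_of_set {0..1}) (top_of_set {0..c}) (\<lambda>t. c * t)"
    using c(1) by (auto intro!: continuous_intros mult_left_le)
  from continuous_map_compose[OF continuous_map_fst this]
  have "continuous_map (prod_topology (top_of_set {0..1}) X) (prod_topology (top_of_set {0..c}) X) (\<lambda>q. (c * fst q, snd q))"
    by (intro continuous_map_pairedI continuous_map_snd) (simp add: o_def)
  from continuous_map_compose[OF this expand_continuous] c(1)
  have "continuous_map (prod_topology (top_of_set {0..1}) X) X H"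
    by (simp add: H_def o_def case_prod_unfold)
  moreover have "H (0, x) = x" if "x \<in> topspace X" for x
    using that
  proof (cases x rule: X_cases)
    case 1
    then show ?thesis by (simp add: H_def expand_S expand_arc_0)
  next
    case (2 l z)
    then show ?thesis using expand_disc_eq[of l z 0] by (simp add: H_def expand_disc_def)
  qed
  moreover have "H (t, e) = e" for t by (simp add: H_def expand_S e_S)
  moreover have "H (t, x) \<in> S" if "t \<in> {0..1}" "x \<in> S" for t x
    using that c(1) by (simp add: H_def expand_S expand_arc_S)
  moreover have "H (1, x) \<in> S" if x: "x \<in> topspace X - S - disc_chart ` closed_nbhd (centre ` {..<r}) \<delta>" for x
  proof -
    obtain l z where z: "l < r" "cmod z < 1" "x = \<Phi> l z" using x X_cases[of x] by blast
    have "x = disc_chart (centre l + z)" using disc_chart_eq[of "centre l + z" l] z by simp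
    then have "centre l + z \<notin> closed_nbhd (centre ` {..<r}) \<delta>" using x by blast
    then have "cmod z > \<delta>" using z(1) by (auto simp: mem_closed_nbhd_centres not_le)
    then have big: "(1 + c) * cmod z > 1" using c(2) by blast
    then have "z \<noteq> 0" by auto
    then have "\<Phi> l (sgn z) \<in> S" using disc_boundary[OF z(1)] by (simp add: norm_sgn)
    then show ?thesis
      using big expand_disc_eq[OF z(1), of z c] z c(1) by (simp add: H_def expand_disc_def expand_arc_S)
  qed
  moreover have "H (1, x) = e" if x: "x \<in> S - arc_chart ` (closed_nbhd (centre ` {..<w}) \<delta> \<inter> \<real>)" for x
  proof -
    have "x \<in> S" using x by blast
    then show ?thesis
    proof (cases x rule: S_cases)
      case 1
      then show ?thesis by (simp add: H_def expand_S e_S)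
    next
      case (2 j \<tau>)
      have "x = arc_chart (centre j + of_real \<tau>)" using arc_chart_eq[of "centre j + of_real \<tau>" j] 2 by simp
      moreover have "centre j + of_real \<tau> \<in> \<real>" by (simp add: centre_def)
      ultimately have "centre j + of_real \<tau> \<notin> closed_nbhd (centre ` {..<w}) \<delta>" using x by blast
      then have "\<bar>\<tau>\<bar> > \<delta>" using 2(1) by (auto simp: mem_closed_nbhd_centres not_le)
      then have "1 < (1 + c) * \<bar>\<tau>\<bar>" using c(2) by blast
      then have "1 < \<bar>(1 + c) * \<tau>\<bar>" using c(1) by (simp add: abs_mult)
      then have "\<bar>clamp1 ((1 + c) * \<tau>)\<bar> = 1" by (auto simp: clamp1_def abs_if split: if_splits)
      then have "\<kappa> j (clamp1 ((1 + c) * \<tau>)) = e" using arc_base[OF 2(1)] by simp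
      then show ?thesis using expand_arc_arc[of j \<tau> c] 2 c(1) \<open>x \<in> S\<close> by (simp add: H_def expand_S)
    qed
  qed
  ultimately show ?thesis by (intro exI[of _ H]) blast
qed

lemma is_cell_charts: "cell_charts X S e disc_chart arc_chart (centre ` {..<w}) (centre ` {..<r})"
proof
  show "Hausdorff_space X" "closedin X S" "e \<in> S" using Hausdorff closed_S e_S by auto
  show "finite (centre ` {..<w})" "finite (centre ` {..<r})" "centre ` {..<w} \<subseteq> \<real>" by (auto simp: centre_def)
  let ?A = "closed_nbhd (centre ` {..<w}) (1/2) \<inter> \<real>" and ?D = "closed_nbhd (centre ` {..<r}) (1/2)"
  show "continuous_map (top_of_set ?A) X arc_chart"
  proof (rule continuous_map_glued_charts[OF closed_complex_Reals])
    fix l assume l: "l < w"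
    have "\<bar>Re (z - centre l)\<bar> \<le> 1" if "z \<in> cball (centre l) (1/2)" for z
      using that abs_Re_le_cmod[of "z - centre l"] by (simp add: dist_norm norm_minus_commute)
    then have "(\<lambda>z. Re (z - centre l)) \<in> cball (centre l) (1/2) \<inter> \<real> \<rightarrow> {-1..1}"
      by (fastforce simp only: Pi_iff Int_iff atLeastAtMost_iff abs_le_iff minus_le_iff)
    moreover have "continuous_on (cball (centre l) (1/2) \<inter> \<real>) (\<lambda>z. Re (z - centre l))"
      by (intro continuous_intros)
    ultimately have "continuous_map (top_of_set (cball (centre l) (1/2) \<inter> \<real>)) (top_of_set {-1..1}) (\<lambda>z. Re (z - centre l))"
      by (simp only: continuous_map_subtopology_eu)
    from continuous_map_compose[OF this arc_continuous[OF l]]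
    show "continuous_map (top_of_set (cball (centre l) (1/2) \<inter> \<real>)) X (\<lambda>z. \<kappa> l (Re (z - centre l)))"
      by (simp only: o_def)
  qed (rule arc_chart_eq)
  have "continuous_map (top_of_set (?D \<inter> UNIV)) X disc_chart"
  proof (rule continuous_map_glued_charts[OF closed_UNIV])
    fix l assume l: "l < r"
    have "continuous_map (top_of_set (cball (centre l) (1/2) \<inter> UNIV)) (top_of_set (cball 0 1)) (\<lambda>z. z - centre l)"
      by (auto simp: dist_norm norm_minus_commute intro!: continuous_intros)
    from continuous_map_compose[OF this disc_continuous[OF l]]
    show "continuous_map (top_of_set (cball (centre l) (1/2) \<inter> UNIV)) X (\<lambda>z. \<Phi> l (z - centre l))"
      by (simp only: o_def)
  qed (rule disc_chart_eq)
  then show "continuous_map (top_of_set ?D) X disc_chart" by simp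
  have A: "\<exists>l<w. \<bar>Re (z - centre l)\<bar> \<le> 1/2 \<and> arc_chart z = \<kappa> l (Re (z - centre l))" if "z \<in> ?A" for z
  proof -
    obtain l where "l < w" "cmod (z - centre l) \<le> 1/2" using \<open>z \<in> ?A\<close> by (auto simp: mem_closed_nbhd_centres)
    then show ?thesis using arc_chart_eq[of z l] real_centre[of z l] that by auto
  qed
  have D: "\<exists>l<r. cmod (z - centre l) \<le> 1/2 \<and> disc_chart z = \<Phi> l (z - centre l)" if "z \<in> ?D" for z
  proof -
    obtain l where "l < r" "cmod (z - centre l) \<le> 1/2" using \<open>z \<in> ?D\<close> by (auto simp: mem_closed_nbhd_centres)
    then show ?thesis using disc_chart_eq[of z l] by auto
  qed
  show "inj_on arc_chart ?A"
  proof (rule inj_onI)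
    fix y z assume yz: "y \<in> ?A" "z \<in> ?A" "arc_chart y = arc_chart z"
    obtain l k where l: "l < w" "\<bar>Re (y - centre l)\<bar> \<le> 1/2" "arc_chart y = \<kappa> l (Re (y - centre l))"
      and k: "k < w" "\<bar>Re (z - centre k)\<bar> \<le> 1/2" "arc_chart z = \<kappa> k (Re (z - centre k))" using A yz by metis
    have "l = k \<and> Re (y - centre l) = Re (z - centre k)"
      using l k yz(3) by (intro arc_inj) auto
    then have "Re y = Re z" by auto
    then show "y = z" using yz by (auto simp: complex_is_Real_iff complex_eq_iff)
  qed
  show "inj_on disc_chart ?D"
  proof (rule inj_onI)
    fix y z assume yz: "y \<in> ?D" "z \<in> ?D" "disc_chart y = disc_chart z"
    obtain l k where l: "l < r" "cmod (y - centre l) \<le> 1/2" "disc_chart y = \<Phi> l (y - centre l)"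
      and k: "k < r" "cmod (z - centre k) \<le> 1/2" "disc_chart z = \<Phi> k (z - centre k)" using D yz by metis
    have "l = k \<and> y - centre l = z - centre k"
      using l k yz(3) by (intro disc_inj) auto
    then show "y = z" by auto
  qed
  show "arc_chart ` ?A \<subseteq> S - {e}"
  proof (rule image_subsetI)
    fix z assume "z \<in> ?A"
    then obtain l where l: "l < w" "\<bar>Re (z - centre l)\<bar> \<le> 1/2" "arc_chart z = \<kappa> l (Re (z - centre l))" using A by blast
    then have "\<bar>Re (z - centre l)\<bar> \<le> 1" "\<bar>Re (z - centre l)\<bar> \<noteq> 1" by auto
    then show "arc_chart z \<in> S - {e}" using arc_in_S[OF l(1)] arc_base[OF l(1)] l(3) by (metis DiffI singletonD)
  qed
  show "disc_chart ` ?D \<subseteq> topspace X - S"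
  proof (rule image_subsetI)
    fix z assume "z \<in> ?D"
    then obtain l where l: "l < r" "cmod (z - centre l) \<le> 1/2" "disc_chart z = \<Phi> l (z - centre l)" using D by blast
    then have "cmod (z - centre l) < 1" by linarith
    then show "disc_chart z \<in> topspace X - S" using disc_interior[OF l(1)] l(3) by simp
  qed
  have "arc_chart ` (open_nbhd (centre ` {..<w}) (1/2) \<inter> \<real>) = (\<Union>l<w. \<kappa> l ` {-(1/2)<..<1/2})"
  proof (intro subset_antisym image_subsetI UN_least)
    fix z assume z: "z \<in> open_nbhd (centre ` {..<w}) (1/2) \<inter> \<real>"
    then obtain l where l: "l < w" "cmod (z - centre l) < 1/2" by (auto simp: mem_open_nbhd_centres)
    have "\<bar>Re (z - centre l)\<bar> < 1/2" using real_centre[of z l] z l(2) by (metis IntD2)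
    then have "Re (z - centre l) \<in> {-(1/2)<..<1/2}" unfolding greaterThanLessThan_iff by linarith
    moreover have "arc_chart z = \<kappa> l (Re (z - centre l))" using l by (intro arc_chart_eq) auto
    ultimately show "arc_chart z \<in> (\<Union>l<w. \<kappa> l ` {-(1/2)<..<1/2})" using l(1) by blast
  next
    fix l \<tau> assume l: "l \<in> {..<w}" and \<tau>: "\<tau> \<in> {-(1/2)<..<1/2::real}"
    have "centre l + of_real \<tau> \<in> open_nbhd (centre ` {..<w}) (1/2)"
      using l \<tau> unfolding mem_open_nbhd_centres by (intro exI[of _ l]) auto
    then have "centre l + of_real \<tau> \<in> open_nbhd (centre ` {..<w}) (1/2) \<inter> \<real>" by (simp add: centre_def)
    moreover have "arc_chart (centre l + of_real \<tau>) = \<kappa> l \<tau>"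
      using \<tau> arc_chart_eq[of "centre l + of_real \<tau>" l] by auto
    ultimately show "\<kappa> l \<tau> \<in> arc_chart ` (open_nbhd (centre ` {..<w}) (1/2) \<inter> \<real>)" by (metis imageI)
  qed
  then show "openin (subtopology X S) (arc_chart ` (open_nbhd (centre ` {..<w}) (1/2) \<inter> \<real>))"
    using arc_open by auto
  have "disc_chart ` open_nbhd (centre ` {..<r}) (1/2) = (\<Union>l<r. \<Phi> l ` ball 0 (1/2))"
  proof (intro subset_antisym image_subsetI UN_least)
    fix z assume z: "z \<in> open_nbhd (centre ` {..<r}) (1/2)"
    then obtain l where l: "l < r" "cmod (z - centre l) < 1/2" by (auto simp: mem_open_nbhd_centres)
    then have "z - centre l \<in> ball 0 (1/2)" by simp
    moreover have "disc_chart z = \<Phi> l (z - centre l)" using l by (intro disc_chart_eq) auto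
    ultimately show "disc_chart z \<in> (\<Union>l<r. \<Phi> l ` ball 0 (1/2))" using l(1) by blast
  next
    fix l z assume l: "l \<in> {..<r}" and z: "z \<in> ball (0::complex) (1/2)"
    have "centre l + z \<in> open_nbhd (centre ` {..<r}) (1/2)"
      using l z by (auto simp: mem_open_nbhd_centres intro!: exI[of _ l])
    moreover have "disc_chart (centre l + z) = \<Phi> l z"
      using z disc_chart_eq[of "centre l + z" l] by auto
    ultimately show "\<Phi> l z \<in> disc_chart ` open_nbhd (centre ` {..<r}) (1/2)" by (metis imageI)
  qed
  then show "openin X (disc_chart ` open_nbhd (centre ` {..<r}) (1/2))"
    using disc_open[of _ "ball 0 (1/2)"] by (auto simp: subset_ball intro!: openin_Union)
qed (rule expansion_pushes)

end

section \<open>Two-complexes over a bouquet\<close>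

lemma Hausdorff_spaceI_maps:
  fixes X :: "'a topology"
  assumes "\<And>x y. \<lbrakk>x \<in> topspace X; y \<in> topspace X; x \<noteq> y\<rbrakk> \<Longrightarrow>
     \<exists>f :: 'a \<Rightarrow> complex. continuous_map X euclidean f \<and> f x \<noteq> f y"
  shows "Hausdorff_space X"
  unfolding Hausdorff_space_def
proof (intro allI impI)
  fix x y assume xy: "x \<in> topspace X \<and> y \<in> topspace X \<and> x \<noteq> y"
  then obtain f :: "'a \<Rightarrow> complex" where f: "continuous_map X euclidean f" "f x \<noteq> f y" using assms by blast
  obtain U V where UV: "open U" "open V" "f x \<in> U" "f y \<in> V" "U \<inter> V = {}" using separation_t2[of "f x" "f y"] f(2) by blast
  show "\<exists>U V. openin X U \<and> openin X V \<and> x \<in> U \<and> y \<in> V \<and> disjnt U V"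
    using openin_continuous_map_preimage[OF f(1), of U] openin_continuous_map_preimage[OF f(1), of V] UV xy
    by (intro exI[of _ "{x \<in> topspace X. f x \<in> U}"] exI[of _ "{x \<in> topspace X. f x \<in> V}"]) (auto simp: disjnt_iff)
qed

abbreviation circles :: "nat \<Rightarrow> (nat \<times> complex) topology"
  where "circles w \<equiv> sum_topology (\<lambda>_. top_of_set (sphere (0::complex) 1)) {..<w}"

lemma topspace_collapse: "topspace (collapse X A) = insert A (collapse_map A ` topspace X)"
  unfolding collapse_def by (rule topspace_final_topology) blast

lemma openin_collapse:
  "openin (collapse X A) U \<longleftrightarrow> U \<subseteq> topspace (collapse X A) \<and> openin X {x \<in> topspace X. collapse_map A x \<in> U}"
  unfolding topspace_collapse unfolding collapse_def openin_final_topology ..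

lemma continuous_map_collapse_map: "continuous_map X (collapse X A) (collapse_map A)"
  unfolding continuous_map_def
proof (intro conjI allI impI)
  show "collapse_map A \<in> topspace X \<rightarrow> topspace (collapse X A)" by (auto simp: topspace_collapse)
  show "openin X {x \<in> topspace X. collapse_map A x \<in> U}" if "openin (collapse X A) U" for U
    using that unfolding openin_collapse by blast
qed

lemma topspace_circles: "topspace (circles w) = {..<w} \<times> sphere 0 1"
  by (auto simp: topspace_sum_topology)

lemma wedge_eq_iff:
  "collapse_map (wedge_point w) (j, z) = wedge_point w \<longleftrightarrow> (j, z) \<in> wedge_point w"
  unfolding collapse_map_def by (metis singletonI)

text \<open>Points are separated by the maps \<open>f j\<close> to the circle that are the identity on the \<open>j\<close>-th circle and constant
  on the others.\<close>

lemma Hausdorff_bouquet: "Hausdorff_space (bouquet w)"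
proof (rule Hausdorff_spaceI_maps)
  let ?W = "wedge_point w"
  define f where "f j y = (if y = ?W then 1 else let (k, z) = the_elem y in if k = j then z else 1)"
    for j :: nat and y :: "(nat \<times> complex) set"
  have f: "f j (collapse_map ?W (k, z)) = (if k = j then z else 1)" if "k < w" for j k z
    using that wedge_eq_iff[of w k z] by (auto simp: f_def wedge_point_def collapse_map_def)
  have cont: "continuous_map (bouquet w) euclidean (f j)" for j
    unfolding continuous_map_def
  proof (intro conjI allI impI)
    fix U :: "complex set" assume U: "openin euclidean U"
    let ?A = "{x \<in> topspace (circles w). (\<lambda>(k, z). if k = j then z else 1) x \<in> U}"
    have "openin (circles w) ?A"
      unfolding openin_sum_topology
    proof (intro conjI ballI)
      show "?A \<subseteq> Sigma {..<w} (topspace \<circ> (\<lambda>_. top_of_set (sphere 0 1)))" by (auto simp: topspace_circles)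
      fix i assume "i \<in> {..<w}"
      then have "{z. (i, z) \<in> ?A} = sphere 0 1 \<inter> (if i = j then U else if 1 \<in> U then UNIV else {})"
        by (auto simp: topspace_circles)
      moreover have "open (if i = j then U else if 1 \<in> U then UNIV else {})" using U by simp
      ultimately show "openin (top_of_set (sphere 0 1)) {z. (i, z) \<in> ?A}" by (simp only: openin_open_Int)
    qed
    also have "?A = {x \<in> topspace (circles w). collapse_map ?W x \<in> {y \<in> topspace (bouquet w). f j y \<in> U}}"
      unfolding bouquet_def topspace_collapse topspace_circles using f by auto
    finally show "openin (bouquet w) {y \<in> topspace (bouquet w). f j y \<in> U}"
      unfolding bouquet_def openin_collapse by blast
  qed simp
  fix x y assume x: "x \<in> topspace (bouquet w)" and y: "y \<in> topspace (bouquet w)" and neq: "x \<noteq> y"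
  have cases: "x = ?W \<or> (\<exists>k<w. \<exists>z. x = collapse_map ?W (k, z) \<and> z \<noteq> 1)" if "x \<in> topspace (bouquet w)" for x
  proof (cases "x = ?W")
    case False
    then obtain k z where kz: "k < w" "x = collapse_map ?W (k, z)"
      using \<open>x \<in> topspace (bouquet w)\<close> unfolding bouquet_def topspace_collapse topspace_circles by auto
    then have "(k, z) \<notin> ?W" using False wedge_eq_iff[of w k z] by simp
    then have "z \<noteq> 1" using kz(1) by (auto simp: wedge_point_def)
    then show ?thesis using kz by blast
  qed simp
  have fW: "f j ?W = 1" for j by (simp add: f_def)
  have sep: "\<exists>j. f j x \<noteq> f j y" if xy: "x \<in> topspace (bouquet w)" "y \<in> topspace (bouquet w)" "x \<noteq> y" "x \<noteq> ?W" for x y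
  proof -
    obtain k z where x: "k < w" "x = collapse_map ?W (k, z)" "z \<noteq> 1" using cases[OF xy(1)] xy(4) by blast
    have fx: "f k x = z" using f[OF x(1)] x(2) by simp
    show ?thesis
    proof (cases "y = ?W")
      case True
      then show ?thesis using fx fW x(3) by metis
    next
      case False
      then obtain l u where y: "l < w" "y = collapse_map ?W (l, u)" using cases[OF xy(2)] by blast
      have "f k y = (if l = k then u else 1)" using f[OF y(1)] y(2) by simp
      moreover have "l = k \<longrightarrow> u \<noteq> z" using xy(3) x(2) y(2) by blast
      ultimately have "f k x \<noteq> f k y" using fx x(3) by auto
      then show ?thesis by blast
    qed
  qed
  have "\<exists>j. f j x \<noteq> f j y"
    using sep[OF x y neq] sep[OF y x] neq by metis
  then show "\<exists>f :: (nat \<times> complex) set \<Rightarrow> complex. continuous_map (bouquet w) euclidean f \<and> f x \<noteq> f y"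
    using cont by blast
qed

locale attached_cells =
  fixes X :: "'a topology" and S :: "'a set" and r :: nat and \<Phi> :: "nat \<Rightarrow> complex \<Rightarrow> 'a"
  assumes attach: "attach_two_cells X S r \<Phi>" and HS: "Hausdorff_space (subtopology X S)"
begin

lemma S_X: "S \<subseteq> topspace X"
  and disc_continuous: "l < r \<Longrightarrow> continuous_map (top_of_set (cball 0 1)) X (\<Phi> l)"
  and disc_sphere: "l < r \<Longrightarrow> \<Phi> l ` sphere 0 1 \<subseteq> S"
  and bij: "bij_betw (\<lambda>(j, z). \<Phi> j z) ({..<r} \<times> ball 0 1) (topspace X - S)"
  and openin_iff: "U \<subseteq> topspace X \<Longrightarrow> openin X U \<longleftrightarrow> openin (subtopology X S) (U \<inter> S) \<and>
         (\<forall>j<r. openin (top_of_set (cball 0 1)) {z \<in> cball 0 1. \<Phi> j z \<in> U})"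
  using attach unfolding attach_two_cells_def by blast+

lemma disc_boundary: "\<lbrakk>l < r; cmod z = 1\<rbrakk> \<Longrightarrow> \<Phi> l z \<in> S"
  using disc_sphere[of l] by auto

lemma disc_interior: "\<lbrakk>l < r; cmod z < 1\<rbrakk> \<Longrightarrow> \<Phi> l z \<in> topspace X - S"
  using bij_betwE[OF bij] by fastforce

lemma disc_inj: "\<lbrakk>l < r; k < r; cmod z < 1; cmod y < 1; \<Phi> l z = \<Phi> k y\<rbrakk> \<Longrightarrow> l = k \<and> z = y"
  using bij_betw_imp_inj_on[OF bij] unfolding inj_on_def by fastforce

lemma disc_cover: "topspace X - S \<subseteq> (\<Union>l<r. \<Phi> l ` ball 0 1)"
proof
  fix p assume "p \<in> topspace X - S"
  then have "p \<in> (\<lambda>(j, z). \<Phi> j z) ` ({..<r} \<times> ball 0 1)" using bij_betw_imp_surj_on[OF bij] by simp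
  then show "p \<in> (\<Union>l<r. \<Phi> l ` ball 0 1)" by auto
qed

lemma disc_mem_iff:
  assumes "l < r" "k < r" "V \<subseteq> ball 0 1" "cmod z \<le> 1"
  shows "\<Phi> k z \<in> \<Phi> l ` V \<longleftrightarrow> k = l \<and> z \<in> V"
proof
  assume "\<Phi> k z \<in> \<Phi> l ` V"
  then obtain y where y: "y \<in> V" "\<Phi> k z = \<Phi> l y" by blast
  have y1: "cmod y < 1" using y(1) assms(3) by auto
  then have "\<Phi> k z \<notin> S" using disc_interior[OF assms(1)] y(2) by auto
  then have "cmod z < 1" using disc_boundary[OF assms(2), of z] assms(4) by force
  then show "k = l \<and> z \<in> V" using disc_inj[OF assms(2,1) _ y1 y(2)] y(1) by blast
qed auto

lemma disc_open:
  assumes l: "l < r" and V: "open V" "V \<subseteq> ball 0 1"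
  shows "openin X (\<Phi> l ` V)"
proof -
  have out: "\<Phi> l ` V \<subseteq> topspace X - S"
    using V(2) disc_interior[OF l] by (intro image_subsetI) auto
  then have "\<Phi> l ` V \<inter> S = {}" by blast
  moreover have "openin (top_of_set (cball 0 1)) {z \<in> cball 0 1. \<Phi> k z \<in> \<Phi> l ` V}" if k: "k < r" for k
  proof -
    have "{z \<in> cball 0 1. \<Phi> k z \<in> \<Phi> l ` V} = (if k = l then cball 0 1 \<inter> V else {})"
      using disc_mem_iff[OF l k V(2)] by auto
    then show ?thesis using V(1) by (simp add: openin_open_Int)
  qed
  moreover have "\<Phi> l ` V \<subseteq> topspace X" using out by blast
  ultimately show ?thesis by (simp add: openin_iff)
qed

lemma closed_S: "closedin X S"
proof -
  have "topspace X - S = (\<Union>l<r. \<Phi> l ` ball 0 1)"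
    using disc_cover disc_interior by fastforce
  moreover have "openin X (\<Union>l<r. \<Phi> l ` ball 0 1)" using disc_open by (intro openin_Union) auto
  ultimately show ?thesis using S_X by (simp add: closedin_def)
qed

text \<open>The radial projection to the unit circle for \<open>cmod z \<ge> 1/2\<close>; the maximum makes it continuous at \<open>0\<close>.\<close>

definition radial :: "complex \<Rightarrow> complex"
  where "radial z = z /\<^sub>R max (1/2) (cmod z)"

text \<open>An open subset of \<open>S\<close>, enlarged by the outer halves of those rays of the two-cells that end in it.\<close>

definition thicken :: "'a set \<Rightarrow> 'a set"
  where "thicken A = A \<union> (\<Union>l<r. \<Phi> l ` {z \<in> ball 0 1. cmod z > 1/2 \<and> \<Phi> l (radial z) \<in> A})"

lemma norm_radial: "cmod z > 1/2 \<Longrightarrow> cmod (radial z) = 1"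
proof -
  assume "cmod z > 1/2"
  then have "cmod z \<noteq> 0" "max (1/2) (cmod z) = cmod z" by auto
  then show ?thesis by (simp add: radial_def)
qed

lemma openin_thicken:
  assumes "openin (subtopology X S) A"
  shows "openin X (thicken A)"
proof -
  have AS: "A \<subseteq> S" using openin_subset[OF assms] by auto
  obtain Q where Q: "openin X Q" "A = Q \<inter> S" using assms unfolding openin_subtopology by blast
  have out: "\<Phi> l z \<in> topspace X - S" if "l < r" "z \<in> ball 0 1" for l z using that disc_interior by simp
  have sub: "thicken A \<subseteq> topspace X" using AS S_X out unfolding thicken_def by blast
  have "thicken A \<inter> S = A" using AS out unfolding thicken_def by blast
  moreover have "openin (top_of_set (cball 0 1)) {z \<in> cball 0 1. \<Phi> k z \<in> thicken A}" if k: "k < r" for k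
  proof -
    have eq: "\<Phi> k z \<in> thicken A \<longleftrightarrow> cmod z > 1/2 \<and> \<Phi> k (radial z) \<in> Q" if z: "z \<in> cball 0 1" for z
    proof (cases "cmod z = 1")
      case True
      then have "radial z = z" by (simp add: radial_def)
      have "\<Phi> k z \<in> S" using disc_boundary[OF k True] .
      then have "\<Phi> k z \<in> thicken A \<longleftrightarrow> \<Phi> k z \<in> A" using \<open>thicken A \<inter> S = A\<close> by blast
      then show ?thesis using True \<open>radial z = z\<close> \<open>\<Phi> k z \<in> S\<close> Q(2) by auto
    next
      case False
      then have z1: "cmod z < 1" using z by simp
      then have "\<Phi> k z \<notin> A" using out[OF k, of z] AS by auto
      then have "\<Phi> k z \<in> thicken A \<longleftrightarrow> (\<exists>l<r. \<Phi> k z \<in> \<Phi> l ` {z \<in> ball 0 1. cmod z > 1/2 \<and> \<Phi> l (radial z) \<in> A})"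
        unfolding thicken_def by blast
      also have "\<dots> \<longleftrightarrow> (\<exists>l<r. k = l \<and> z \<in> {z \<in> ball 0 1. cmod z > 1/2 \<and> \<Phi> l (radial z) \<in> A})"
      proof -
        have "\<Phi> k z \<in> \<Phi> l ` {z \<in> ball 0 1. cmod z > 1/2 \<and> \<Phi> l (radial z) \<in> A} \<longleftrightarrow>
            k = l \<and> z \<in> {z \<in> ball 0 1. cmod z > 1/2 \<and> \<Phi> l (radial z) \<in> A}" if "l < r" for l
          using z1 by (intro disc_mem_iff[OF that k]) auto
        then show ?thesis by blast
      qed
      also have "\<dots> \<longleftrightarrow> cmod z > 1/2 \<and> \<Phi> k (radial z) \<in> A" using z1 k by auto
      also have "\<dots> \<longleftrightarrow> cmod z > 1/2 \<and> \<Phi> k (radial z) \<in> Q"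
        using disc_boundary[OF k norm_radial] Q(2) by blast
      finally show ?thesis .
    qed
    have "continuous_on (cball 0 1) radial"
      unfolding radial_def by (intro continuous_intros) (auto simp: max_def)
    moreover have "radial z \<in> cball 0 1" for z
    proof -
      define M where "M = max (1/2) (cmod z)"
      have M: "M > 0" "cmod z \<le> M" by (simp_all add: M_def)
      have "cmod (radial z) = inverse M * cmod z" using M by (simp add: radial_def flip: M_def)
      also have "\<dots> \<le> inverse M * M" using M by (intro mult_left_mono) auto
      finally show ?thesis using M by simp
    qed
    ultimately have "continuous_map (top_of_set (cball 0 1)) (top_of_set (cball 0 1)) radial"
      unfolding continuous_map_subtopology_eu by blast
    from continuous_map_compose[OF this disc_continuous[OF k]]
    have "continuous_map (top_of_set (cball 0 1)) X (\<lambda>z. \<Phi> k (radial z))" by (simp only: o_def)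
    from openin_continuous_map_preimage[OF this Q(1)]
    have 1: "openin (top_of_set (cball 0 1)) {z \<in> cball 0 1. \<Phi> k (radial z) \<in> Q}" by simp
    have "open {z::complex. 1/2 < cmod z}" by (intro open_Collect_less continuous_intros)
    then have "openin (top_of_set (cball 0 1)) (cball 0 1 \<inter> {z. 1/2 < cmod z})" by (rule openin_open_Int)
    from openin_Int[OF 1 this]
    have "openin (top_of_set (cball 0 1)) ({z \<in> cball 0 1. \<Phi> k (radial z) \<in> Q} \<inter> (cball 0 1 \<inter> {z. 1/2 < cmod z}))" .
    moreover have "{z \<in> cball 0 1. \<Phi> k z \<in> thicken A} =
        {z \<in> cball 0 1. \<Phi> k (radial z) \<in> Q} \<inter> (cball 0 1 \<inter> {z. 1/2 < cmod z})" using eq by blast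
    ultimately show ?thesis by simp
  qed
  ultimately show ?thesis using openin_iff[OF sub] assms by simp
qed

lemma disjoint_thicken:
  assumes "A \<subseteq> S" "B \<subseteq> S" "A \<inter> B = {}" shows "thicken A \<inter> thicken B = {}"
proof (rule ccontr)
  assume "thicken A \<inter> thicken B \<noteq> {}"
  then obtain p where p: "p \<in> thicken A" "p \<in> thicken B" by blast
  have out: "\<Phi> l z \<notin> S" if "l < r" "z \<in> ball 0 1" for l z using that disc_interior[of l z] by simp
  show False
  proof (cases "p \<in> S")
    case True
    then have "p \<in> A" "p \<in> B" using p out unfolding thicken_def by blast+
    then show False using assms(3) by blast
  next
    case False
    obtain l z where l: "l < r" "z \<in> ball 0 1" "p = \<Phi> l z" "\<Phi> l (radial z) \<in> A"
      using p(1) False assms(1) unfolding thicken_def by blast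
    obtain k y where k: "k < r" "y \<in> ball 0 1" "p = \<Phi> k y" "\<Phi> k (radial y) \<in> B"
      using p(2) False assms(2) unfolding thicken_def by blast
    have "l = k \<and> z = y" using disc_inj[OF l(1) k(1), of z y] l k by simp
    then show False using l(4) k(4) assms(3) by blast
  qed
qed

text \<open>Two points of \<open>S\<close> are separated by thickened neighbourhoods, a point of \<open>S\<close> and a point of an open cell by a
  concentric circle in that cell, and two points of open cells by open subsets of these cells.\<close>

lemma Hausdorff_X: "Hausdorff_space X"
  unfolding Hausdorff_space_def
proof (intro allI impI)
  fix p q assume pq: "p \<in> topspace X \<and> q \<in> topspace X \<and> p \<noteq> q"
  let ?sep = "\<lambda>p q. \<exists>U V. openin X U \<and> openin X V \<and> p \<in> U \<and> q \<in> V \<and> disjnt U V"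
  have out: "\<exists>l<r. \<exists>z\<in>ball 0 1. p = \<Phi> l z" if "p \<in> topspace X - S" for p using that disc_cover by blast
  have mixed: "?sep p q" if p: "p \<in> S" and q: "q \<in> topspace X - S" for p q
  proof -
    obtain l z where l: "l < r" "z \<in> ball 0 1" "q = \<Phi> l z" using out[OF q] by blast
    \<comment> \<open>the radius of the separating circle\<close>
    define \<rho> where "\<rho> = (1 + cmod z) / 2"
    have \<rho>: "cmod z < \<rho>" "\<rho> < 1" using l(2) by (simp_all add: \<rho>_def)
    have cb: "cball 0 \<rho> \<subseteq> ball (0::complex) 1" using \<rho> by auto
    have bb: "ball 0 \<rho> \<subseteq> ball (0::complex) 1" using \<rho> by auto
    have "compactin (top_of_set (cball 0 1)) (cball (0::complex) \<rho>)" using cb by (auto simp: compactin_subtopology)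
    define U where "U = topspace X - \<Phi> l ` cball 0 \<rho>"
    have SU: "S \<subseteq> U" using S_X cb disc_interior[OF l(1)] unfolding U_def by fastforce
    have "openin X U"
    proof -
      have "openin (top_of_set (cball 0 1)) {z \<in> cball 0 1. \<Phi> k z \<in> U}" if k: "k < r" for k
      proof -
        have "\<Phi> k z \<in> topspace X" if "z \<in> cball 0 1" for z
          using continuous_map_image_subset_topspace[OF disc_continuous[OF k]] that by auto
        then have "\<Phi> k z \<in> U \<longleftrightarrow> \<not> (k = l \<and> z \<in> cball 0 \<rho>)" if "z \<in> cball 0 1" for z
          using disc_mem_iff[OF l(1) k cb, of z] that unfolding U_def by simp
        then have "{z \<in> cball 0 1. \<Phi> k z \<in> U} = cball 0 1 \<inter> (if k = l then - cball 0 \<rho> else UNIV)"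
          by auto
        moreover have "open (if k = l then - cball 0 \<rho> else (UNIV :: complex set))" by auto
        ultimately show ?thesis by (simp add: openin_open_Int)
      qed
      moreover have "openin (subtopology X S) (U \<inter> S)"
        using SU S_X by (metis inf.absorb2 openin_topspace topspace_subtopology_subset)
      ultimately show ?thesis using openin_iff[of U] by (simp add: U_def)
    qed
    moreover have "openin X (\<Phi> l ` ball 0 \<rho>)" using disc_open[OF l(1) _ bb] by simp
    moreover have "p \<in> U" "q \<in> \<Phi> l ` ball 0 \<rho>" using p SU l(3) \<rho> by auto
    moreover have "disjnt U (\<Phi> l ` ball 0 \<rho>)" by (auto simp: U_def disjnt_iff)
    ultimately show ?thesis by blast
  qed
  consider "p \<in> S" "q \<in> S" | "p \<in> S" "q \<in> topspace X - S" | "p \<in> topspace X - S" "q \<in> S"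
    | "p \<in> topspace X - S" "q \<in> topspace X - S" using pq by blast
  then show "?sep p q"
  proof cases
    case 1
    then have "p \<in> topspace (subtopology X S)" "q \<in> topspace (subtopology X S)" using S_X by auto
    then obtain A B where AB: "openin (subtopology X S) A" "openin (subtopology X S) B" "p \<in> A" "q \<in> B" "disjnt A B"
      using HS pq unfolding Hausdorff_space_def by metis
    have "A \<subseteq> S" "B \<subseteq> S" using AB openin_subset by fastforce+
    then have "disjnt (thicken A) (thicken B)" using disjoint_thicken AB(5) by (simp add: disjnt_def)
    moreover have "p \<in> thicken A" "q \<in> thicken B" using AB by (auto simp: thicken_def)
    ultimately show ?thesis using openin_thicken AB(1,2) by blast
  next
    case 2
    then show ?thesis using mixed by blast
  next
    case 3
    then show ?thesis using mixed[of q p] by (metis disjnt_sym)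
  next
    case 4
    obtain l z where l: "l < r" "z \<in> ball 0 1" "p = \<Phi> l z" using out[OF 4(1)] by blast
    obtain k y where k: "k < r" "y \<in> ball 0 1" "q = \<Phi> k y" using out[OF 4(2)] by blast
    obtain U V where UV: "open U" "open V" "U \<subseteq> ball 0 1" "V \<subseteq> ball 0 1" "z \<in> U" "y \<in> V" "l \<noteq> k \<or> U \<inter> V = {}"
    proof (cases "l = k")
      case True
      then have "z \<noteq> y" using l k pq by blast
      then obtain U V where "open U" "open V" "z \<in> U" "y \<in> V" "U \<inter> V = {}" using separation_t2[of z y] by blast
      then show ?thesis using that[of "U \<inter> ball 0 1" "V \<inter> ball 0 1"] l k by auto
    next
      case False
      then show ?thesis using that[of "ball 0 1" "ball 0 1"] l k by auto
    qed
    have "disjnt (\<Phi> l ` U) (\<Phi> k ` V)"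
      unfolding disjnt_iff
    proof (intro allI notI)
      fix x assume x: "x \<in> \<Phi> l ` U \<and> x \<in> \<Phi> k ` V"
      then obtain b where b: "b \<in> V" "x = \<Phi> k b" by blast
      then have "cmod b \<le> 1" using UV(4) by (auto dest: subsetD)
      then have "k = l \<and> b \<in> U" using disc_mem_iff[OF l(1) k(1) UV(3), of b] x b(2) by simp
      then show False using UV(7) b(1) by blast
    qed
    then show ?thesis using disc_open l k UV by blast
  qed
qed

end

lemma cis_eq_minus_1_iff:
  assumes "\<bar>\<tau>\<bar> \<le> 1" shows "cis (pi * \<tau>) = - 1 \<longleftrightarrow> \<bar>\<tau>\<bar> = 1"
proof
  assume "cis (pi * \<tau>) = - 1"
  then have "cos (pi * \<tau>) = - 1" by (simp add: complex_eq_iff)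
  then have c: "cos (pi * \<bar>\<tau>\<bar>) = - 1" by (cases "\<tau> \<ge> 0") simp_all
  show "\<bar>\<tau>\<bar> = 1"
  proof (rule ccontr)
    assume "\<bar>\<tau>\<bar> \<noteq> 1"
    then have "cos pi < cos (pi * \<bar>\<tau>\<bar>)" using assms by (intro cos_monotone_0_pi) auto
    then show False using c by simp
  qed
next
  assume "\<bar>\<tau>\<bar> = 1"
  then have "\<tau> = 1 \<or> \<tau> = -1" by auto
  then show "cis (pi * \<tau>) = - 1" by (auto simp: complex_eq_iff)
qed

lemma cis_inj_open:
  assumes "\<bar>\<tau>\<bar> < 1" "\<bar>\<sigma>\<bar> < 1" "cis (pi * \<tau>) = cis (pi * \<sigma>)" shows "\<tau> = \<sigma>"
proof -
  have "Arg (cis (pi * x)) = pi * x" if "\<bar>x\<bar> < 1" for x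
  proof (rule Arg_cis)
    have "- pi < pi * x" "pi * x < pi"
      using mult_strict_left_mono[of "-1" x pi] mult_strict_left_mono[of x 1 pi] that by auto
    then show "pi * x \<in> {-pi<..pi}" by simp
  qed
  then show ?thesis using assms by (metis mult_cancel_left pi_neq_zero)
qed

text \<open>The \<open>j\<close>-th arc is \<open>- cis (pi * \<tau>)\<close> on the \<open>j\<close>-th circle. The sign puts the wedge point \<open>1\<close> at the ends
  \<open>\<tau> = 1\<close> and \<open>\<tau> = -1\<close>.\<close>

lemma two_complex_over_bouquet_cells:
  assumes "two_complex_over_bouquet X e w r"
  obtains S \<kappa> \<Phi> where "two_cell_complex X S e w r \<kappa> \<Phi>"
proof -
  obtain S h \<Phi> where h: "homeomorphic_map (bouquet w) (subtopology X S) h" and he: "h (wedge_point w) = e"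
    and att: "attach_two_cells X S r \<Phi>"
    using assms unfolding two_complex_over_bouquet_def by blast
  let ?W = "wedge_point w"
  have "Hausdorff_space (subtopology X S)"
    using homeomorphic_map_imp_homeomorphic_space[OF h] homeomorphic_Hausdorff_space Hausdorff_bouquet by blast
  with att interpret attached_cells X S r \<Phi> by unfold_locales
  have topB: "topspace (bouquet w) = insert ?W (collapse_map ?W ` ({..<w} \<times> sphere 0 1))"
    unfolding bouquet_def topspace_collapse topspace_circles ..
  have h_inj: "inj_on h (topspace (bouquet w))" using homeomorphic_imp_injective_map[OF h] .
  have h_S: "h ` topspace (bouquet w) = S"
    using homeomorphic_imp_surjective_map[OF h] S_X by auto
  define c where "c j \<tau> = collapse_map ?W (j, - cis (pi * \<tau>))" for j :: nat and \<tau> :: real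
  define \<kappa> where "\<kappa> j \<tau> = h (c j \<tau>)" for j \<tau>
  have c_top: "c j \<tau> \<in> topspace (bouquet w)" if "j < w" for j \<tau>
    using that unfolding topB c_def by auto
  have W_top: "?W \<in> topspace (bouquet w)" unfolding topB by simp
  have c_W: "c j \<tau> = ?W \<longleftrightarrow> \<bar>\<tau>\<bar> = 1" if "j < w" "\<bar>\<tau>\<bar> \<le> 1" for j \<tau>
  proof -
    have "c j \<tau> = ?W \<longleftrightarrow> - cis (pi * \<tau>) = 1"
      unfolding c_def wedge_eq_iff using that(1) by (simp add: wedge_point_def)
    also have "\<dots> \<longleftrightarrow> cis (pi * \<tau>) = - 1" by (metis minus_minus)
    finally have "c j \<tau> = ?W \<longleftrightarrow> cis (pi * \<tau>) = - 1" .
    then show ?thesis using cis_eq_minus_1_iff[OF that(2)] by simp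
  qed
  have "two_cell_complex X S e w r \<kappa> \<Phi>"
  proof
    show "continuous_map (top_of_set {-1..1}) X (\<kappa> j)" if j: "j < w" for j
    proof -
      have 1: "continuous_map (top_of_set {-1..1}) (top_of_set (sphere 0 1)) (\<lambda>\<tau>. - cis (pi * \<tau>))"
        by (auto intro!: continuous_intros)
      have 2: "continuous_map (top_of_set (sphere 0 1)) (circles w) (\<lambda>z. (j, z))"
        using continuous_map_component_injection[of j "{..<w}" "\<lambda>_. top_of_set (sphere (0::complex) 1)"] j by simp
      have 3: "continuous_map (circles w) (bouquet w) (collapse_map ?W)"
        unfolding bouquet_def by (rule continuous_map_collapse_map)
      have 4: "continuous_map (bouquet w) X h"
        using homeomorphic_imp_continuous_map[OF h] continuous_map_into_fulltopology by blast
      show ?thesis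
        using continuous_map_compose[OF continuous_map_compose[OF continuous_map_compose[OF 1 2] 3] 4]
        unfolding o_def \<kappa>_def c_def .
    qed
    show "\<kappa> j \<tau> = e \<longleftrightarrow> \<bar>\<tau>\<bar> = 1" if "j < w" "\<bar>\<tau>\<bar> \<le> 1" for j \<tau>
      using c_W[OF that] inj_on_eq_iff[OF h_inj c_top[OF that(1)] W_top] unfolding \<kappa>_def he[symmetric] by blast
    show "j = k \<and> \<tau> = \<sigma>" if "j < w" "k < w" "\<bar>\<tau>\<bar> < 1" "\<bar>\<sigma>\<bar> < 1" "\<kappa> j \<tau> = \<kappa> k \<sigma>" for j k \<tau> \<sigma>
    proof -
      have "c j \<tau> = c k \<sigma>" using inj_onD[OF h_inj that(5)[unfolded \<kappa>_def]] c_top that by blast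
      moreover have "c j \<tau> \<noteq> ?W" using c_W[of j \<tau>] that by simp
      ultimately have "(j, - cis (pi * \<tau>)) = (k, - cis (pi * \<sigma>))"
        unfolding c_def wedge_eq_iff collapse_map_eq_iff by blast
      then show ?thesis using cis_inj_open[OF that(3,4)] by simp
    qed
    have "z \<in> (\<lambda>\<tau>. - cis (pi * \<tau>)) ` {-1..1}" if "z \<in> sphere 0 1" for z
    proof (rule image_eqI)
      have "- z \<noteq> 0" "cmod (- z) = 1" using that by auto
      then show "z = - cis (pi * (Arg (- z) / pi))" using cis_Arg[of "- z"] by (simp add: sgn_div_norm)
      show "Arg (- z) / pi \<in> {-1..1}" using Arg_bounded[of "- z"] by (auto simp: field_simps)
    qed
    then have sph: "(\<lambda>\<tau>. - cis (pi * \<tau>)) ` {-1..1} = sphere 0 1" by auto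
    have "collapse_map ?W ` ({..<w} \<times> sphere 0 1) = (\<Union>j<w. c j ` {-1..1})"
      unfolding sph[symmetric] c_def by auto
    then show "S = insert e (\<Union>j<w. \<kappa> j ` {-1..1})"
      unfolding h_S[symmetric] topB \<kappa>_def he[symmetric] by (simp add: image_UN image_image)
  qed (use Hausdorff_X closed_S disc_continuous disc_boundary disc_interior disc_inj disc_cover disc_open in \<open>blast+\<close>)
  then show ?thesis by (rule that)
qed

theorem proposition1p4:
  fixes X :: "'a topology" and e :: 'a and w r n :: nat
  assumes "two_complex_over_bouquet X e w r"
    and "n \<ge> 1"
  shows "m_connected (2 * n - min w n - 1) (reduced_sym_prod n X e)"
proof -
  obtain S \<kappa> \<Phi> where "two_cell_complex X S e w r \<kappa> \<Phi>"
    using two_complex_over_bouquet_cells[OF assms(1)] .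
  then interpret two_cell_complex X S e w r \<kappa> \<Phi> .
  show ?thesis
    using cell_charts.m_connected_reduced_sym_prod[OF is_cell_charts assms(2)] unfolding card_centres .
qed

end
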